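(* Let $\Omega\subset\mathbb{R}^{\mathrm{d}}$ be a bounded Lipschitz polyhedral domain and let $\{\mathcal{T}_h\}_{h>0}$ be a shape-regular sequence of geometrically conformal affine simplicial meshes of $\Omega$ of mesh size $h$. Suppose that $\alpha\in C(\overline\Omega)$ satisfies $\inf_{x\in\Omega}\alpha(x)>0$, let $N\in\mathbb{N}$, and let $1\le p\le+\infty$. Then the sets $$\mathbf{K}^1_h:=\{w\in(H_h)^N:|w(x_T)|_{\ell^p}\le\alpha(x_T)\ \text{for all }T\in\mathcal{T}_h\},$$ $$\mathbf{K}^2_h:=\{w\in(H_h)^N:|w(x)|_{\ell^p}\le\alpha(x)\ \text{for all }x\in\mathcal{N}_h\}$$ each Mosco-converge for $h\to0$ to the set $$\mathbf{K}=\{w\in H^1(\Omega)^N:|w|_{\ell^p}\le\alpha\ \text{a.e. in }\Omega\}$$ in $H^1(\Omega)^N$.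
   Context: The mesh size of $\mathcal{T}_h$ is $h=\max_{T\in\mathcal{T}_h}\mathrm{diam}(T)$. Shape-regularity: there is $c>0$ such that $\mathrm{diam}(T)/\rho_T\le c$ for all $h$ and all $T\in\mathcal{T}_h$, where $\rho_T$ is the diameter of the largest ball contained in $T$. For $T\in\mathcal{T}_h$, $x_T$ denotes the (barycentric) midpoint of $T$; $\mathcal{N}_h$ is the set of nodes (vertices) of $\mathcal{T}_h$. The space of continuous piecewise affine functions is $$H_h:=\{u\in C(\overline\Omega):u|_T\in\mathbb{P}_1\ \forall T\in\mathcal{T}_h\},$$ with $\mathbb{P}_1$ the polynomials of degree at most one. $|\cdot|_{\ell^p}$ is the $\ell^p$-norm on $\mathbb{R}^N$. Mosco convergence: let $\mathbf{K}$ and $\mathbf{K}_n$ ($n\in\mathbb{N}$) be non-empty, closed, convex subsets of a Banach space $V$. The sequence $\{\mathbf{K}_n\}$ converges to $\mathbf{K}$ in the sense of Mosco if: (I) for each $w\in\mathbf{K}$ there exists $\{w_{n'}\}$ with $w_{n'}\in\mathbf{K}_{n'}$ for $n'\in\mathbb{N}'$, where $\mathbb{N}'\subset\mathbb{N}$ is infinite, such that $w_{n'}\to w$ in $V$; (II) if $w_n\in\mathbf{K}_n$ and $w_n\rightharpoonup w$ weakly in $V$ along a subsequence, then $w\in\mathbf{K}$. A family $\{\mathbf{K}_h\}$ Mosco-converges to $\mathbf{K}$ for $h\to0$ if $\mathbf{K}_{h_n}$ converges to $\mathbf{K}$ in the sense of Mosco for any sequence of mesh sizes $h_n\to0$. 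*)

theory Defs
  imports "HOL-Analysis.Analysis" "HOL-Library.Function_Algebras" "HOL-Library.Extended_Real"
begin

text \<open>Pointwise vector space structure on functions, so that \<^const>\<open>convex\<close> and
  \<^const>\<open>linear\<close> apply to function spaces.\<close>

instantiation "fun" :: (type, real_vector) real_vector
begin

definition scaleR_fun :: "real \<Rightarrow> ('a \<Rightarrow> 'b) \<Rightarrow> 'a \<Rightarrow> 'b"
  where "scaleR_fun c f = (\<lambda>x. c *\<^sub>R f x)"

instance
  by standard (simp_all add: scaleR_fun_def fun_eq_iff scaleR_add_right scaleR_add_left)

end


subsection \<open>Mosco convergence\<close>

text \<open>A normed space is given by a linear subspace \<open>V\<close> of a real vector space together with a
  function \<open>nrm\<close> on it. Only a seminorm is needed: elements at distance zero (functions
  agreeing almost everywhere) play the role of equal elements, and closed sets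
  are automatically saturated under this identification.\<close>

definition strongly_converges :: "('v::real_vector \<Rightarrow> real) \<Rightarrow> (nat \<Rightarrow> 'v) \<Rightarrow> 'v \<Rightarrow> bool"
  where "strongly_converges nrm u w \<longleftrightarrow> (\<lambda>k. nrm (u k - w)) \<longlonglongrightarrow> 0"

text \<open>Every linear functional on the subspace \<open>V\<close> is the restriction of a linear functional on the
  whole vector space, so the functionals below restrict to exactly the topological dual of \<open>V\<close>.\<close>

definition weakly_converges ::
    "'v::real_vector set \<Rightarrow> ('v \<Rightarrow> real) \<Rightarrow> (nat \<Rightarrow> 'v) \<Rightarrow> 'v \<Rightarrow> bool"
  where "weakly_converges V nrm u w \<longleftrightarrow>
    (\<forall>\<phi>::'v \<Rightarrow> real. linear \<phi> \<and> (\<exists>C. \<forall>v\<in>V. \<bar>\<phi> v\<bar> \<le> C * nrm v) \<longrightarrow> (\<lambda>k. \<phi> (u k)) \<longlonglongrightarrow> \<phi> w)"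

definition nonempty_closed_convex :: "'v::real_vector set \<Rightarrow> ('v \<Rightarrow> real) \<Rightarrow> 'v set \<Rightarrow> bool"
  where "nonempty_closed_convex V nrm K \<longleftrightarrow>
    K \<noteq> {} \<and> K \<subseteq> V \<and> convex K \<and>
    (\<forall>u. \<forall>w\<in>V. (\<forall>k. u k \<in> K) \<and> strongly_converges nrm u w \<longrightarrow> w \<in> K)"

text \<open>Infinite subsets of the index set are enumerated by strictly increasing sequences. The
  recovery sequences in the first condition are only required along such a subset.\<close>

definition mosco_converges ::
    "'v::real_vector set \<Rightarrow> ('v \<Rightarrow> real) \<Rightarrow> (nat \<Rightarrow> 'v set) \<Rightarrow> 'v set \<Rightarrow> bool"
  where "mosco_converges V nrm Kn K \<longleftrightarrow>
    nonempty_closed_convex V nrm K \<and> (\<forall>n. nonempty_closed_convex V nrm (Kn n)) \<and>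
    (\<forall>w\<in>K. \<exists>r::nat \<Rightarrow> nat. strict_mono r \<and>
       (\<exists>u. (\<forall>k. u k \<in> Kn (r k)) \<and> strongly_converges nrm u w)) \<and>
    (\<forall>(r::nat \<Rightarrow> nat) u. \<forall>w\<in>V. strict_mono r \<and> (\<forall>k. u k \<in> Kn (r k)) \<and>
       weakly_converges V nrm u w \<longrightarrow> w \<in> K)"

text \<open>\<open>H\<close> is the set of available mesh sizes.\<close>

definition mosco_converges_mesh ::
    "'v::real_vector set \<Rightarrow> ('v \<Rightarrow> real) \<Rightarrow> real set \<Rightarrow> (real \<Rightarrow> 'v set) \<Rightarrow> 'v set \<Rightarrow> bool"
  where "mosco_converges_mesh V nrm H Kh K \<longleftrightarrow>
    (\<forall>h::nat \<Rightarrow> real. (\<forall>n. h n \<in> H) \<and> h \<longlonglongrightarrow> 0 \<longrightarrow> mosco_converges V nrm (\<lambda>n. Kh (h n)) K)"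


subsection \<open>Sobolev spaces\<close>

definition partial_deriv :: "'d::finite \<Rightarrow> (real^'d \<Rightarrow> real) \<Rightarrow> real^'d \<Rightarrow> real"
  where "partial_deriv i f x = frechet_derivative f (at x) (axis i 1)"

primrec C_k :: "nat \<Rightarrow> (real^'d::finite \<Rightarrow> real) \<Rightarrow> bool"
  where
    "C_k 0 f \<longleftrightarrow> continuous_on UNIV f"
  | "C_k (Suc k) f \<longleftrightarrow> (\<forall>x. f differentiable (at x)) \<and> (\<forall>i. C_k k (partial_deriv i f))"

definition test_function :: "(real^'d::finite) set \<Rightarrow> (real^'d \<Rightarrow> real) \<Rightarrow> bool"
  where "test_function \<Omega> \<phi> \<longleftrightarrow>
    (\<forall>k. C_k k \<phi>) \<and> compact (closure {x. \<phi> x \<noteq> 0}) \<and> closure {x. \<phi> x \<noteq> 0} \<subseteq> \<Omega>"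

definition L2 :: "(real^'d::finite) set \<Rightarrow> (real^'d \<Rightarrow> 'b::euclidean_space) set"
  where "L2 \<Omega> = {u. u \<in> borel_measurable (lebesgue_on \<Omega>) \<and>
    integrable (lebesgue_on \<Omega>) (\<lambda>x. (norm (u x))\<^sup>2)}"

text \<open>Meant for functions \<open>u\<close> and \<open>G\<close> in \<open>L2 \<Omega>\<close>, for which all integrands are integrable.\<close>

definition is_weak_gradient ::
    "(real^'d::finite) set \<Rightarrow> (real^'d \<Rightarrow> real) \<Rightarrow> (real^'d \<Rightarrow> real^'d) \<Rightarrow> bool"
  where "is_weak_gradient \<Omega> u G \<longleftrightarrow> (\<forall>\<phi> i. test_function \<Omega> \<phi> \<longrightarrow>
    (LINT x|lebesgue_on \<Omega>. u x * partial_deriv i \<phi> x) =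
    - (LINT x|lebesgue_on \<Omega>. G x $ i * \<phi> x))"

definition H1 :: "(real^'d::finite) set \<Rightarrow> (real^'d \<Rightarrow> real) set"
  where "H1 \<Omega> = {u \<in> L2 \<Omega>. \<exists>G\<in>L2 \<Omega>. is_weak_gradient \<Omega> u G}"

text \<open>The weak gradient is determined up to null sets, so the choice does not affect the norm.\<close>

definition weak_gradient :: "(real^'d::finite) set \<Rightarrow> (real^'d \<Rightarrow> real) \<Rightarrow> real^'d \<Rightarrow> real^'d"
  where "weak_gradient \<Omega> u = (SOME G. G \<in> L2 \<Omega> \<and> is_weak_gradient \<Omega> u G)"

definition H1_norm :: "(real^'d::finite) set \<Rightarrow> (real^'d \<Rightarrow> real) \<Rightarrow> real"
  where "H1_norm \<Omega> u = sqrt ((LINT x|lebesgue_on \<Omega>. (u x)\<^sup>2) +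
    (LINT x|lebesgue_on \<Omega>. (norm (weak_gradient \<Omega> u x))\<^sup>2))"

definition H1_vec :: "(real^'d::finite) set \<Rightarrow> (real^'d \<Rightarrow> real^'n::finite) set"
  where "H1_vec \<Omega> = {w. \<forall>i. (\<lambda>x. w x $ i) \<in> H1 \<Omega>}"

definition H1_vec_norm :: "(real^'d::finite) set \<Rightarrow> (real^'d \<Rightarrow> real^'n::finite) \<Rightarrow> real"
  where "H1_vec_norm \<Omega> w = sqrt (\<Sum>i\<in>UNIV. (H1_norm \<Omega> (\<lambda>x. w x $ i))\<^sup>2)"

text \<open>All representatives of the almost-everywhere classes of the members of \<open>S\<close>; this is how a set
  of genuine functions (such as finite element functions) is viewed as a subset of a Sobolev
  space.\<close>

definition ae_classes :: "(real^'d::finite) set \<Rightarrow> (real^'d \<Rightarrow> 'b) set \<Rightarrow> (real^'d \<Rightarrow> 'b) set"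
  where "ae_classes \<Omega> S = {w. \<exists>v\<in>S. AE x in lebesgue_on \<Omega>. w x = v x}"


subsection \<open>Domains and meshes\<close>

text \<open>Near each boundary point, \<open>\<Omega>\<close> is the strict epigraph, in some direction \<open>e\<close>, of a Lipschitz
  function \<open>\<gamma>\<close> on the hyperplane orthogonal to \<open>e\<close>.\<close>

definition lipschitz_boundary :: "(real^'d::finite) set \<Rightarrow> bool"
  where "lipschitz_boundary \<Omega> \<longleftrightarrow> (\<forall>x\<in>frontier \<Omega>. \<exists>r>0. \<exists>e L \<gamma>. norm e = 1 \<and>
    L-lipschitz_on {z. e \<bullet> z = 0} \<gamma> \<and>
    (\<forall>y\<in>ball x r. y \<in> \<Omega> \<longleftrightarrow> \<gamma> (y - (e \<bullet> y) *\<^sub>R e) < e \<bullet> y))"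

definition polyhedral :: "(real^'d::finite) set \<Rightarrow> bool"
  where "polyhedral \<Omega> \<longleftrightarrow> (\<exists>F. finite F \<and> (\<forall>P\<in>F. polytope P) \<and> closure \<Omega> = \<Union>F)"

text \<open>By \<^const>\<open>triangulation\<close>, any two cells meet in a common (possibly empty) face.\<close>

definition conformal_simplicial_mesh :: "(real^'d::finite) set \<Rightarrow> (real^'d) set set \<Rightarrow> bool"
  where "conformal_simplicial_mesh \<Omega> \<T> \<longleftrightarrow>
    triangulation \<T> \<and> (\<forall>T\<in>\<T>. int CARD('d) simplex T) \<and> \<Union>\<T> = closure \<Omega>"

definition mesh_size :: "(real^'d::finite) set set \<Rightarrow> real"
  where "mesh_size \<T> = Max (diameter ` \<T>)"

definition inball_diameter :: "(real^'d::finite) set \<Rightarrow> real"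
  where "inball_diameter T = Sup {diameter (cball x r) | x r. cball x r \<subseteq> T}"

definition shape_regular :: "real set \<Rightarrow> (real \<Rightarrow> (real^'d::finite) set set) \<Rightarrow> bool"
  where "shape_regular H \<T> \<longleftrightarrow>
    (\<exists>c>0. \<forall>h\<in>H. \<forall>T\<in>\<T> h. diameter T / inball_diameter T \<le> c)"

definition vertices :: "(real^'d::finite) set \<Rightarrow> (real^'d) set"
  where "vertices T = {v. v extreme_point_of T}"

definition midpoint_of :: "(real^'d::finite) set \<Rightarrow> real^'d"
  where "midpoint_of T = (1 / real (card (vertices T))) *\<^sub>R (\<Sum>v\<in>vertices T. v)"

definition mesh_nodes :: "(real^'d::finite) set set \<Rightarrow> (real^'d) set"
  where "mesh_nodes \<T> = (\<Union>T\<in>\<T>. vertices T)"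

definition P1_elements :: "(real^'d::finite) set \<Rightarrow> (real^'d) set set \<Rightarrow> (real^'d \<Rightarrow> real) set"
  where "P1_elements \<Omega> \<T> = {u. continuous_on (closure \<Omega>) u \<and>
    (\<forall>T\<in>\<T>. \<exists>a b. \<forall>x\<in>T. u x = a \<bullet> x + b)}"


subsection \<open>Constraint sets\<close>

definition lp_norm :: "ereal \<Rightarrow> real^'n::finite \<Rightarrow> real"
  where "lp_norm p x =
    (if p = \<infinity> then MAX i. \<bar>x $ i\<bar>
     else (\<Sum>i\<in>UNIV. \<bar>x $ i\<bar> powr real_of_ereal p) powr (1 / real_of_ereal p))"

definition K_cont ::
    "(real^'d::finite) set \<Rightarrow> ereal \<Rightarrow> (real^'d \<Rightarrow> real) \<Rightarrow> (real^'d \<Rightarrow> real^'n::finite) set"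
  where "K_cont \<Omega> p \<alpha> = {w \<in> H1_vec \<Omega>. AE x in lebesgue_on \<Omega>. lp_norm p (w x) \<le> \<alpha> x}"

definition K_midpoint ::
    "(real^'d::finite) set \<Rightarrow> (real^'d) set set \<Rightarrow> ereal \<Rightarrow> (real^'d \<Rightarrow> real) \<Rightarrow>
      (real^'d \<Rightarrow> real^'n::finite) set"
  where "K_midpoint \<Omega> \<T> p \<alpha> = {w. (\<forall>i. (\<lambda>x. w x $ i) \<in> P1_elements \<Omega> \<T>) \<and>
    (\<forall>T\<in>\<T>. lp_norm p (w (midpoint_of T)) \<le> \<alpha> (midpoint_of T))}"

definition K_nodal ::
    "(real^'d::finite) set \<Rightarrow> (real^'d) set set \<Rightarrow> ereal \<Rightarrow> (real^'d \<Rightarrow> real) \<Rightarrow>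
      (real^'d \<Rightarrow> real^'n::finite) set"
  where "K_nodal \<Omega> \<T> p \<alpha> = {w. (\<forall>i. (\<lambda>x. w x $ i) \<in> P1_elements \<Omega> \<T>) \<and>
    (\<forall>x\<in>mesh_nodes \<T>. lp_norm p (w x) \<le> \<alpha> x)}"

end

theory Submission
  imports Defs
begin

text \<open>
  Recovery sequences: by the Lipschitz property, near every point of the closure of the domain some
  fixed direction points into the domain. Shifting along these directions, mollifying and gluing with
  a \<open>C\<^sup>1\<close> partition of unity turns a member of \<open>K\<close> into a function that is
  \<open>C\<^sup>1\<close> up to the boundary; the constraint is convex, so averaging violates it by at most the
  oscillation of \<open>\<alpha>\<close> at small scale.
  Since \<open>\<alpha>\<close> is bounded away from zero, multiplying by a constant slightly below \<open>1\<close> creates a uniform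
  gap in the constraint, which absorbs the error of nodal interpolation.

  Weak limits: a discrete function differs on each cell from its value at a point where
  the constraint is imposed by at most the mesh size times its gradient. Weakly convergent gradients
  are bounded in \<open>L\<^sup>1\<close>, so this difference disappears in the limit. Testing with the closed
  half-spaces that contain the cone of all \<open>(v, t)\<close> with \<open>|v| \<le> t\<close> gives the constraint for the limit.

  Closedness of the discrete sets holds because affine functions that converge almost everywhere on a
  simplex converge everywhere, to an affine function.
\<close>


subsection \<open>Smooth bump functions and mollifiers\<close>

text \<open>Nodal values require a continuous function, so a member of \<open>K_cont\<close> has to
  be smoothed first. Plain mollification near the boundary would average over points outside the
  domain, where no constraint is known; averaging around a point moved inwards uses inner values
  only. Gluing is a convex combination at each point, so it respects the constraint too. The
  recovered functions satisfy the constraint on the whole closure and not just at selected points,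
  so both discrete sets can be treated as one family: P1 functions constrained on a point set that
  lies in the closure and meets every cell. The first property serves the recovery sequences, the
  second the weak limits. For the latter no compact embedding is invoked: tested by a half-space and
  integrated against a bounded weight, the constraint is linear in the function, and weak
  convergence suffices. Bounded weights also explain why the gradients are bounded in L1: this
  follows from convergence of the integrals by an elementary gliding hump argument.\<close>

definition grad :: "(real^'d::finite \<Rightarrow> real) \<Rightarrow> real^'d \<Rightarrow> real^'d"
  where "grad f x = (\<chi> i. partial_deriv i f x)"

lemma partial_deriv_eq:
  assumes "(f has_derivative f') (at x)"
  shows "partial_deriv i f x = f' (axis i 1)"
  unfolding partial_deriv_def using frechet_derivative_at[OF assms] by simp

lemma linear_real_eq_inner:
  fixes f :: "real^'d::finite \<Rightarrow> real"
  assumes "linear f"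
  shows "f v = (\<chi> i. f (axis i 1)) \<bullet> v"
proof -
  have "f v = f (\<Sum>i\<in>UNIV. (v $ i) *s axis i 1)"
    by (simp add: basis_expansion)
  also have "\<dots> = (\<Sum>i\<in>UNIV. v $ i * f (axis i 1))"
    by (simp add: linear_sum[OF assms] scalar_mult_eq_scaleR linear_scale[OF assms])
  also have "\<dots> = (\<chi> i. f (axis i 1)) \<bullet> v"
    by (simp add: inner_vec_def mult.commute)
  finally show ?thesis .
qed

lemma has_derivative_grad:
  assumes "f differentiable (at x)"
  shows "(f has_derivative (\<lambda>v. grad f x \<bullet> v)) (at x)"
proof -
  obtain f' where f': "(f has_derivative f') (at x)" using assms by (auto simp: differentiable_def)
  have "grad f x = (\<chi> i. f' (axis i 1))"
    unfolding grad_def using partial_deriv_eq[OF f'] by simp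
  then have "f' = (\<lambda>v. grad f x \<bullet> v)"
    using linear_real_eq_inner[OF has_derivative_linear[OF f']] by metis
  with f' show ?thesis by simp
qed

lemma partial_deriv_inner:
  assumes "(f has_derivative (\<lambda>v. g \<bullet> v)) (at x)"
  shows "partial_deriv i f x = g $ i"
  using partial_deriv_eq[OF assms] by (simp add: inner_axis)

lemma C_k_mono: "C_k (Suc k) f \<Longrightarrow> C_k k f"
proof (induction k arbitrary: f)
  case 0
  then have "\<And>x. continuous (at x) f"
    by (simp add: differentiable_imp_continuous_within)
  then show ?case by (simp add: continuous_on_eq_continuous_at)
next
  case (Suc k)
  then show ?case by (meson C_k.simps(2))
qed

lemma partial_deriv_add:
  assumes "f differentiable (at x)" "g differentiable (at x)"
  shows "partial_deriv i (\<lambda>x. f x + g x) x = partial_deriv i f x + partial_deriv i g x"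
  using partial_deriv_eq[OF has_derivative_add[OF has_derivative_grad[OF assms(1)] has_derivative_grad[OF assms(2)]]]
  by (simp add: inner_axis grad_def)

lemma partial_deriv_mult:
  assumes "f differentiable (at x)" "g differentiable (at x)"
  shows "partial_deriv i (\<lambda>x. f x * g x) x = f x * partial_deriv i g x + partial_deriv i f x * g x"
  using partial_deriv_eq[OF has_derivative_mult[OF has_derivative_grad[OF assms(1)] has_derivative_grad[OF assms(2)]]]
  by (simp add: inner_axis grad_def)

lemma C_k_add: "C_k k f \<Longrightarrow> C_k k g \<Longrightarrow> C_k k (\<lambda>x. f x + g x)"
proof (induction k arbitrary: f g)
  case 0
  then show ?case by (simp add: continuous_on_add)
next
  case (Suc k)
  have "partial_deriv i (\<lambda>x. f x + g x) = (\<lambda>x. partial_deriv i f x + partial_deriv i g x)" for i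
    using Suc.prems by (auto simp: fun_eq_iff partial_deriv_add)
  with Suc show ?case by simp
qed

lemma C_k_mult: "C_k k f \<Longrightarrow> C_k k g \<Longrightarrow> C_k k (\<lambda>x. f x * g x)"
proof (induction k arbitrary: f g)
  case 0
  then show ?case by (simp add: continuous_on_mult)
next
  case (Suc k)
  have *: "partial_deriv i (\<lambda>x. f x * g x) = (\<lambda>x. f x * partial_deriv i g x + partial_deriv i f x * g x)" for i
    using Suc.prems by (auto simp: fun_eq_iff partial_deriv_mult)
  have "C_k k f" "C_k k g" using Suc.prems C_k_mono by blast+
  with Suc show ?case unfolding C_k.simps * by (auto intro!: C_k_add)
qed

lemma partial_deriv_const [simp]: "partial_deriv i (\<lambda>x. c) = (\<lambda>x. 0)"
  using partial_deriv_eq[OF has_derivative_const] by (auto simp: fun_eq_iff)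

lemma C_k_const: "C_k k (\<lambda>x. c)"
  by (induction k arbitrary: c) auto

lemma C_k_prod: "finite I \<Longrightarrow> (\<And>i. i \<in> I \<Longrightarrow> C_k k (f i)) \<Longrightarrow> C_k k
    (\<lambda>x. \<Prod>i\<in>I. f i x)"
  by (induction I rule: finite_induct) (auto intro: C_k_const C_k_mult)

section \<open>Smooth kernels with compact support\<close>

text \<open>The polynomial factor makes the family closed under differentiation: with s = 1/t one
  has ds/dt = -s^2, so the derivative of P(s) exp(-s) is s^2 (P(s) - P'(s)) exp(-s), again of this
  form. Smoothness of all orders then needs a single induction over \<open>k\<close> with
  \<open>P\<close> arbitrary.\<close>

definition expfun :: "real poly \<Rightarrow> real \<Rightarrow> real"
  where "expfun P t = (if t > 0 then poly P (1/t) * exp (- (1/t)) else 0)"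

lemma poly_over_exp_tendsto_0: "((\<lambda>s::real. poly P s * exp (- s)) \<longlongrightarrow> 0) at_top"
proof -
  have "((\<lambda>s. \<Sum>i\<le>degree P. coeff P i * (s ^ i / exp s)) \<longlongrightarrow> (\<Sum>i\<le>degree P. coeff P i * 0)) at_top"
    by (intro tendsto_sum tendsto_mult tendsto_const tendsto_power_div_exp_0)
  then show ?thesis
    by (simp add: poly_altdef exp_minus sum_divide_distrib divide_inverse sum_distrib_right mult.assoc)
qed

lemma expfun_tendsto_0: "(expfun P \<longlongrightarrow> 0) (at 0)"
proof -
  have "((\<lambda>t. poly P (inverse t) * exp (- inverse t)) \<longlongrightarrow> 0) (at_right 0)"
    using filterlim_compose[OF poly_over_exp_tendsto_0 filterlim_inverse_at_top_right] .
  then have 1: "(expfun P \<longlongrightarrow> 0) (at_right 0)"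
    by (rule Lim_transform_eventually)
       (auto simp: expfun_def eventually_at_filter inverse_eq_divide)
  have 2: "(expfun P \<longlongrightarrow> 0) (at_left 0)"
    by (rule Lim_transform_eventually[OF tendsto_const])
       (auto simp: expfun_def eventually_at_filter)
  from 1 2 show ?thesis by (simp add: filterlim_at_split)
qed

lemma expfun_has_derivative:
  "(expfun P has_real_derivative expfun ([:0,0,1:] * (P - pderiv P)) t) (at t)"
proof -
  consider "t > 0" | "t < 0" | "t = 0" by linarith
  then show ?thesis
  proof cases
    case 1
    have "((\<lambda>t. poly P (1/t) * exp (- (1/t))) has_real_derivative
        expfun ([:0,0,1:] * (P - pderiv P)) t) (at t)"
      using 1 by (auto intro!: derivative_eq_intros poly_DERIV[THEN DERIV_chain2]
          simp: expfun_def power2_eq_square field_simps)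
    then show ?thesis
      by (rule has_field_derivative_transform_within_open[where S="{0<..}"])
         (use 1 in \<open>auto simp: expfun_def\<close>)
  next
    case 2
    have "((\<lambda>t. 0) has_real_derivative expfun ([:0,0,1:] * (P - pderiv P)) t) (at t)"
      using 2 by (simp add: expfun_def)
    then show ?thesis
      by (rule has_field_derivative_transform_within_open[where S="{..<0}"])
         (use 2 in \<open>auto simp: expfun_def\<close>)
  next
    case 3
    \<comment> \<open>Dividing by h multiplies the polynomial by its variable 1/h, so the difference
      quotient at 0 is \<open>expfun (pCons 0 P)\<close>, which tends to 0.\<close>
    have "((\<lambda>h. (expfun P (0 + h) - expfun P 0) / h) \<longlongrightarrow> 0) (at 0)"
      by (rule Lim_transform_eventually[OF expfun_tendsto_0[of "pCons 0 P"]])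
         (auto simp: expfun_def eventually_at_filter)
    then have "(expfun P has_real_derivative 0) (at 0)" unfolding DERIV_def .
    then show ?thesis using 3 by (simp add: expfun_def)
  qed
qed

lemma expfun_affine_has_derivative:
  "((\<lambda>x. expfun P (l \<bullet> x + c)) has_derivative
     (\<lambda>v. (expfun ([:0,0,1:] * (P - pderiv P)) (l \<bullet> x + c) *\<^sub>R l) \<bullet> v)) (at x)"
proof -
  have "((\<lambda>x. l \<bullet> x + c) has_derivative (\<lambda>v. l \<bullet> v)) (at x)"
    by (auto intro!: derivative_eq_intros)
  from DERIV_compose_FDERIV[OF expfun_has_derivative this] show ?thesis
    by (simp add: mult.commute)
qed

lemma C_k_expfun: "C_k k (\<lambda>x. expfun P (l \<bullet> x + c))"
proof (induction k arbitrary: P)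
  case 0
  have "continuous (at x) (\<lambda>x. expfun P (l \<bullet> x + c))" for x
    using has_derivative_continuous[OF expfun_affine_has_derivative] .
  then show ?case by (simp add: continuous_on_eq_continuous_at)
next
  case (Suc k)
  have "partial_deriv i (\<lambda>x. expfun P (l \<bullet> x + c)) =
     (\<lambda>x. l $ i * expfun ([:0,0,1:] * (P - pderiv P)) (l \<bullet> x + c))" for i
    by (rule ext) (subst partial_deriv_inner[OF expfun_affine_has_derivative], simp)
  moreover have "(\<lambda>x. expfun P (l \<bullet> x + c)) differentiable (at x)" for x
    unfolding differentiable_def using expfun_affine_has_derivative by blast
  ultimately show ?case
    using Suc.IH by (auto intro!: C_k_mult C_k_const)
qed

text \<open>A product over the coordinates instead of a radial bump: every factor is
  \<open>expfun\<close> of an affine function, so smoothness follows from closure of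
  \<open>C_k\<close> under products. It is positive exactly on the open cube of half-side
  \<open>r\<close>.\<close>

definition box_bump :: "real \<Rightarrow> real^'d::finite \<Rightarrow> real"
  where "box_bump r x = (\<Prod>i\<in>UNIV. expfun 1 (r + x $ i) * expfun 1 (r - x $ i))"

lemma C_k_box_bump: "C_k k (box_bump r :: real^'d::finite \<Rightarrow> real)"
proof -
  have 1: "C_k k (\<lambda>x::real^'d. expfun 1 (r + x $ i))" for i
    using C_k_expfun[of k 1 "axis i 1" r] by (simp add: inner_axis' add.commute)
  have 2: "C_k k (\<lambda>x::real^'d. expfun 1 (r - x $ i))" for i
    using C_k_expfun[of k 1 "- axis i 1" r] by (simp add: inner_axis' add.commute)
  have "(box_bump r :: real^'d \<Rightarrow> real) = (\<lambda>x. \<Prod>i\<in>UNIV. expfun 1 (r + x $ i) * expfun 1 (r - x $ i))"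
    by (auto simp: box_bump_def)
  then show ?thesis by (auto intro!: C_k_prod C_k_mult 1 2)
qed

lemma expfun_1_nonneg: "0 \<le> expfun 1 t" by (simp add: expfun_def)

lemma box_bump_nonneg: "0 \<le> box_bump r x"
  unfolding box_bump_def by (intro prod_nonneg mult_nonneg_nonneg ballI expfun_1_nonneg)

lemma box_bump_pos_iff: "0 < box_bump r x \<longleftrightarrow> (\<forall>i. \<bar>x $ i\<bar> < r)"
proof
  assume *: "\<forall>i. \<bar>x $ i\<bar> < r"
  have "0 < r + x $ i \<and> 0 < r - x $ i" for i
    using *[rule_format, of i] by (auto simp: abs_less_iff)
  then show "0 < box_bump r x" unfolding box_bump_def
    by (intro prod_pos mult_pos_pos) (auto simp: expfun_def)
next
  assume *: "0 < box_bump r x"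
  show "\<forall>i. \<bar>x $ i\<bar> < r"
  proof
    fix i
    have "expfun 1 (r + x $ i) * expfun 1 (r - x $ i) \<noteq> 0"
      using * unfolding box_bump_def by (metis UNIV_I finite less_irrefl prod_zero)
    then show "\<bar>x $ i\<bar> < r" by (auto simp: expfun_def split: if_splits)
  qed
qed

lemma box_bump_zero: "r > 0 \<Longrightarrow> real CARD('d) * r \<le> norm x \<Longrightarrow> box_bump r (x::real^'d::finite) = 0"
proof (rule ccontr)
  assume r: "r > 0" "real CARD('d) * r \<le> norm x" "box_bump r x \<noteq> 0"
  then have "0 < box_bump r x" using box_bump_nonneg[of r x] by simp
  then have "\<forall>i. \<bar>x $ i\<bar> < r" by (simp add: box_bump_pos_iff)
  then have "(\<Sum>i\<in>UNIV. \<bar>x $ i\<bar>) < (\<Sum>i\<in>(UNIV::'d set). r)"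
    by (intro sum_strict_mono) auto
  moreover have "norm x \<le> (\<Sum>i\<in>UNIV. \<bar>x $ i\<bar>)" using norm_le_l1_cart[of x] by simp
  ultimately show False using r(2) by simp
qed

text \<open>A predicate rather than one fixed kernel: the later arguments use these properties only,
  and every patch of the boundary gets a kernel of its own radius.\<close>

definition mollifier :: "real \<Rightarrow> (real^'d::finite \<Rightarrow> real) \<Rightarrow> bool"
  where "mollifier r \<rho> \<longleftrightarrow> (\<forall>k. C_k k \<rho>) \<and> (\<forall>x. 0 \<le> \<rho> x)
      \<and> (\<forall>x. r \<le> norm x \<longrightarrow> \<rho> x = 0) \<and>
    integrable lborel \<rho> \<and> integral\<^sup>L lborel \<rho> = 1"

lemma C_kD_cont: "C_k k f \<Longrightarrow> continuous_on UNIV f"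
  by (induction k) (use C_k_mono in auto)

lemma integrable_cont_bounded_support:
  fixes f :: "'a::euclidean_space \<Rightarrow> real"
  assumes "continuous_on UNIV f" "\<And>x. r \<le> norm x \<Longrightarrow> f x = 0"
  shows "integrable lborel f"
proof -
  have "integrable lborel (\<lambda>x. indicator (cball 0 r) x *\<^sub>R f x)"
    by (rule borel_integrable_compact) (use assms(1) continuous_on_subset in auto)
  moreover have "(\<lambda>x. indicator (cball 0 r) x *\<^sub>R f x) = f"
    using assms(2) by (auto simp: fun_eq_iff indicator_def dist_norm)
  ultimately show ?thesis by simp
qed

lemma mollifier_exists:
  assumes "r > 0"
  shows "\<exists>\<rho>::real^'d::finite \<Rightarrow> real. mollifier r \<rho>"
proof -
  \<comment> \<open>The Euclidean norm is at most the sum of the coordinates, so the cube of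
    half-side r / d lies in the ball of radius r.\<close>
  define s where "s = r / CARD('d)"
  have s: "s > 0" "real CARD('d) * s = r" using assms by (auto simp: s_def)
  define B where "B = (box_bump s :: real^'d \<Rightarrow> real)"
  define I where "I = integral\<^sup>L lborel B"
  have cont: "continuous_on UNIV B" unfolding B_def by (rule C_kD_cont[OF C_k_box_bump[of 0]])
  have int: "integrable lborel B"
    by (rule integrable_cont_bounded_support[OF cont, of r]) (use box_bump_zero s in \<open>auto simp: B_def\<close>)
  have nn: "0 \<le> B x" for x by (simp add: B_def box_bump_nonneg)
  \<comment> \<open>A vanishing integral would make the nonempty open set where \<open>B\<close> is
    nonzero negligible.\<close>
  have "I \<noteq> 0"
  proof
    assume "I = 0"
    then have "AE x in lborel. B x = 0"
      unfolding I_def using integral_nonneg_eq_0_iff_AE[OF int] nn by auto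
    then have "{x. B x \<noteq> 0} \<in> null_sets lborel"
      using borel_measurable_continuous_onI[OF cont] by (subst (asm) AE_iff_null) auto
    then have "negligible {x. B x \<noteq> 0}"
      by (simp add: negligible_iff_null_sets null_sets_completionI)
    moreover have "open {x. B x \<noteq> 0}"
      using cont by (intro open_Collect_neq) auto
    moreover have "0 \<in> {x. B x \<noteq> 0}"
      using box_bump_pos_iff[of s "0::real^'d"] s by (simp add: B_def)
    ultimately show False using open_not_negligible by blast
  qed
  moreover have "I \<ge> 0" unfolding I_def using nn by simp
  ultimately have "I > 0" by simp
  have "mollifier r (\<lambda>x. (1/I) * B x)"
    unfolding mollifier_def
  proof (intro conjI allI impI)
    show "C_k k (\<lambda>x. 1 / I * B x)" for k
      unfolding B_def by (intro C_k_mult C_k_const C_k_box_bump)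
    show "1 / I * B x = 0" if "r \<le> norm x" for x using box_bump_zero[of s x] s that by (simp add: B_def)
    show "integral\<^sup>L lborel (\<lambda>x. 1 / I * B x) = 1"
      using \<open>I > 0\<close> by (simp add: I_def)
  qed (use nn \<open>I > 0\<close> int in auto)
  then show ?thesis by blast
qed


subsection \<open>Square integrable functions\<close>

lemma L2D:
  assumes "u \<in> L2 \<Omega>"
  shows "u \<in> borel_measurable (lebesgue_on \<Omega>)" "integrable (lebesgue_on \<Omega>) (\<lambda>x. (norm (u x))\<^sup>2)"
  using assms by (auto simp: L2_def)

lemma L2_square_integrable:
  fixes u :: "real^'d::finite \<Rightarrow> real"
  assumes "u \<in> L2 \<Omega>"
  shows "integrable (lebesgue_on \<Omega>) (\<lambda>x. (u x)\<^sup>2)"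
  using L2D(2)[OF assms] by simp

lemma norm_add_square_le: "(norm (a + b))\<^sup>2 \<le> 2 * (norm a)\<^sup>2 + 2 * (norm (b::'a::real_normed_vector))\<^sup>2"
proof -
  have "(norm (a + b))\<^sup>2 \<le> (norm a + norm b)\<^sup>2"
    by (intro power_mono norm_triangle_ineq) auto
  also have "\<dots> \<le> 2 * (norm a)\<^sup>2 + 2 * (norm b)\<^sup>2"
    using sum_squares_bound[of "norm a" "norm b"] by (simp add: power2_sum)
  finally show ?thesis .
qed

lemma L2_scaleR:
  assumes "u \<in> L2 \<Omega>"
  shows "(\<lambda>x. c *\<^sub>R u x) \<in> L2 \<Omega>"
  using assms by (auto simp: L2_def power_mult_distrib)

lemma L2_add:
  assumes "u \<in> L2 \<Omega>" "v \<in> L2 \<Omega>"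
  shows "(\<lambda>x. u x + v x) \<in> L2 \<Omega>"
proof -
  note m = L2D[OF assms(1)] L2D[OF assms(2)]
  have "integrable (lebesgue_on \<Omega>) (\<lambda>x. (norm (u x + v x))\<^sup>2)"
  proof (rule Bochner_Integration.integrable_bound)
    show "integrable (lebesgue_on \<Omega>) (\<lambda>x. 2 * (norm (u x))\<^sup>2 + 2 * (norm (v x))\<^sup>2)"
      using m by auto
    show "AE x in lebesgue_on \<Omega>. norm ((norm (u x + v x))\<^sup>2) \<le> norm (2 * (norm (u x))\<^sup>2 + 2 * (norm (v x))\<^sup>2)"
      using norm_add_square_le by (intro AE_I2) auto
    show "(\<lambda>x. (norm (u x + v x))\<^sup>2) \<in> borel_measurable (lebesgue_on \<Omega>)"
      using m(1,3) by measurable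
  qed
  with m(1,3) show ?thesis by (auto simp: L2_def)
qed

lemma L2_diff:
  assumes "u \<in> L2 \<Omega>" "v \<in> L2 \<Omega>"
  shows "(\<lambda>x. u x - v x) \<in> L2 \<Omega>"
  using L2_add[OF assms(1) L2_scaleR[OF assms(2), of "-1"]] by simp

lemma L2_zero: "(\<lambda>x. 0) \<in> L2 \<Omega>"
  by (simp add: L2_def)

lemma L2_integrable_mult:
  fixes u v :: "real^'d::finite \<Rightarrow> real"
  assumes "u \<in> L2 \<Omega>" "v \<in> L2 \<Omega>"
  shows "integrable (lebesgue_on \<Omega>) (\<lambda>x. u x * v x)"
proof (rule Bochner_Integration.integrable_bound)
  note m = L2D[OF assms(1)] L2D[OF assms(2)]
  show "integrable (lebesgue_on \<Omega>) (\<lambda>x. (u x)\<^sup>2 + (v x)\<^sup>2)"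
    using m by auto
  show "AE x in lebesgue_on \<Omega>. norm (u x * v x) \<le> norm ((u x)\<^sup>2 + (v x)\<^sup>2)"
  proof (rule AE_I2)
    fix x
    have "2 * (\<bar>u x\<bar> * \<bar>v x\<bar>) \<le> (u x)\<^sup>2 + (v x)\<^sup>2"
      using sum_squares_bound[of "\<bar>u x\<bar>" "\<bar>v x\<bar>"] by simp
    moreover have "0 \<le> \<bar>u x\<bar> * \<bar>v x\<bar>" by simp
    ultimately have "\<bar>u x\<bar> * \<bar>v x\<bar> \<le> (u x)\<^sup>2 + (v x)\<^sup>2" by linarith
    then show "norm (u x * v x) \<le> norm ((u x)\<^sup>2 + (v x)\<^sup>2)"
      by (simp add: abs_mult)
  qed
  show "(\<lambda>x. u x * v x) \<in> borel_measurable (lebesgue_on \<Omega>)" using m by measurable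
qed

lemma L2_Cauchy_Schwarz:
  fixes u v :: "real^'d::finite \<Rightarrow> real"
  assumes u: "u \<in> L2 \<Omega>" and v: "v \<in> L2 \<Omega>"
  shows "(LINT x|lebesgue_on \<Omega>. u x * v x)\<^sup>2 \<le> (LINT x|lebesgue_on \<Omega>. (u x)\<^sup>2) * (LINT
      x|lebesgue_on \<Omega>. (v x)\<^sup>2)"
proof -
  define A B C where "A = (LINT x|lebesgue_on \<Omega>. (u x)\<^sup>2)" and "B = (LINT x|lebesgue_on \<Omega>. (v x)\<^sup>2)"
    and "C = (LINT x|lebesgue_on \<Omega>. u x * v x)"
  note i = L2_integrable_mult[OF u v] L2_square_integrable[OF u] L2_square_integrable[OF v]
  have A0: "A \<ge> 0" and B0: "B \<ge> 0" by (auto simp: A_def B_def)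
  have q: "0 \<le> s\<^sup>2 * A - 2 * s * t * C + t\<^sup>2 * B" for s t
  proof -
    have "0 \<le> (LINT x|lebesgue_on \<Omega>. (s * u x - t * v x)\<^sup>2)" by simp
    also have "\<dots> = (LINT x|lebesgue_on \<Omega>. s\<^sup>2 * (u x)\<^sup>2 - 2 * s * t * (u x * v x) + t\<^sup>2 * (v x)\<^sup>2)"
      by (intro Bochner_Integration.integral_cong refl) (simp add: power2_eq_square algebra_simps)
    also have "\<dots> = s\<^sup>2 * A - 2 * s * t * C + t\<^sup>2 * B"
      unfolding A_def B_def C_def using i by simp
    finally show ?thesis .
  qed
  have "C\<^sup>2 \<le> A * B"
  proof (cases "B = 0")
    case True
    have "C = 0"
    proof (rule ccontr)
      assume "C \<noteq> 0"
      \<comment> \<open>For \<open>B = 0\<close> the quadratic form with s = 1 is affine in t, and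
        this t gives it the value -1.\<close>
      have "0 \<le> A - 2 * ((A + 1) / (2 * C)) * C"
        using q[of 1 "(A+1)/(2*C)"] True by simp
      with \<open>C \<noteq> 0\<close> show False by simp
    qed
    with True show ?thesis by simp
  next
    case False
    then have "B > 0" using B0 by simp
    \<comment> \<open>The choice s = B, t = C turns the form into B (A B - C^2).\<close>
    have "0 \<le> B * (A * B - C\<^sup>2)"
      using q[of B C] by (simp add: power2_eq_square algebra_simps)
    with \<open>B > 0\<close> show ?thesis by (simp add: zero_le_mult_iff)
  qed
  then show ?thesis by (simp add: A_def B_def C_def)
qed

lemma finite_measure_lebesgue_on_bounded:
  assumes "bounded \<Omega>" "\<Omega> \<in> sets lebesgue"
  shows "finite_measure (lebesgue_on \<Omega>)"
proof (rule finite_measureI)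
  have "\<Omega> \<in> lmeasurable" using assms bounded_set_imp_lmeasurable by blast
  then show "emeasure (lebesgue_on \<Omega>) (space (lebesgue_on \<Omega>)) \<noteq> \<infinity>"
    using assms by (auto simp: space_restrict_space emeasure_restrict_space fmeasurable_def)
qed

lemma L2_bounded_measurable:
  assumes "bounded \<Omega>" "\<Omega> \<in> sets lebesgue" "u \<in> borel_measurable (lebesgue_on \<Omega>)"
    and "\<And>x. x \<in> \<Omega> \<Longrightarrow> norm (u x) \<le> M"
  shows "u \<in> L2 \<Omega>"
proof -
  interpret finite_measure "lebesgue_on \<Omega>" using finite_measure_lebesgue_on_bounded assms by blast
  have "integrable (lebesgue_on \<Omega>) (\<lambda>x. (norm (u x))\<^sup>2)"
  proof (rule integrable_const_bound[of _ "M\<^sup>2"])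
    show "AE x in lebesgue_on \<Omega>. norm ((norm (u x))\<^sup>2) \<le> M\<^sup>2"
      using assms(4) by (auto intro!: AE_I2 power_mono simp: space_restrict_space)
    show "(\<lambda>x. (norm (u x))\<^sup>2) \<in> borel_measurable (lebesgue_on \<Omega>)"
      using assms(3) by measurable
  qed
  with assms(3) show ?thesis by (auto simp: L2_def)
qed

lemma L2_integrable:
  fixes u :: "real^'d::finite \<Rightarrow> real"
  assumes "bounded \<Omega>" "\<Omega> \<in> sets lebesgue" "u \<in> L2 \<Omega>"
  shows "integrable (lebesgue_on \<Omega>) u"
  using L2_integrable_mult[OF assms(3) L2_bounded_measurable[OF assms(1,2), of "\<lambda>x. 1" 1]] by simp

lemma L2_component:
  assumes "G \<in> L2 \<Omega>"
  shows "(\<lambda>x. G x $ i) \<in> L2 \<Omega>"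
proof -
  note m = L2D[OF assms]
  have m': "(\<lambda>x. G x $ i) \<in> borel_measurable (lebesgue_on \<Omega>)" 
    by (rule measurable_compose[OF m(1) borel_measurable_continuous_onI]) (intro continuous_intros)
  have "integrable (lebesgue_on \<Omega>) (\<lambda>x. (norm (G x $ i))\<^sup>2)"
  proof (rule Bochner_Integration.integrable_bound[OF m(2)])
    show "AE x in lebesgue_on \<Omega>. norm ((norm (G x $ i))\<^sup>2) \<le> norm ((norm (G x))\<^sup>2)"
      by (intro AE_I2) (simp add: abs_le_square_iff[symmetric] Finite_Cartesian_Product.norm_nth_le)
    show "(\<lambda>x. (norm (G x $ i))\<^sup>2) \<in> borel_measurable (lebesgue_on \<Omega>)" using m' by measurable
  qed
  with m' show ?thesis by (auto simp: L2_def)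
qed

text \<open>Completeness of Lebesgue measure. It is needed because \<open>ae_classes\<close>
  contains every representative of a class, with no measurability demanded.\<close>

lemma borel_measurable_lebesgue_on_AE:
  fixes u v :: "real^'d::finite \<Rightarrow> 'b::euclidean_space"
  assumes "\<Omega> \<in> sets lebesgue" "u \<in> borel_measurable (lebesgue_on \<Omega>)" "AE x in lebesgue_on \<Omega>. u x = v x"
  shows "v \<in> borel_measurable (lebesgue_on \<Omega>)"
proof -
  have "AE x in lebesgue. x \<in> \<Omega> \<longrightarrow> u x = v x"
    using assms(3,1) by (subst (asm) AE_restrict_space_iff) auto
  then obtain N where N: "N \<in> null_sets lebesgue" "{x. \<not> (x \<in> \<Omega> \<longrightarrow> u x = v x)} \<subseteq> N"
    by (auto simp: eventually_ae_filter)
  show ?thesis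
    unfolding measurable_on_iff_borel_measurable[OF assms(1), symmetric]
  proof (rule measurable_on_spike)
    show "u measurable_on \<Omega>" unfolding measurable_on_iff_borel_measurable[OF assms(1)] by (rule assms(2))
    show "negligible N" using N(1) by (simp add: negligible_iff_null_sets)
    show "v x = u x" if "x \<in> \<Omega> - N" for x using N(2) that by auto
  qed
qed

lemma L2_AE:
  assumes "\<Omega> \<in> sets lebesgue" "u \<in> L2 \<Omega>" "AE x in lebesgue_on \<Omega>. u x = v x"
  shows "v \<in> L2 \<Omega>"
proof -
  note m = L2D[OF assms(2)]
  have v: "v \<in> borel_measurable (lebesgue_on \<Omega>)" by (rule borel_measurable_lebesgue_on_AE[OF assms(1) m(1) assms(3)])
  have "(\<lambda>x. (norm (v x))\<^sup>2) \<in> borel_measurable (lebesgue_on \<Omega>)" using v by measurable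
  moreover have "AE x in lebesgue_on \<Omega>. (norm (u x))\<^sup>2 = (norm (v x))\<^sup>2"
    using assms(3) by (rule AE_mp) (intro AE_I2 impI, simp)
  ultimately have "integrable (lebesgue_on \<Omega>) (\<lambda>x. (norm (v x))\<^sup>2)"
    by (rule integrable_cong_AE_imp[OF m(2)])
  with v show ?thesis by (auto simp: L2_def)
qed


subsection \<open>Mollification\<close>

text \<open>The mean value inequality for \<open>h\<close> minus its linear part at
  \<open>a\<close>: the remainder is governed by the oscillation of the gradient. It serves
  differentiation under the integral, Lipschitz bounds and the interpolation error alike.\<close>

lemma gradient_linearization:
  fixes h :: "'a::euclidean_space \<Rightarrow> real"
  assumes "convex S" "a \<in> S" "b \<in> S"
    and d: "\<And>z. z \<in> S \<Longrightarrow> (h has_derivative (\<lambda>v. g z \<bullet> v)) (at z)"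
    and B: "\<And>z. z \<in> S \<Longrightarrow> norm (g z - g a) \<le> B"
  shows "\<bar>h b - h a - g a \<bullet> (b - a)\<bar> \<le> norm (b - a) * B"
proof -
  have "norm (h b - h a - (\<lambda>z v. g z \<bullet> v) a (b - a)) \<le> norm (b - a) * B"
  proof (rule differentiable_bound_linearization[where S=S and f'="\<lambda>z v. g z \<bullet> v" and ?x0.0=a])
    show "a + t *\<^sub>R (b - a) \<in> S" if "t \<in> {0..1}" for t
    proof -
      have "a + t *\<^sub>R (b - a) = (1 - t) *\<^sub>R a + t *\<^sub>R b" by (simp add: algebra_simps)
      then show ?thesis using assms(1-3) that by (simp add: convexD)
    qed
    show "(h has_derivative (\<lambda>v. g z \<bullet> v)) (at z within S)" if "z \<in> S" for z
      using d[OF that] has_derivative_at_withinI by blast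
    show "onorm ((\<lambda>v. g z \<bullet> v) - (\<lambda>v. g a \<bullet> v)) \<le> B" if "z \<in> S" for z
    proof (rule onorm_le)
      fix v
      have "norm ((g z - g a) \<bullet> v) \<le> norm (g z - g a) * norm v" by (simp add: Cauchy_Schwarz_ineq2)
      also have "\<dots> \<le> B * norm v" using B[OF that] by (simp add: mult_right_mono)
      finally show "norm (((\<lambda>v. g z \<bullet> v) - (\<lambda>v. g a \<bullet> v)) v) \<le> B * norm v"
        by (simp add: inner_diff_left)
    qed
  qed (use assms in auto)
  then show ?thesis by simp
qed

lemma bounded_support_uniformly_continuous:
  fixes f :: "'a::euclidean_space \<Rightarrow> 'b::real_normed_vector"
  assumes f: "continuous_on UNIV f" and z: "\<And>x. R \<le> norm x \<Longrightarrow> f x = 0"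
  shows "uniformly_continuous_on UNIV f"
proof -
  \<comment> \<open>The margin 1 ensures that two points at distance below 1 either both lie in this
    ball or both lie where \<open>f\<close> vanishes.\<close>
  have u: "uniformly_continuous_on (cball 0 (R + 1)) f"
    by (intro compact_uniformly_continuous continuous_on_subset[OF f]) auto
  show ?thesis unfolding uniformly_continuous_on_def
  proof (intro allI impI)
    fix e :: real assume "e > 0"
    then obtain d where d: "d > 0" "\<And>x y. x \<in> cball 0 (R + 1) \<Longrightarrow> y \<in> cball 0 (R + 1)
        \<Longrightarrow> dist y x < d \<Longrightarrow> dist (f y) (f x) < e"
      using u unfolding uniformly_continuous_on_def by metis
    have "dist (f y) (f x) < e" if xy: "dist y x < min d 1" for x y
    proof (cases "norm x \<le> R + 1 \<and> norm y \<le> R + 1")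
      case True
      then show ?thesis using d(2)[of x y] xy by (simp add: dist_norm)
    next
      case False
      have "norm x - norm y < 1" "norm y - norm x < 1"
        using xy norm_triangle_ineq2[of x y] norm_triangle_ineq2[of y x] by (auto simp: dist_norm norm_minus_commute)
      with False have "R \<le> norm x" "R \<le> norm y" by linarith+
      then show ?thesis using z \<open>e > 0\<close> by simp
    qed
    then show "\<exists>d>0. \<forall>x\<in>UNIV. \<forall>x'\<in>UNIV. dist x' x < d \<longrightarrow> dist (f x') (f x) < e"
      using d(1) by (intro exI[of _ "min d 1"]) auto
  qed
qed

lemma continuous_bounded_support_bounded:
  fixes f :: "'a::euclidean_space \<Rightarrow> 'b::real_normed_vector"
  assumes f: "continuous_on UNIV f" and z: "\<And>x. R \<le> norm x \<Longrightarrow> f x = 0"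
  shows "\<exists>M\<ge>0. \<forall>x. norm (f x) \<le> M"
proof -
  have "compact (f ` cball 0 R)" by (intro compact_continuous_image continuous_on_subset[OF f]) auto
  then have "bounded (f ` cball 0 R)" by (rule compact_imp_bounded)
  then obtain M where "\<forall>y\<in>f ` cball 0 R. norm y \<le> M" unfolding bounded_iff by (elim exE) (rule that)
  then have M: "\<And>x. x \<in> cball 0 R \<Longrightarrow> norm (f x) \<le> M" by (rule bspec[OF _ imageI])
  have "norm (f x) \<le> max M 0" for x
    using M[of x] z[of x] by (cases "norm x \<le> R") auto
  then show ?thesis by (meson max.cobounded2)
qed

lemma mollifierD:
  assumes "mollifier r \<rho>"
  shows "C_k k \<rho>" "0 \<le> \<rho> x" "r \<le> norm x \<Longrightarrow> \<rho> x = 0" "integrable lborel \<rho>"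
      "integral\<^sup>L lborel \<rho> = 1"
  using assms by (auto simp: mollifier_def)

lemma C_1D:
  assumes "\<And>k. C_k k \<phi>"
  shows "(\<phi> has_derivative (\<lambda>v. grad \<phi> x \<bullet> v)) (at x)" "continuous_on UNIV (grad \<phi>)" "continuous_on UNIV \<phi>"
proof -
  have "C_k 1 \<phi>" using assms .
  then show "(\<phi> has_derivative (\<lambda>v. grad \<phi> x \<bullet> v)) (at x)" "continuous_on UNIV (grad \<phi>)"
    using has_derivative_grad by (auto intro!: continuous_on_vec_lambda simp: grad_def[abs_def])
  show "continuous_on UNIV \<phi>" using assms C_kD_cont by blast
qed

lemma grad_zero_outside:
  assumes "\<And>x. r \<le> norm x \<Longrightarrow> \<phi> x = 0" "r < norm x"
  shows "grad \<phi> x = 0"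
proof -
  have "(\<phi> has_derivative (\<lambda>v. 0)) (at x)"
  proof (rule has_derivative_transform_within_open[where f="\<lambda>x. 0" and s="{x. r < norm x}"])
    show "open {x. r < norm x}" by (intro open_Collect_less continuous_intros)
  qed (use assms in auto)
  then show ?thesis using partial_deriv_eq by (auto simp: grad_def vec_eq_iff)
qed

text \<open>The derivative falls on the kernel. Uniform continuity of \<open>g\<close> makes the
  linearization error of \<open>K\<close> small uniformly in s, so it may be integrated against
  \<open>\<bar>f s\<bar>\<close>; the minus sign comes from the argument s - y.\<close>

lemma convolution_has_derivative:
  fixes K :: "'a::euclidean_space \<Rightarrow> real"
  assumes f: "integrable lebesgue f"
    and K: "\<And>z. (K has_derivative (\<lambda>v. g z \<bullet> v)) (at z)"
    and g: "uniformly_continuous_on UNIV g"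
    and bK: "\<And>z. \<bar>K z\<bar> \<le> M" and bg: "\<And>z. norm (g z) \<le> M"
  shows "((\<lambda>y. LINT s|lebesgue. K (s - y) * f s) has_derivative
           (\<lambda>v. (- (LINT s|lebesgue. f s *\<^sub>R g (s - y))) \<bullet> v)) (at y)" (is ?D)
    and "continuous_on UNIV (\<lambda>y. LINT s|lebesgue. f s *\<^sub>R g (s - y))" (is ?C)
    and "integrable lebesgue (\<lambda>s. K (s - y) * f s)"
    and "integrable lebesgue (\<lambda>s. f s *\<^sub>R g (s - y))"
proof -
  have cK: "continuous_on UNIV K"
    by (intro continuous_at_imp_continuous_on ballI has_derivative_continuous[OF K])
  have cg: "continuous_on UNIV g" using g uniformly_continuous_imp_continuous by blast
  have mK: "(\<lambda>s. K (s - y)) \<in> borel_measurable lebesgue" for y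
    by (intro measurable_completion) (auto intro!: borel_measurable_continuous_onI continuous_on_compose2[OF cK] continuous_intros)
  have mg: "(\<lambda>s. g (s - y)) \<in> borel_measurable lebesgue" for y
    by (intro measurable_completion) (auto intro!: borel_measurable_continuous_onI continuous_on_compose2[OF cg] continuous_intros)
  have mf: "f \<in> borel_measurable lebesgue" using f by auto
  have M0: "0 \<le> M" using bK[of 0] by linarith
  have iK: "integrable lebesgue (\<lambda>s. K (s - y) * f s)" for y
  proof (rule Bochner_Integration.integrable_bound)
    show "integrable lebesgue (\<lambda>s. M * norm (f s))" using f by simp
    show "(\<lambda>s. K (s - y) * f s) \<in> borel_measurable lebesgue" using mK mf by measurable
    show "AE s in lebesgue. norm (K (s - y) * f s) \<le> norm (M * norm (f s))"
      using bK M0 by (intro AE_I2) (auto simp: abs_mult intro!: mult_right_mono)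
  qed
  have ig: "integrable lebesgue (\<lambda>s. f s *\<^sub>R g (s - y))" for y
  proof (rule Bochner_Integration.integrable_bound)
    show "integrable lebesgue (\<lambda>s. M * norm (f s))" using f by simp
    show "(\<lambda>s. f s *\<^sub>R g (s - y)) \<in> borel_measurable lebesgue" using mg mf by measurable
    show "AE s in lebesgue. norm (f s *\<^sub>R g (s - y)) \<le> norm (M * norm (f s))"
      using bg M0 by (intro AE_I2) (simp add: abs_mult mult.commute[of M] mult_left_mono)
  qed
  show "integrable lebesgue (\<lambda>s. K (s - y) * f s)" "integrable lebesgue (\<lambda>s. f s *\<^sub>R g (s - y))" by fact+
  define N where "N = (LINT s|lebesgue. \<bar>f s\<bar>)"
  have N0: "N \<ge> 0" by (simp add: N_def)
  have fa: "integrable lebesgue (\<lambda>s. \<bar>f s\<bar>)" using f by simp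
  have key: "\<exists>d>0. \<forall>y'. norm (y' - y) < d \<longrightarrow>
     (\<forall>s. norm (g (s - y') - g (s - y)) * N \<le> e)" if "e > 0" for e y
  proof -
    \<comment> \<open>N + 1 instead of N keeps the quotient meaningful when \<open>f\<close>
      vanishes almost everywhere.\<close>
    have "e / (N + 1) > 0" using that N0 by simp
    then obtain d where d: "d > 0" "\<And>x x'. dist x' x < d \<Longrightarrow> dist (g x') (g x) < e / (N + 1)"
      using g unfolding uniformly_continuous_on_def by (metis UNIV_I)
    have "norm (g (s - y') - g (s - y)) * N \<le> e" if "norm (y' - y) < d" for s y'
    proof -
      have "norm (g (s - y') - g (s - y)) \<le> e / (N + 1)"
        using d(2)[of "s - y'" "s - y"] that by (simp add: dist_norm norm_minus_commute)
      then have "norm (g (s - y') - g (s - y)) * N \<le> e / (N + 1) * N" using N0 by (rule mult_right_mono)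
      also have "\<dots> \<le> e" using N0 \<open>e > 0\<close> by (simp add: field_simps)
      finally show ?thesis .
    qed
    with d(1) show ?thesis by blast
  qed
  show ?C unfolding continuous_on_iff
  proof (intro ballI allI impI)
    fix y :: 'a and e :: real assume "e > 0"
    then obtain d where d: "d > 0" "\<And>y' s. norm (y' - y) < d \<Longrightarrow> norm (g (s - y') - g (s - y)) * N \<le> e/2"
      using key[of "e/2" y] by auto
    have "dist (LINT s|lebesgue. f s *\<^sub>R g (s - y')) (LINT s|lebesgue. f s *\<^sub>R g (s - y)) < e"
      if "dist y' y < d" for y'
    \<comment> \<open>For N = 0 the bound from \<open>key\<close> says nothing about
      \<open>g\<close>, but then \<open>f\<close> is zero almost everywhere and so are both
      integrals.\<close>
    proof (cases "N = 0")
      case True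
      then have "AE s in lebesgue. \<bar>f s\<bar> = 0"
        unfolding N_def using integral_nonneg_eq_0_iff_AE[OF fa] by simp
      then have "AE s in lebesgue. f s *\<^sub>R g (s - y) = 0" for y by eventually_elim simp
      then have "(LINT s|lebesgue. f s *\<^sub>R g (s - y)) = 0" for y by (rule integral_eq_zero_AE)
      then show ?thesis using \<open>e > 0\<close> by simp
    next
      case False
      then have N: "N > 0" using N0 by simp
      have b: "norm (g (s - y') - g (s - y)) \<le> e / 2 / N" for s
        using d(2)[of y' s] that N by (simp add: dist_norm field_simps)
      have "norm (LINT s|lebesgue. f s *\<^sub>R g (s - y') - f s *\<^sub>R g (s - y)) \<le> (LINT s|lebesgue. (e/2/N) * \<bar>f s\<bar>)"
      proof (rule Bochner_Integration.integral_norm_bound_integral)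
        show "integrable lebesgue (\<lambda>s. f s *\<^sub>R g (s - y') - f s *\<^sub>R g (s - y))" using ig by auto
        show "integrable lebesgue (\<lambda>s. (e/2/N) * \<bar>f s\<bar>)" using fa by simp
        show "norm (f s *\<^sub>R g (s - y') - f s *\<^sub>R g (s - y)) \<le> (e/2/N) * \<bar>f s\<bar>" for s
          using mult_left_mono[OF b[of s], of "\<bar>f s\<bar>"] by (simp add: scaleR_diff_right[symmetric] mult.commute)
      qed
      also have "\<dots> = e / 2" using N by (simp add: N_def)
      finally show ?thesis using ig \<open>e > 0\<close> by (simp add: dist_norm)
    qed
    with d(1) show "\<exists>d>0. \<forall>x'\<in>UNIV. dist x' y < d \<longrightarrow>
        dist (LINT s|lebesgue. f s *\<^sub>R g (s - x')) (LINT s|lebesgue. f s *\<^sub>R g (s - y)) < e" by blast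
  qed
  show ?D unfolding has_derivative_at_alt
  proof (intro conjI allI impI)
    show "bounded_linear (\<lambda>v. (- (LINT s|lebesgue. f s *\<^sub>R g (s - y))) \<bullet> v)"
      by (rule bounded_linear_inner_right)
    fix e :: real assume "e > 0"
    have "e / (N + 1) > 0" using \<open>e > 0\<close> N0 by simp
    then obtain d where d: "d > 0" "\<And>x x'. dist x' x < d \<Longrightarrow> dist (g x') (g x) < e / (N + 1)"
      using g unfolding uniformly_continuous_on_def by (metis UNIV_I)
    have "norm ((LINT s|lebesgue. K (s - y') * f s) - (LINT s|lebesgue. K (s - y) * f s) -
        (- (LINT s|lebesgue. f s *\<^sub>R g (s - y))) \<bullet> (y' - y)) \<le> e * norm (y' - y)" if y': "norm (y' - y) < d" for y'
    proof -
      have lin: "\<bar>K (s - y') - K (s - y) - g (s - y) \<bullet> (y - y')\<bar> \<le> norm (y - y') * (e / (N + 1))" for s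
      proof -
        have "\<bar>K (s - y') - K (s - y) - g (s - y) \<bullet> ((s - y') - (s - y))\<bar> \<le> norm ((s - y') - (s - y)) * (e / (N + 1))"
        proof (rule gradient_linearization[where S="ball (s - y) d"])
          show "norm (g z - g (s - y)) \<le> e / (N + 1)" if "z \<in> ball (s - y) d" for z
            using d(2)[of z "s - y"] that by (simp add: dist_norm norm_minus_commute)
        qed (use K y' d in \<open>auto simp: dist_norm norm_minus_commute\<close>)
        then show ?thesis by simp
      qed
      have eq: "(LINT s|lebesgue. K (s - y') * f s) - (LINT s|lebesgue. K (s - y) * f s) -
        (- (LINT s|lebesgue. f s *\<^sub>R g (s - y))) \<bullet> (y' - y) =
        (LINT s|lebesgue. K (s - y') * f s - K (s - y) * f s + (f s *\<^sub>R g (s - y)) \<bullet> (y' - y))"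
      proof -
        have "(LINT s|lebesgue. (f s *\<^sub>R g (s - y)) \<bullet> (y' - y)) = (LINT s|lebesgue. f s *\<^sub>R g (s - y)) \<bullet> (y' - y)"
          using ig[of y] by (intro integral_inner_left)
        moreover have "integrable lebesgue (\<lambda>s. (f s *\<^sub>R g (s - y)) \<bullet> (y' - y))"
          using ig[of y] by (intro integrable_inner_left)
        ultimately show ?thesis
          using iK[of y'] iK[of y] by (simp del: inner_scaleR_left)
      qed
      have "norm \<dots> \<le> (LINT s|lebesgue. (norm (y - y') * (e / (N + 1))) * \<bar>f s\<bar>)"
      proof (rule Bochner_Integration.integral_norm_bound_integral)
        show "integrable lebesgue (\<lambda>s. K (s - y') * f s - K (s - y) * f s + (f s *\<^sub>R g (s - y)) \<bullet> (y' - y))"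
          using iK ig integrable_inner_left by (intro Bochner_Integration.integrable_add Bochner_Integration.integrable_diff) blast+
        show "integrable lebesgue (\<lambda>s. (norm (y - y') * (e / (N + 1))) * \<bar>f s\<bar>)" using fa by simp
        fix s
        have "K (s - y') * f s - K (s - y) * f s + (f s *\<^sub>R g (s - y)) \<bullet> (y' - y)
           = (K (s - y') - K (s - y) - g (s - y) \<bullet> (y - y')) * f s"
          by (simp add: inner_diff_right algebra_simps)
        then show "norm (K (s - y') * f s - K (s - y) * f s + (f s *\<^sub>R g (s - y)) \<bullet> (y' - y))
           \<le> (norm (y - y') * (e / (N + 1))) * \<bar>f s\<bar>"
          using mult_right_mono[OF lin[of s], of "\<bar>f s\<bar>"] by (simp add: abs_mult)
      qed
      also have "\<dots> = norm (y - y') * (e * (N / (N + 1)))" by (simp add: N_def)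
      also have "\<dots> \<le> norm (y - y') * (e * 1)"
        using N0 \<open>e > 0\<close> by (intro mult_left_mono) (auto simp: field_simps)
      finally show ?thesis using eq by (simp add: mult.commute norm_minus_commute)
    qed
    with d(1) show "\<exists>d>0. \<forall>y'. norm (y' - y) < d \<longrightarrow> norm ((LINT s|lebesgue. K (s - y') *
        f s) - (LINT s|lebesgue. K (s - y) * f s) -
        (- (LINT s|lebesgue. f s *\<^sub>R g (s - y))) \<bullet> (y' - y)) \<le> e * norm (y' - y)" by blast
  qed
qed

section \<open>Shifted mollification\<close>

text \<open>An average of \<open>f\<close> around y + c instead of y: with a suitable shift
  \<open>c\<close> the averaging ball of a boundary point lies inside the domain.\<close>

definition moll :: "(real^'d::finite \<Rightarrow> real) \<Rightarrow> real^'d \<Rightarrow> (real^'d \<Rightarrow>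
    real) \<Rightarrow> real^'d \<Rightarrow> real"
  where "moll \<rho> c f y = (LINT s|lebesgue. \<rho> (s - y - c) * f s)"

lemma moll_has_derivative:
  fixes c :: "real^'d::finite"
  assumes \<rho>: "mollifier r \<rho>" and f: "integrable lebesgue f"
  defines "D \<equiv> (\<lambda>y. - (LINT s|lebesgue. f s *\<^sub>R grad \<rho> (s - y - c)))"
  shows "(moll \<rho> c f has_derivative (\<lambda>v. D y \<bullet> v)) (at y)" "continuous_on UNIV D"
    "integrable lebesgue (\<lambda>s. \<rho> (s - y - c) * f s)" "integrable lebesgue (\<lambda>s. f s *\<^sub>R grad \<rho> (s - y - c))"
proof -
  note C = C_1D[OF mollifierD(1)[OF \<rho>]]
  have gz: "r + 1 \<le> norm x \<Longrightarrow> grad \<rho> x = 0" for x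
    by (rule grad_zero_outside[of r]) (use mollifierD(3)[OF \<rho>] in auto)
  obtain M1 where M1: "\<And>x. norm (grad \<rho> x) \<le> M1" using continuous_bounded_support_bounded[OF C(2) gz] by blast
  obtain M2 where M2: "\<And>x. norm (\<rho> x) \<le> M2" using continuous_bounded_support_bounded[OF C(3) mollifierD(3)[OF \<rho>]] by blast
  have uc: "uniformly_continuous_on UNIV (\<lambda>z. grad \<rho> (z - c))"
    unfolding uniformly_continuous_on_def
  proof (intro allI impI)
    fix e :: real assume "e > 0"
    then obtain d where d: "d > 0" "\<And>x x'. dist x' x < d \<Longrightarrow> dist (grad \<rho> x') (grad \<rho> x) < e"
      using bounded_support_uniformly_continuous[OF C(2) gz] unfolding uniformly_continuous_on_def by (metis UNIV_I)
    then show "\<exists>d>0. \<forall>x\<in>UNIV. \<forall>x'\<in>UNIV. dist x' x < d \<longrightarrow> dist (grad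
        \<rho> (x' - c)) (grad \<rho> (x - c)) < e"
      by (intro exI[of _ d]) (simp add: dist_norm)
  qed
  have d: "((\<lambda>z. \<rho> (z - c)) has_derivative (\<lambda>v. grad \<rho> (z - c) \<bullet> v)) (at z)" for z
  proof -
    have "((\<lambda>z. z - c) has_derivative (\<lambda>v. v)) (at z)" by (auto intro!: derivative_eq_intros)
    from has_derivative_compose[OF this C(1)] show ?thesis .
  qed
  note cv = convolution_has_derivative[OF f d uc, of "max M1 M2"]
  have b: "\<bar>\<rho> (z - c)\<bar> \<le> max M1 M2" "norm (grad \<rho> (z - c)) \<le> max M1 M2" for z
    using M1[of "z - c"] M2[of "z - c"] by (auto simp: le_max_iff_disj)
  show "(moll \<rho> c f has_derivative (\<lambda>v. D y \<bullet> v)) (at y)" "continuous_on UNIV D"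
    "integrable lebesgue (\<lambda>s. \<rho> (s - y - c) * f s)" "integrable lebesgue (\<lambda>s. f s *\<^sub>R grad \<rho> (s - y - c))"
    using cv[OF b] unfolding moll_def[abs_def] D_def by (auto intro!: continuous_on_minus)
qed

lemma moll_continuous:
  assumes "mollifier r \<rho>" "integrable lebesgue f"
  shows "continuous_on UNIV (moll \<rho> c f)"
  by (intro continuous_at_imp_continuous_on ballI has_derivative_continuous[OF moll_has_derivative(1)[OF assms]])

lemma nn_integral_reflect:
  fixes f :: "'a::euclidean_space \<Rightarrow> ennreal"
  assumes "f \<in> borel_measurable borel"
  shows "(\<integral>\<^sup>+y. f (t - y) \<partial>lborel) = (\<integral>\<^sup>+y. f y \<partial>lborel)"
proof -
  have "(\<integral>\<^sup>+y. f y \<partial>lborel) = (\<integral>\<^sup>+y. f y \<partial>(density (distr lborel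
      borel (\<lambda>x. t + (-1) *\<^sub>R x)) (\<lambda>_. \<bar>-1::real\<bar>^DIM('a))))"
    by (subst lborel_affine[of "-1" t, symmetric]) auto
  also have "\<dots> = (\<integral>\<^sup>+y. f (t - y) \<partial>lborel)"
    using assms by (simp add: density_1 nn_integral_distr)
  finally show ?thesis by simp
qed

text \<open>Unit mass in either variable: integrating in s makes \<open>moll\<close> an average,
  integrating in y yields the constant 1 in the L2 bound once the order of integration is
  exchanged.\<close>

lemma mollifier_shift_integral:
  assumes "mollifier r \<rho>"
  shows "integrable lebesgue (\<lambda>s. \<rho> (s - y - c))" "(LINT s|lebesgue. \<rho> (s - y - c)) = 1"
    and "(\<integral>\<^sup>+y. ennreal (\<rho> (s - y - c)) \<partial>lborel) = 1"
proof -
  note C = C_1D[OF mollifierD(1)[OF assms]]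
  have m: "\<rho> \<in> borel_measurable borel" using C(3) by (rule borel_measurable_continuous_onI)
  have nn: "(\<integral>\<^sup>+y. ennreal (\<rho> y) \<partial>lborel) = 1"
    using nn_integral_eq_integral[OF mollifierD(4)[OF assms]] mollifierD[OF assms] by simp
  have 1: "integrable lborel (\<lambda>s. \<rho> (s + - (y + c)))"
    using mollifierD(4)[OF assms] lborel_distr_plus[of "- (y + c)"]
    by (subst (asm) lborel_distr_plus[of "- (y + c)", symmetric], subst (asm) integrable_distr_eq)
       (use m in \<open>auto simp: add.commute\<close>)
  have 2: "integral\<^sup>L lborel (\<lambda>s. \<rho> (s + - (y + c))) = 1"
    using mollifierD(5)[OF assms]
    by (subst (asm) lborel_distr_plus[of "- (y + c)", symmetric], subst (asm) integral_distr)
       (use m in \<open>auto simp: add.commute\<close>)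
  have m2: "(\<lambda>s. \<rho> (s - y - c)) \<in> borel_measurable borel" using m by measurable
  show "integrable lebesgue (\<lambda>s. \<rho> (s - y - c))" "(LINT s|lebesgue. \<rho> (s - y - c)) = 1"
    using 1 2 m2 by (auto simp: integrable_completion integral_completion algebra_simps)
  have "(\<integral>\<^sup>+y. ennreal (\<rho> ((s - c) - y)) \<partial>lborel) = 1"
    using nn_integral_reflect[of "\<lambda>y. ennreal (\<rho> y)" "s - c"] m nn by simp
  then show "(\<integral>\<^sup>+y. ennreal (\<rho> (s - y - c)) \<partial>lborel) = 1"
    by (simp add: algebra_simps)
qed


lemma L2_UNIV_real: "f \<in> L2 UNIV \<longleftrightarrow> f \<in> borel_measurable lebesgue \<and> integrable lebesgue (\<lambda>x. (f x)\<^sup>2)"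
  for f :: "real^'d::finite \<Rightarrow> real"
  by (simp add: L2_def lebesgue_on_UNIV_eq)

text \<open>Young's inequality for a kernel of mass one: Jensen's inequality for the square at each
  y, then Tonelli.\<close>

lemma moll_L2_bound:
  fixes f :: "real^'d::finite \<Rightarrow> real"
  assumes \<rho>: "mollifier r \<rho>" and f: "f \<in> L2 UNIV" "integrable lebesgue f"
  shows "moll \<rho> c f \<in> L2 UNIV" "(LINT y|lebesgue. (moll \<rho> c f y)\<^sup>2) \<le> (LINT y|lebesgue. (f y)\<^sup>2)"
proof -
  note C = C_1D[OF mollifierD(1)[OF \<rho>]]
  have \<rho>m: "\<rho> \<in> borel_measurable borel" using C(3) by (rule borel_measurable_continuous_onI)
  obtain M where M: "\<And>x. norm (\<rho> x) \<le> M" using continuous_bounded_support_bounded[OF C(3) mollifierD(3)[OF \<rho>]] by blast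
  have fm: "f \<in> borel_measurable lebesgue" and f2: "integrable lebesgue (\<lambda>x. (f x)\<^sup>2)"
    using f(1) by (auto simp: L2_UNIV_real)
  \<comment> \<open>Tonelli on the product of two copies of \<open>lborel\<close> asks for joint
    Borel measurability, so \<open>f\<close> is replaced by a Borel representative.\<close>
  obtain h where h: "h \<in> borel_measurable lborel" "AE x in lborel. f x = h x"
    using completion_ex_borel_measurable_real[OF fm] by blast
  have hb: "h \<in> borel_measurable borel" using h(1) by simp
  have hl: "h \<in> borel_measurable lebesgue" using h(1) by (rule measurable_completion)
  have ae: "AE x in lebesgue. f x = h x" using h(2) by (rule AE_completion)
  have h2: "integrable lebesgue (\<lambda>x. (h x)\<^sup>2)"
  proof (rule integrable_cong_AE_imp[OF f2])
    show "(\<lambda>x. (h x)\<^sup>2) \<in> borel_measurable lebesgue" using hl by measurable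
    show "AE x in lebesgue. (f x)\<^sup>2 = (h x)\<^sup>2" using ae by eventually_elim simp
  qed
  have h1: "integrable lebesgue h"
    by (rule integrable_cong_AE_imp[OF f(2) hl ae])
  have I2: "(LINT y|lebesgue. (h y)\<^sup>2) = (LINT y|lebesgue. (f y)\<^sup>2)"
  proof (rule integral_cong_AE)
    show "(\<lambda>x. (h x)\<^sup>2) \<in> borel_measurable lebesgue" using hl by measurable
    show "(\<lambda>x. (f x)\<^sup>2) \<in> borel_measurable lebesgue" using fm by measurable
    show "AE x in lebesgue. (h x)\<^sup>2 = (f x)\<^sup>2" using ae by eventually_elim simp
  qed
  have rs: "(\<lambda>s. \<rho> (s - y - c)) \<in> borel_measurable lebesgue" for y
    using mollifier_shift_integral(1)[OF \<rho>] by auto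
  have mol: "moll \<rho> c f y = (LINT s|lebesgue. \<rho> (s - y - c) * h s)" for y
    unfolding moll_def
  proof (rule integral_cong_AE)
    show "(\<lambda>s. \<rho> (s - y - c) * h s) \<in> borel_measurable lebesgue" using rs hl by measurable
    show "(\<lambda>s. \<rho> (s - y - c) * f s) \<in> borel_measurable lebesgue" using rs fm by measurable
    show "AE s in lebesgue. \<rho> (s - y - c) * f s = \<rho> (s - y - c) * h s" using ae by eventually_elim simp
  qed
  have ir: "integrable lebesgue (\<lambda>s. \<rho> (s - y - c) * (h s)\<^sup>2)" for y
  proof (rule Bochner_Integration.integrable_bound)
    show "integrable lebesgue (\<lambda>s. M * (h s)\<^sup>2)" using h2 by simp
    show "(\<lambda>s. \<rho> (s - y - c) * (h s)\<^sup>2) \<in> borel_measurable lebesgue" using rs hl by measurable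
    show "AE s in lebesgue. norm (\<rho> (s - y - c) * (h s)\<^sup>2) \<le> norm (M * (h s)\<^sup>2)"
    proof (rule AE_I2)
      fix s
      have "\<bar>\<rho> (s - y - c)\<bar> \<le> \<bar>M\<bar>" using M[of "s - y - c"] by simp
      then show "norm (\<rho> (s - y - c) * (h s)\<^sup>2) \<le> norm (M * (h s)\<^sup>2)"
        by (simp add: abs_mult mult_right_mono)
    qed
  qed
  have jensen: "(moll \<rho> c f y)\<^sup>2 \<le> (LINT s|lebesgue. \<rho> (s - y - c) * (h s)\<^sup>2)" for y
  proof -
    define m where "m = moll \<rho> c f y"
    have i1: "integrable lebesgue (\<lambda>s. \<rho> (s - y - c) * h s)" using moll_has_derivative(3)[OF \<rho> h1] .
    \<comment> \<open>Jensen's inequality in the form that a variance is nonnegative;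
      \<open>m\<close> is the mean.\<close>
    have "0 \<le> (LINT s|lebesgue. \<rho> (s - y - c) * (h s - m)\<^sup>2)"
      using mollifierD(2)[OF \<rho>] by (intro integral_nonneg_AE AE_I2) auto
    also have "\<dots> = (LINT s|lebesgue. \<rho> (s - y - c) * (h s)\<^sup>2 - 2 * m * (\<rho> (s - y - c) * h s) + m\<^sup>2 * \<rho> (s - y - c))"
      by (intro Bochner_Integration.integral_cong refl) (simp add: power2_eq_square algebra_simps)
    also have "\<dots> = (LINT s|lebesgue. \<rho> (s - y - c) * (h s)\<^sup>2) - 2 * m * m + m\<^sup>2"
      using ir i1 mollifier_shift_integral[OF \<rho>] by (simp add: mol m_def)
    finally show ?thesis by (simp add: m_def power2_eq_square)
  qed
  have "(\<integral>\<^sup>+y. ennreal ((moll \<rho> c f y)\<^sup>2) \<partial>lborel)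
      \<le> (\<integral>\<^sup>+y. (\<integral>\<^sup>+s. ennreal (\<rho> (s - y - c) * (h s)\<^sup>2) \<partial>lborel) \<partial>lborel)"
  proof (rule nn_integral_mono)
    fix y
    have "ennreal ((moll \<rho> c f y)\<^sup>2) \<le> ennreal (LINT s|lebesgue. \<rho> (s - y - c) * (h s)\<^sup>2)"
      using jensen by (rule ennreal_leI)
    also have "\<dots> = (\<integral>\<^sup>+s. ennreal (\<rho> (s - y - c) * (h s)\<^sup>2) \<partial>lebesgue)"
      using nn_integral_eq_integral[OF ir] mollifierD(2)[OF \<rho>] by auto
    finally show "ennreal ((moll \<rho> c f y)\<^sup>2) \<le> (\<integral>\<^sup>+s. ennreal (\<rho> (s - y - c) * (h s)\<^sup>2) \<partial>lborel)"
      by (simp add: nn_integral_completion)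
  qed
  also have "\<dots> = (\<integral>\<^sup>+s. (\<integral>\<^sup>+y. ennreal (\<rho> (s - y - c) * (h s)\<^sup>2) \<partial>lborel) \<partial>lborel)"
  proof (rule lborel_pair.Fubini')
    show "(\<lambda>(s, y). ennreal (\<rho> (s - y - c) * (h s)\<^sup>2)) \<in> borel_measurable (lborel \<Otimes>\<^sub>M lborel)"
      using \<rho>m hb by measurable
  qed
  also have "\<dots> = (\<integral>\<^sup>+s. ennreal ((h s)\<^sup>2) \<partial>lborel)"
  proof (rule nn_integral_cong)
    fix s
    have m: "(\<lambda>y. ennreal (\<rho> (s - y - c))) \<in> borel_measurable lborel" using \<rho>m by measurable
    have "(\<integral>\<^sup>+y. ennreal (\<rho> (s - y - c) * (h s)\<^sup>2) \<partial>lborel) =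
        (\<integral>\<^sup>+y. ennreal (\<rho> (s - y - c)) * ennreal ((h s)\<^sup>2) \<partial>lborel)"
      using mollifierD(2)[OF \<rho>] by (simp add: ennreal_mult)
    also have "\<dots> = ennreal ((h s)\<^sup>2)"
      using mollifier_shift_integral(3)[OF \<rho>] by (simp add: nn_integral_multc[OF m])
    finally show "(\<integral>\<^sup>+y. ennreal (\<rho> (s - y - c) * (h s)\<^sup>2) \<partial>lborel) = ennreal ((h s)\<^sup>2)" .
  qed
  also have "\<dots> = ennreal (LINT y|lebesgue. (f y)\<^sup>2)"
    using nn_integral_eq_integral[OF h2] I2 by (simp add: nn_integral_completion)
  finally have *: "(\<integral>\<^sup>+y. ennreal ((moll \<rho> c f y)\<^sup>2) \<partial>lebesgue) \<le> ennreal (LINT y|lebesgue. (f y)\<^sup>2)"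
    by (simp add: nn_integral_completion)
  have mm: "moll \<rho> c f \<in> borel_measurable lebesgue"
    using moll_continuous[OF \<rho> f(2)] by (intro measurable_completion) (simp add: borel_measurable_continuous_onI)
  have int: "integrable lebesgue (\<lambda>y. (moll \<rho> c f y)\<^sup>2)"
    by (rule integrableI_bounded) (use mm le_less_trans[OF *] in auto)
  then show "moll \<rho> c f \<in> L2 UNIV" using mm by (simp add: L2_UNIV_real)
  show "(LINT y|lebesgue. (moll \<rho> c f y)\<^sup>2) \<le> (LINT y|lebesgue. (f y)\<^sup>2)"
    using * nn_integral_eq_integral[OF int] by simp
qed

lemma L2_bounded_support_integrable:
  fixes f :: "real^'d::finite \<Rightarrow> real"
  assumes "f \<in> L2 UNIV" "\<And>x. R \<le> norm x \<Longrightarrow> f x = 0"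
  shows "integrable lebesgue f"
proof -
  have i: "integrable lebesgue (indicator (cball 0 R) :: real^'d \<Rightarrow> real)"
    using emeasure_bounded_finite[OF bounded_cball[of "0::real^'d" R]] by (simp add: integrable_indicator_iff)
  have "(indicator (cball 0 R) :: real^'d \<Rightarrow> real) \<in> L2 UNIV"
    using i by (auto simp: L2_UNIV_real power2_eq_square indicator_inter_arith[symmetric])
  from L2_integrable_mult[OF assms(1) this] 
  have "integrable lebesgue (\<lambda>x. f x * indicator (cball 0 R) x)" by (simp add: lebesgue_on_UNIV_eq)
  moreover have "(\<lambda>x. f x * indicator (cball 0 R) x) = f"
    using assms(2) by (auto simp: fun_eq_iff indicator_def)
  ultimately show ?thesis by simp
qed

section \<open>Continuous approximation and convergence of mollifications in L2\<close>

definition clip :: "real \<Rightarrow> real \<Rightarrow> real"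
  where "clip m t = max (- m) (min m t)"

lemma abs_clip: "0 \<le> m \<Longrightarrow> \<bar>clip m t\<bar> \<le> m" "0 \<le> m \<Longrightarrow> \<bar>t - clip m t\<bar> \<le> \<bar>t\<bar>"
  by (auto simp: clip_def)

lemma clip_zero: "0 \<le> m \<Longrightarrow> clip m 0 = 0" by (auto simp: clip_def)

lemma tendsto_clip: "(f \<longlongrightarrow> l) F \<Longrightarrow> ((\<lambda>x. clip m (f x)) \<longlongrightarrow> clip m l) F"
  unfolding clip_def by (intro tendsto_intros)

lemma continuous_on_clip: "continuous_on S f \<Longrightarrow> continuous_on S (\<lambda>x. clip m (f x))"
  unfolding clip_def by (intro continuous_intros)

lemma borel_measurable_clip: "f \<in> borel_measurable M \<Longrightarrow> (\<lambda>x. clip m (f x)) \<in> borel_measurable M"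
  unfolding clip_def by (intro borel_measurable_max borel_measurable_min) auto

lemma borel_measurable_lebesgue_continuous:
  assumes "continuous_on UNIV (f :: 'a::euclidean_space \<Rightarrow> 'b::topological_space)"
  shows "f \<in> borel_measurable lebesgue"
  by (intro measurable_completion) (simp add: borel_measurable_continuous_onI[OF assms])

lemma integrable_indicator_cball:
  "integrable lebesgue (indicator (cball 0 R) :: 'a::euclidean_space \<Rightarrow> real)"
  using emeasure_bounded_finite[OF bounded_cball[of "0::'a" R]] by (simp add: integrable_indicator_iff)

lemma L2_continuous_bounded_support:
  fixes g :: "real^'d::finite \<Rightarrow> real"
  assumes "continuous_on UNIV g" "\<And>x. R \<le> norm x \<Longrightarrow> g x = 0"
  shows "g \<in> L2 UNIV"
proof -
  have "integrable lborel (\<lambda>x. (g x)\<^sup>2)"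
    by (rule integrable_cont_bounded_support[where r=R]) (use assms in \<open>auto intro!: continuous_intros\<close>)
  moreover have "(\<lambda>x. (g x)\<^sup>2) \<in> borel_measurable lborel"
    using assms(1) by (simp add: borel_measurable_continuous_onI continuous_on_power)
  ultimately show ?thesis
    using borel_measurable_lebesgue_continuous[OF assms(1)] by (simp add: L2_UNIV_real integrable_completion)
qed

lemma L2_approx_continuous:
  fixes f :: "real^'d::finite \<Rightarrow> real"
  assumes f: "f \<in> L2 UNIV" and z: "\<And>x. R \<le> norm x \<Longrightarrow> f x = 0" and "e > 0"
  shows "\<exists>g. continuous_on UNIV g \<and> (\<forall>x. R + 1 \<le> norm x \<longrightarrow> g x = 0) \<and>
      (LINT x|lebesgue. (f x - g x)\<^sup>2) < e"
proof -
  have fm: "f \<in> borel_measurable lebesgue" and f2: "integrable lebesgue (\<lambda>x. (f x)\<^sup>2)"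
    using f by (auto simp: L2_UNIV_real)
  have "(\<lambda>m::nat. LINT x|lebesgue. (f x - clip (real m) (f x))\<^sup>2) \<longlonglongrightarrow> (LINT x|(lebesgue :: (real^'d) measure). 0)"
  proof (rule integral_dominated_convergence[where w="\<lambda>x. (f x)\<^sup>2"])
    show "AE x in lebesgue. (\<lambda>m. (f x - clip (real m) (f x))\<^sup>2) \<longlonglongrightarrow> 0"
    proof (rule AE_I2)
      fix x
      obtain M where M: "\<bar>f x\<bar> \<le> real M" using real_arch_simple by blast
      have "eventually (\<lambda>m. (f x - clip (real m) (f x))\<^sup>2 = 0) sequentially"
        using eventually_ge_at_top[of M]
      proof eventually_elim
        case (elim m)
        then have "\<bar>f x\<bar> \<le> real m" using M by linarith
        then show ?case by (auto simp: clip_def)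
      qed
      then show "(\<lambda>m. (f x - clip (real m) (f x))\<^sup>2) \<longlonglongrightarrow> 0" by (rule tendsto_eventually)
    qed
    show "AE x in lebesgue. norm ((f x - clip (real m) (f x))\<^sup>2) \<le> (f x)\<^sup>2" for m
      using abs_clip(2)[of "real m"] by (intro AE_I2) (simp add: abs_le_square_iff[symmetric])
    show "(\<lambda>x. (f x - clip (real m) (f x))\<^sup>2) \<in> borel_measurable lebesgue" for m
      using fm borel_measurable_clip[OF fm] by measurable
  qed (use f2 in auto)
  \<comment> \<open>Each of the two approximation errors enters the final estimate with the factor
    2, hence a quarter of \<open>e\<close> for each.\<close>
  then have "eventually (\<lambda>m. (LINT x|lebesgue. (f x - clip (real m) (f x))\<^sup>2) < e/4) sequentially"
    using \<open>e > 0\<close> by (intro order_tendstoD) auto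
  then obtain m :: nat where m: "(LINT x|lebesgue. (f x - clip (real m) (f x))\<^sup>2) < e/4"
    by (auto simp: eventually_sequentially)
  define F where "F x = clip (real m) (f x)" for x
  have Fm: "F \<in> borel_measurable lebesgue" unfolding F_def[abs_def] by (rule borel_measurable_clip[OF fm])
  \<comment> \<open>\<open>measurable_on\<close> supplies continuous functions converging to
    \<open>f\<close> off a negligible set. Clipping at \<open>m\<close> and the cutoff
    \<open>ct\<close>, which is 1 where \<open>f\<close> can be nonzero, give them an integrable
    majorant.\<close>
  have "f measurable_on UNIV"
    using fm by (simp add: measurable_on_iff_borel_measurable lebesgue_on_UNIV_eq)
  then obtain N g where N: "negligible N" and g: "\<And>n. continuous_on UNIV (g n)"
    and lim: "\<And>x. x \<notin> N \<Longrightarrow> (\<lambda>n. g n x) \<longlonglongrightarrow> f x"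
    unfolding measurable_on_def by auto
  define ct where "ct x = max 0 (min 1 (R + 1 - norm x))" for x :: "real^'d"
  define k where "k n x = ct x * clip (real m) (g n x)" for n x
  have kc: "continuous_on UNIV (k n)" for n
    unfolding k_def[abs_def] ct_def by (intro continuous_intros continuous_on_clip g)
  have kz: "k n x = 0" if "R + 1 \<le> norm x" for n x using that by (simp add: k_def ct_def)
  have Fchi: "ct x * F x = F x" for x
    using z[of x] by (cases "R \<le> norm x") (auto simp: F_def ct_def clip_zero)
  have Fz: "F x = 0" if "R \<le> norm x" for x using z[OF that] by (simp add: F_def clip_zero)
  have kb: "\<bar>k n x\<bar> \<le> real m" for n x
  proof -
    have "\<bar>ct x\<bar> * \<bar>clip (real m) (g n x)\<bar> \<le> 1 * real m"
      by (intro mult_mono abs_clip) (auto simp: ct_def)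
    then show ?thesis by (simp add: k_def abs_mult)
  qed
  have "(\<lambda>n. LINT x|lebesgue. (F x - k n x)\<^sup>2) \<longlonglongrightarrow> (LINT x|(lebesgue :: (real^'d) measure). 0)"
  proof (rule integral_dominated_convergence[where w="\<lambda>x. (2 * real m)\<^sup>2 * indicator (cball 0 (R + 1)) x"])
    have "AE x in lebesgue. x \<notin> N" using N by (simp add: negligible_iff_null_sets AE_not_in)
    then show "AE x in lebesgue. (\<lambda>n. (F x - k n x)\<^sup>2) \<longlonglongrightarrow> 0"
    proof eventually_elim
      case (elim x)
      have "(\<lambda>n. (F x - k n x)\<^sup>2) \<longlonglongrightarrow> (F x - ct x * F x)\<^sup>2"
        unfolding k_def F_def by (intro tendsto_intros tendsto_clip lim elim)
      then show ?case by (simp add: Fchi)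
    qed
    show "AE x in lebesgue. norm ((F x - k n x)\<^sup>2) \<le> (2 * real m)\<^sup>2 * indicator (cball 0 (R + 1)) x" for n
    proof (rule AE_I2)
      fix x
      have "\<bar>F x - k n x\<bar> \<le> 2 * real m" using kb[of n x] abs_clip(1)[of "real m" "f x"] by (simp add: F_def)
      then have "(F x - k n x)\<^sup>2 \<le> (2 * real m)\<^sup>2"
        using abs_le_square_iff[of "F x - k n x" "2 * real m"] by simp
      then show "norm ((F x - k n x)\<^sup>2) \<le> (2 * real m)\<^sup>2 * indicator (cball 0 (R + 1)) x"
        using kz[of x n] Fz[of x] by (auto simp: indicator_def dist_norm)
    qed
    show "(\<lambda>x. (F x - k n x)\<^sup>2) \<in> borel_measurable lebesgue" for n
      using Fm borel_measurable_lebesgue_continuous[OF kc] by measurable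
    show "integrable lebesgue (\<lambda>x::real^'d. (2 * real m)\<^sup>2 * indicator (cball 0 (R + 1)) x :: real)"
      by (intro integrable_mult_right integrable_indicator_cball)
  qed auto
  then have "eventually (\<lambda>n. (LINT x|lebesgue. (F x - k n x)\<^sup>2) < e/4) sequentially"
    using \<open>e > 0\<close> by (intro order_tendstoD) auto
  then obtain n where n: "(LINT x|lebesgue. (F x - k n x)\<^sup>2) < e/4"
    by (auto simp: eventually_sequentially)
  have "integrable lebesgue (\<lambda>x. (F x)\<^sup>2)"
  proof (rule Bochner_Integration.integrable_bound[OF f2])
    show "AE x in lebesgue. norm ((F x)\<^sup>2) \<le> norm ((f x)\<^sup>2)"
      by (intro AE_I2) (auto simp: abs_le_square_iff[symmetric] F_def clip_def)
    show "(\<lambda>x. (F x)\<^sup>2) \<in> borel_measurable lebesgue" using Fm by measurable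
  qed
  then have FL: "F \<in> L2 UNIV" using Fm by (simp add: L2_UNIV_real)
  have kL: "k n \<in> L2 UNIV" by (rule L2_continuous_bounded_support[OF kc kz])
  have i1: "integrable lebesgue (\<lambda>x. (f x - F x)\<^sup>2)" using L2_diff[OF f FL] by (simp add: L2_UNIV_real)
  have i2: "integrable lebesgue (\<lambda>x. (F x - k n x)\<^sup>2)" using L2_diff[OF FL kL] by (simp add: L2_UNIV_real)
  have i3: "integrable lebesgue (\<lambda>x. (f x - k n x)\<^sup>2)" using L2_diff[OF f kL] by (simp add: L2_UNIV_real)
  have "(LINT x|lebesgue. (f x - k n x)\<^sup>2) \<le> (LINT x|lebesgue. 2 * (f x - F x)\<^sup>2 + 2 * (F x - k n x)\<^sup>2)"
  proof (rule integral_mono)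
    show "(f x - k n x)\<^sup>2 \<le> 2 * (f x - F x)\<^sup>2 + 2 * (F x - k n x)\<^sup>2" for x
      using norm_add_square_le[of "f x - F x" "F x - k n x"] by simp
  qed (use i1 i2 i3 in auto)
  also have "\<dots> = 2 * (LINT x|lebesgue. (f x - F x)\<^sup>2) + 2 * (LINT x|lebesgue. (F x - k n x)\<^sup>2)"
    using i1 i2 by simp
  also have "\<dots> < e" using m n by (simp add: F_def)
  finally show ?thesis using kc kz by blast
qed

lemma moll_diff:
  assumes "mollifier r \<rho>" "integrable lebesgue f" "integrable lebesgue g"
  shows "moll \<rho> c (\<lambda>x. f x - g x) y = moll \<rho> c f y - moll \<rho> c g y"
  using moll_has_derivative(3)[OF assms(1,2)] moll_has_derivative(3)[OF assms(1,3)]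
  by (simp add: moll_def right_diff_distrib)

lemma moll_close_continuous:
  fixes g :: "real^'d::finite \<Rightarrow> real"
  assumes g: "continuous_on UNIV g" and z: "\<And>x. R \<le> norm x \<Longrightarrow> g x = 0" and "e > 0"
  shows "\<exists>\<delta>>0. \<forall>r \<rho> c. mollifier r \<rho> \<and> r + norm c < \<delta> \<longrightarrow>
      (LINT x|lebesgue. (moll \<rho> c g x - g x)\<^sup>2) < e"
proof -
  define A where "A = (LINT x|lebesgue. indicator (cball (0::real^'d) (R + 1)) x :: real)"
  have A0: "A \<ge> 0" by (simp add: A_def)
  \<comment> \<open>A uniform error \<eta> on a ball of volume A costs \<eta>^2 A, which is at most
    e/2; the summand 1 guards against division by zero.\<close>
  define \<eta> where "\<eta> = sqrt (e / (A + 1) / 2)"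
  have \<eta>: "\<eta> > 0" "\<eta>\<^sup>2 * A < e"
  proof -
    show "\<eta> > 0" using A0 \<open>e > 0\<close> by (simp add: \<eta>_def)
    have "\<eta>\<^sup>2 * A = e / 2 * (A / (A + 1))" using A0 \<open>e > 0\<close> by (simp add: \<eta>_def)
    also have "\<dots> \<le> e / 2 * 1" using A0 \<open>e > 0\<close> by (intro mult_left_mono) auto
    finally show "\<eta>\<^sup>2 * A < e" using \<open>e > 0\<close> by simp
  qed
  have "uniformly_continuous_on UNIV g" by (rule bounded_support_uniformly_continuous[OF g z])
  then obtain d where d: "d > 0" "\<And>x x'. dist x' x < d \<Longrightarrow> dist (g x') (g x) < \<eta>"
    using \<eta>(1) unfolding uniformly_continuous_on_def by (metis UNIV_I)
  have gL: "g \<in> L2 UNIV" by (rule L2_continuous_bounded_support[OF g z])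
  have gi: "integrable lebesgue g" by (rule L2_bounded_support_integrable[OF gL z])
  \<comment> \<open>Capping r + norm c by 1 keeps the mollified function supported in the ball of
    radius R + 1.\<close>
  have "(LINT x|lebesgue. (moll \<rho> c g x - g x)\<^sup>2) < e" if \<rho>: "mollifier r \<rho>" and rc: "r + norm c < min d 1" for r \<rho> c
  proof -
    have near: "norm (s - y) < r + norm c" if "\<rho> (s - y - c) \<noteq> 0" for s y
    proof -
      have "norm (s - y - c) < r" using mollifierD(3)[OF \<rho>, of "s - y - c"] that by force
      then show ?thesis using norm_triangle_ineq[of "s - y - c" c] by simp
    qed
    have b: "\<bar>moll \<rho> c g y - g y\<bar> \<le> \<eta>" for y
    proof -
      have i1: "integrable lebesgue (\<lambda>s. \<rho> (s - y - c) * g s)" by (rule moll_has_derivative(3)[OF \<rho> gi])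
      note i2 = mollifier_shift_integral(1,2)[OF \<rho>, of y c]
      have "moll \<rho> c g y - g y = (LINT s|lebesgue. \<rho> (s - y - c) * g s - \<rho> (s - y - c) * g y)"
        using i1 i2 by (simp add: moll_def)
      also have "\<bar>\<dots>\<bar> \<le> (LINT s|lebesgue. \<rho> (s - y - c) * \<eta>)"
      proof -
        have "norm (LINT s|lebesgue. \<rho> (s - y - c) * g s - \<rho> (s - y - c) * g y) \<le> (LINT s|lebesgue. \<rho> (s - y - c) * \<eta>)"
        proof (rule Bochner_Integration.integral_norm_bound_integral)
          fix s
          show "norm (\<rho> (s - y - c) * g s - \<rho> (s - y - c) * g y) \<le> \<rho> (s - y - c) * \<eta>"
          proof (cases "\<rho> (s - y - c) = 0")
            case False
            then have "\<bar>g s - g y\<bar> \<le> \<eta>" using d(2)[of s y] near[OF False] rc by (auto simp: dist_norm)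
            then have "\<rho> (s - y - c) * \<bar>g s - g y\<bar> \<le> \<rho> (s - y - c) * \<eta>"
              using mollifierD(2)[OF \<rho>] by (rule mult_left_mono)
            then show ?thesis using mollifierD(2)[OF \<rho>, of "s - y - c"] by (simp add: right_diff_distrib[symmetric] abs_mult)
          qed simp
        qed (use i1 i2 in auto)
        then show ?thesis by simp
      qed
      also have "\<dots> = \<eta>" using i2 by simp
      finally show ?thesis .
    qed
    have zero: "moll \<rho> c g y - g y = 0" if "R + 1 \<le> norm y" for y
    proof -
      have "\<rho> (s - y - c) * g s = 0" for s
      proof (cases "\<rho> (s - y - c) = 0")
        case False
        then have "norm (s - y) < 1" using near[OF False] rc by auto
        then have "R \<le> norm s" using that norm_triangle_ineq2[of y s] by (simp add: norm_minus_commute)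
        then show ?thesis using z by simp
      qed simp
      then have "moll \<rho> c g y = 0" unfolding moll_def by (simp only: integral_zero)
      moreover have "g y = 0" using z[of y] that by simp
      ultimately show ?thesis by simp
    qed
    have "(LINT x|lebesgue. (moll \<rho> c g x - g x)\<^sup>2) \<le> (LINT x|lebesgue. \<eta>\<^sup>2 * indicator (cball (0::real^'d) (R + 1)) x)"
    proof (rule integral_mono)
      show "integrable lebesgue (\<lambda>x. (moll \<rho> c g x - g x)\<^sup>2)"
        using L2_diff[OF moll_L2_bound(1)[OF \<rho> gL gi] gL] by (simp add: L2_UNIV_real)
      show "integrable lebesgue (\<lambda>x::real^'d. \<eta>\<^sup>2 * indicator (cball 0 (R + 1)) x :: real)"
        by (intro integrable_mult_right integrable_indicator_cball)
      fix x
      have "(moll \<rho> c g x - g x)\<^sup>2 \<le> \<eta>\<^sup>2" using b[of x] \<eta>(1) by (simp add: abs_le_square_iff[symmetric])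
      then show "(moll \<rho> c g x - g x)\<^sup>2 \<le> \<eta>\<^sup>2 * indicator (cball 0 (R + 1)) x"
        using zero[of x] by (auto simp: indicator_def dist_norm)
    qed
    also have "\<dots> = \<eta>\<^sup>2 * A" by (simp add: A_def)
    finally show ?thesis using \<eta>(2) by simp
  qed
  then show ?thesis using d(1) by (intro exI[of _ "min d 1"]) auto
qed

text \<open>The bound in \<open>moll_L2_bound\<close> is uniform in kernel and shift, so the
  continuous case carries over by density. Nothing but r + norm c has to be small, which permits
  different kernels and shifts on different patches.\<close>

lemma moll_close:
  fixes f :: "real^'d::finite \<Rightarrow> real"
  assumes f: "f \<in> L2 UNIV" and z: "\<And>x. R \<le> norm x \<Longrightarrow> f x = 0" and "e > 0"
  shows "\<exists>\<delta>>0. \<forall>r \<rho> c. mollifier r \<rho> \<and> r + norm c < \<delta> \<longrightarrow>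
      (LINT x|lebesgue. (moll \<rho> c f x - f x)\<^sup>2) < e"
proof -
  \<comment> \<open>The three errors enter the estimate with the weights 4, 4 and 2, so twelfths
    leave a strict inequality.\<close>
  obtain g where g: "continuous_on UNIV g" "\<And>x. R + 1 \<le> norm x \<Longrightarrow> g x = 0" "(LINT x|lebesgue. (f x - g x)\<^sup>2) < e/12"
    using L2_approx_continuous[of f R "e/12"] f z \<open>e > 0\<close> by auto
  obtain \<delta> where \<delta>: "\<delta> > 0" "\<And>r \<rho> c. mollifier r \<rho> \<Longrightarrow> r + norm c <
      \<delta> \<Longrightarrow> (LINT x|lebesgue. (moll \<rho> c g x - g x)\<^sup>2) < e/12"
    using moll_close_continuous[of g "R + 1" "e/12"] g(1,2) \<open>e > 0\<close> by auto
  have fi: "integrable lebesgue f" by (rule L2_bounded_support_integrable[OF f z])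
  have gL: "g \<in> L2 UNIV" by (rule L2_continuous_bounded_support[OF g(1,2)])
  have gi: "integrable lebesgue g" by (rule L2_bounded_support_integrable[OF gL g(2)])
  have dL: "(\<lambda>x. f x - g x) \<in> L2 UNIV" by (rule L2_diff[OF f gL])
  have di: "integrable lebesgue (\<lambda>x. f x - g x)" using fi gi by simp
  have "(LINT x|lebesgue. (moll \<rho> c f x - f x)\<^sup>2) < e" if \<rho>: "mollifier r \<rho>" and rc: "r + norm c < \<delta>" for r \<rho> c
  proof -
    define a where "a = moll \<rho> c (\<lambda>x. f x - g x)"
    define b where "b x = moll \<rho> c g x - g x" for x
    define h where "h x = f x - g x" for x
    have aL: "a \<in> L2 UNIV" unfolding a_def by (rule moll_L2_bound(1)[OF \<rho> dL di])
    have bL: "b \<in> L2 UNIV" unfolding b_def[abs_def] by (intro L2_diff moll_L2_bound(1)[OF \<rho>] gL gi)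
    have hL: "h \<in> L2 UNIV" unfolding h_def[abs_def] by (rule dL)
    have i: "integrable lebesgue (\<lambda>x. (a x)\<^sup>2)" "integrable lebesgue (\<lambda>x. (b x)\<^sup>2)"
        "integrable lebesgue (\<lambda>x. (h x)\<^sup>2)"
      using aL bL hL by (auto simp: L2_UNIV_real)
    have A: "(LINT x|lebesgue. (a x)\<^sup>2) < e/12"
      unfolding a_def using moll_L2_bound(2)[OF \<rho> dL di] g(3) by (rule le_less_trans)
    have B: "(LINT x|lebesgue. (b x)\<^sup>2) < e/12"
      unfolding b_def by (rule \<delta>(2)[OF \<rho> rc])
    have H: "(LINT x|lebesgue. (h x)\<^sup>2) < e/12" using g(3) by (simp add: h_def)
    have eq: "moll \<rho> c f x - f x = (a x + b x) - h x" for x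
      unfolding a_def b_def h_def using moll_diff[OF \<rho> fi gi] by simp
    have sq: "((a x + b x) - h x)\<^sup>2 \<le> 4 * (a x)\<^sup>2 + 4 * (b x)\<^sup>2 + 2 * (h x)\<^sup>2" for x
      using norm_add_square_le[of "a x + b x" "- h x"] norm_add_square_le[of "a x" "b x"] by simp
    have "(LINT x|lebesgue. (moll \<rho> c f x - f x)\<^sup>2) \<le> (LINT x|lebesgue. 4 * (a x)\<^sup>2 + 4 * (b x)\<^sup>2 + 2 * (h x)\<^sup>2)"
    proof (rule integral_mono)
      show "integrable lebesgue (\<lambda>x. (moll \<rho> c f x - f x)\<^sup>2)"
        using L2_diff[OF moll_L2_bound(1)[OF \<rho> f fi] f] by (simp add: L2_UNIV_real)
    qed (use i sq eq in auto)
    also have "\<dots> = 4 * (LINT x|lebesgue. (a x)\<^sup>2) + 4 * (LINT x|lebesgue. (b x)\<^sup>2) + 2 * (LINT x|lebesgue. (h x)\<^sup>2)"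
      using i by simp
    also have "\<dots> < e" using A B H \<open>e > 0\<close> by simp
    finally show ?thesis .
  qed
  then show ?thesis using \<delta>(1) by blast
qed


subsection \<open>Weak gradients\<close>

definition zero_ext :: "'a set \<Rightarrow> ('a \<Rightarrow> real) \<Rightarrow> 'a \<Rightarrow> real"
  where "zero_ext \<Omega> f x = (if x \<in> \<Omega> then f x else 0)"

lemma LINT_lebesgue_on:
  assumes "\<Omega> \<in> sets lebesgue"
  shows "(LINT x|lebesgue_on \<Omega>. f x) = (LINT x|lebesgue. zero_ext \<Omega> f x)"
    "integrable (lebesgue_on \<Omega>) f \<longleftrightarrow> integrable lebesgue (zero_ext \<Omega> f)"
proof -
  have eq: "(\<lambda>x. indicator \<Omega> x * f x) = zero_ext \<Omega> f" by (auto simp: fun_eq_iff zero_ext_def indicator_def)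
  show "(LINT x|lebesgue_on \<Omega>. f x) = (LINT x|lebesgue. zero_ext \<Omega> f x)"
    using integral_restrict_space[of \<Omega> lebesgue f] assms by (simp add: eq)
  show "integrable (lebesgue_on \<Omega>) f \<longleftrightarrow> integrable lebesgue (zero_ext \<Omega> f)"
    using integrable_restrict_space[of \<Omega> lebesgue f] assms by (simp add: eq)
qed

lemma zero_ext_measurable:
  assumes "\<Omega> \<in> sets lebesgue"
  shows "f \<in> borel_measurable (lebesgue_on \<Omega>) \<longleftrightarrow> zero_ext \<Omega> f \<in> borel_measurable lebesgue"
  unfolding zero_ext_def[abs_def] using borel_measurable_if[OF assms, of f] by simp

lemma zero_ext_L2:
  assumes "\<Omega> \<in> sets lebesgue"
  shows "f \<in> L2 \<Omega> \<longleftrightarrow> zero_ext \<Omega> f \<in> L2 UNIV"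
proof -
  have "zero_ext \<Omega> (\<lambda>x. (norm (f x))\<^sup>2) = (\<lambda>x. (zero_ext \<Omega> f x)\<^sup>2)"
    by (auto simp: zero_ext_def fun_eq_iff)
  then show ?thesis
    using zero_ext_measurable[OF assms, of f] LINT_lebesgue_on(2)[OF assms, of "\<lambda>x. (norm (f x))\<^sup>2"]
    by (simp add: L2_def lebesgue_on_UNIV_eq)
qed

lemma C_k_translate: "C_k k f \<Longrightarrow> C_k k (\<lambda>s. f (s - a))"
proof (induction k arbitrary: f)
  case 0
  then show ?case by (auto intro!: continuous_on_compose2[of UNIV f] continuous_intros)
next
  case (Suc k)
  have d: "((\<lambda>s. f (s - a)) has_derivative (\<lambda>v. grad f (x - a) \<bullet> v)) (at x)" for x
  proof -
    have "((\<lambda>z. z - a) has_derivative (\<lambda>v. v)) (at x)" by (auto intro!: derivative_eq_intros)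
    moreover have "(f has_derivative (\<lambda>v. grad f (x - a) \<bullet> v)) (at (x - a))"
      using Suc.prems by (intro has_derivative_grad) simp
    ultimately show ?thesis by (rule has_derivative_compose)
  qed
  have "partial_deriv i (\<lambda>s. f (s - a)) = (\<lambda>s. partial_deriv i f (s - a))" for i
    using partial_deriv_inner[OF d] by (simp add: fun_eq_iff grad_def)
  moreover have "(\<lambda>s. f (s - a)) differentiable (at x)" for x using d differentiable_def by blast
  ultimately show ?case using Suc by simp
qed

lemma mollifier_test_function:
  assumes \<rho>: "mollifier r \<rho>" and sub: "cball (y + c) r \<subseteq> \<Omega>"
  shows "test_function \<Omega> (\<lambda>s. \<rho> (s - y - c))"
    and "partial_deriv i (\<lambda>s. \<rho> (s - y - c)) s = grad \<rho> (s - y - c) $ i"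
proof -
  have supp: "closure {s. \<rho> (s - y - c) \<noteq> 0} \<subseteq> cball (y + c) r"
  proof (rule closure_minimal)
    show "{s. \<rho> (s - y - c) \<noteq> 0} \<subseteq> cball (y + c) r"
    proof
      fix s assume "s \<in> {s. \<rho> (s - y - c) \<noteq> 0}"
      then have "norm (s - y - c) < r" using mollifierD(3)[OF \<rho>, of "s - y - c"] by force
      then show "s \<in> cball (y + c) r" by (simp add: dist_norm norm_minus_commute algebra_simps)
    qed
  qed simp
  have "C_k k (\<lambda>s. \<rho> (s - y - c))" for k
    using C_k_translate[OF mollifierD(1)[OF \<rho>], of k "y + c"] by (simp add: diff_diff_eq)
  moreover have "compact (closure {s. \<rho> (s - y - c) \<noteq> 0})"
    using supp bounded_cball bounded_subset by (auto simp: compact_eq_bounded_closed)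
  ultimately show "test_function \<Omega> (\<lambda>s. \<rho> (s - y - c))"
    using supp sub unfolding test_function_def by blast
  have "((\<lambda>z. z - y - c) has_derivative (\<lambda>v. v)) (at s)" by (auto intro!: derivative_eq_intros)
  from has_derivative_compose[OF this C_1D(1)[OF mollifierD(1)[OF \<rho>]]]
  show "partial_deriv i (\<lambda>s. \<rho> (s - y - c)) s = grad \<rho> (s - y - c) $ i"
    by (rule partial_deriv_inner)
qed

lemma moll_zero_ext:
  assumes "\<Omega> \<in> sets lebesgue"
  shows "moll \<rho> c (zero_ext \<Omega> g) y = (LINT s|lebesgue_on \<Omega>. g s * \<rho> (s - y - c))"
  unfolding moll_def LINT_lebesgue_on(1)[OF assms]
  by (intro Bochner_Integration.integral_cong) (auto simp: zero_ext_def)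

text \<open>Where the kernel's ball lies in \<Omega>, the translated kernel is itself a test
  function, and the weak gradient identity moves the derivative from the kernel to \<open>u\<close>.
  At other points the jump of the zero extension may contribute.\<close>

lemma moll_weak_gradient:
  fixes \<Omega> :: "(real^'d::finite) set"
  assumes \<Omega>: "\<Omega> \<in> sets lebesgue" "bounded \<Omega>" and \<rho>: "mollifier r \<rho>" and sub: "cball (y + c) r \<subseteq> \<Omega>"
    and u: "u \<in> L2 \<Omega>" and wg: "is_weak_gradient \<Omega> u G"
  shows "(- (LINT s|lebesgue. zero_ext \<Omega> u s *\<^sub>R grad \<rho> (s - y - c))) $ i = moll \<rho> c (zero_ext
      \<Omega> (\<lambda>x. G x $ i)) y"
proof -
  have "integrable lebesgue (zero_ext \<Omega> u)"
    using L2_integrable[OF \<Omega>(2,1) u] LINT_lebesgue_on(2)[OF \<Omega>(1)] by blast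
  from moll_has_derivative(4)[OF \<rho> this]
  have int: "integrable lebesgue (\<lambda>s. zero_ext \<Omega> u s *\<^sub>R grad \<rho> (s - y - c))" .
  have "(LINT s|lebesgue. zero_ext \<Omega> u s *\<^sub>R grad \<rho> (s - y - c)) $ i
      = (LINT s|lebesgue. (zero_ext \<Omega> u s *\<^sub>R grad \<rho> (s - y - c)) $ i)"
    using integral_bounded_linear[OF bounded_linear_vec_nth int] by simp
  also have "\<dots> = (LINT s|lebesgue_on \<Omega>. u s * partial_deriv i (\<lambda>s. \<rho> (s - y - c)) s)"
    unfolding LINT_lebesgue_on(1)[OF \<Omega>(1)] mollifier_test_function(2)[OF \<rho> sub]
    by (intro Bochner_Integration.integral_cong) (auto simp: zero_ext_def)
  also have "\<dots> = - (LINT s|lebesgue_on \<Omega>. G s $ i * \<rho> (s - y - c))"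
    using wg mollifier_test_function(1)[OF \<rho> sub] unfolding is_weak_gradient_def by blast
  finally show ?thesis by (simp add: moll_zero_ext[OF \<Omega>(1)])
qed

section \<open>Uniqueness of weak gradients\<close>

text \<open>At points farther than the kernel radius from the complement, the mollification of
  \<open>g\<close> is an integral against a test function and vanishes. Hence the integral of g^2
  over \<open>Q s\<close> is at most the squared L2 distance of \<open>g\<close> to its
  mollification, which is arbitrarily small; countably many sets \<open>Q s\<close> exhaust
  \<Omega>.\<close>

lemma fundamental_lemma_variations:
  fixes \<Omega> :: "(real^'d::finite) set"
  assumes "open \<Omega>" "bounded \<Omega>" and g: "g \<in> L2 \<Omega>"
    and test: "\<And>\<phi>. test_function \<Omega> \<phi> \<Longrightarrow> (LINT x|lebesgue_on \<Omega>. g x * \<phi> x) = 0"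
  shows "AE x in lebesgue_on \<Omega>. g x = 0"
proof -
  have \<Omega>: "\<Omega> \<in> sets lebesgue" using \<open>open \<Omega>\<close> by (simp add: borel_open sets_completionI_sets)
  obtain R where R: "\<And>x. x \<in> \<Omega> \<Longrightarrow> norm x < R"
    using \<open>bounded \<Omega>\<close> unfolding bounded_pos_less by blast
  define f where "f = zero_ext \<Omega> g"
  have fL: "f \<in> L2 UNIV" using zero_ext_L2[OF \<Omega>] g by (simp add: f_def)
  have fz: "f x = 0" if "R \<le> norm x" for x using R[of x] that by (auto simp: f_def zero_ext_def)
  have fi: "integrable lebesgue f" by (rule L2_bounded_support_integrable[OF fL fz])
  have fm: "f \<in> borel_measurable lebesgue" and f2: "integrable lebesgue (\<lambda>x. (f x)\<^sup>2)"
    using fL by (auto simp: L2_UNIV_real)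
  \<comment> \<open>The distance \<open>infdist\<close> to the empty set is 0 by convention, which
    would leave the sets \<open>Q s\<close> empty.\<close>
  have ne: "- \<Omega> \<noteq> {}" using \<open>bounded \<Omega>\<close> not_bounded_UNIV by (metis Compl_empty_eq double_complement)
  define Q where "Q s = {y. s < infdist y (- \<Omega>)}" for s
  have Qo: "open (Q s)" for s
    unfolding Q_def by (intro open_Collect_less continuous_intros)
  have Qc: "cball y r \<subseteq> \<Omega>" if "y \<in> Q s" "r \<le> s" for y r s
  proof
    fix z assume "z \<in> cball y r"
    show "z \<in> \<Omega>"
    proof (rule ccontr)
      assume "z \<notin> \<Omega>"
      then have "infdist y (- \<Omega>) \<le> dist y z" by (intro infdist_le) auto
      then show False using \<open>z \<in> cball y r\<close> that by (auto simp: Q_def)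
    qed
  qed
  have Qae: "AE x in lebesgue. x \<in> Q s \<longrightarrow> f x = 0" if "s > 0" for s
  proof -
    have Qm: "Q s \<in> sets lebesgue" using Qo by (simp add: borel_open sets_completionI_sets)
    have i: "integrable lebesgue (\<lambda>x. indicator (Q s) x * (f x)\<^sup>2)"
    proof (rule Bochner_Integration.integrable_bound[OF f2])
      show "(\<lambda>x. indicator (Q s) x * (f x)\<^sup>2) \<in> borel_measurable lebesgue"
        using fm Qm by measurable
    qed (auto simp: indicator_def)
    have "(LINT x|lebesgue. indicator (Q s) x * (f x)\<^sup>2) \<le> e" if "e > 0" for e
    proof -
      obtain \<delta> where \<delta>: "\<delta> > 0" "\<And>r \<rho> c. mollifier r \<rho> \<Longrightarrow> r + norm c
          < \<delta> \<Longrightarrow> (LINT x|lebesgue. (moll \<rho> c f x - f x)\<^sup>2) < e"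
        using moll_close[of f R e] fL fz \<open>e > 0\<close> by auto
      define r where "r = min (\<delta>/2) s"
      have r: "r > 0" "r + norm (0::real^'d) < \<delta>" "r \<le> s" using \<delta>(1) \<open>s > 0\<close> by (auto simp: r_def)
      obtain \<rho> :: "real^'d \<Rightarrow> real" where \<rho>: "mollifier r \<rho>" using mollifier_exists[OF r(1)] by blast
      have z: "moll \<rho> 0 f y = 0" if "y \<in> Q s" for y
      proof -
        have "cball (y + 0) r \<subseteq> \<Omega>" using Qc[OF that r(3)] by simp
        from test[OF mollifier_test_function(1)[OF \<rho> this]] show ?thesis
          by (simp add: f_def moll_zero_ext[OF \<Omega>])
      qed
      have "(LINT x|lebesgue. indicator (Q s) x * (f x)\<^sup>2) \<le> (LINT x|lebesgue. (moll \<rho> 0 f x - f x)\<^sup>2)"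
      proof (rule integral_mono[OF i])
        show "integrable lebesgue (\<lambda>x. (moll \<rho> 0 f x - f x)\<^sup>2)"
          using L2_diff[OF moll_L2_bound(1)[OF \<rho> fL fi] fL] by (simp add: L2_UNIV_real)
      qed (use z in \<open>auto simp: indicator_def\<close>)
      also have "\<dots> \<le> e" using \<delta>(2)[OF \<rho> r(2)] by simp
      finally show ?thesis .
    qed
    then have "(LINT x|lebesgue. indicator (Q s) x * (f x)\<^sup>2) \<le> 0" by (rule field_le_epsilon) simp
    moreover have "(LINT x|lebesgue. indicator (Q s) x * (f x)\<^sup>2) \<ge> 0"
      by (intro integral_nonneg_AE AE_I2) auto
    ultimately have "(LINT x|lebesgue. indicator (Q s) x * (f x)\<^sup>2) = 0" by simp
    then have "AE x in lebesgue. indicator (Q s) x * (f x)\<^sup>2 = 0"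
      using integral_nonneg_eq_0_iff_AE[OF i] by auto
    then show ?thesis by eventually_elim (auto simp: indicator_def split: if_splits)
  qed
  have "AE x in lebesgue. \<forall>n. x \<in> Q (1 / real (Suc n)) \<longrightarrow> f x = 0"
    using Qae by (subst AE_all_countable) simp
  then have "AE x in lebesgue. x \<in> \<Omega> \<longrightarrow> g x = 0"
  proof eventually_elim
    case (elim x)
    show ?case
    proof
      assume x: "x \<in> \<Omega>"
      have "infdist x (- \<Omega>) > 0"
        using x \<open>open \<Omega>\<close> ne in_closed_iff_infdist_zero[of "- \<Omega>" x] infdist_nonneg[of x "- \<Omega>"]
        by (auto simp: less_le closed_def)
      then obtain n where "inverse (real (Suc n)) < infdist x (- \<Omega>)" using reals_Archimedean by blast
      then have "x \<in> Q (1 / real (Suc n))" by (simp add: Q_def inverse_eq_divide)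
      then have "f x = 0" using elim by blast
      then show "g x = 0" using x by (simp add: f_def zero_ext_def)
    qed
  qed
  then show ?thesis using \<Omega> by (subst AE_restrict_space_iff) auto
qed

lemma test_function_L2:
  assumes "test_function \<Omega> \<phi>" "bounded \<Omega>" "\<Omega> \<in> sets lebesgue"
  shows "\<phi> \<in> L2 \<Omega>" "partial_deriv i \<phi> \<in> L2 \<Omega>"
    and "\<exists>M\<ge>0. \<forall>x. \<bar>\<phi> x\<bar> \<le> M \<and> norm (grad \<phi> x) \<le> M"
proof -
  have C: "\<And>k. C_k k \<phi>" and S: "compact (closure {x. \<phi> x \<noteq> 0})"
    using assms(1) by (auto simp: test_function_def)
  note D = C_1D[OF C]
  obtain R where R: "\<And>x. x \<in> closure {x. \<phi> x \<noteq> 0} \<Longrightarrow> norm x < R"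
    using compact_imp_bounded[OF S] unfolding bounded_pos_less by blast
  have z: "\<phi> x = 0" if "R \<le> norm x" for x using R[of x] closure_subset[of "{x. \<phi> x \<noteq> 0}"] that by force
  have gz: "grad \<phi> x = 0" if "R + 1 \<le> norm x" for x
    by (rule grad_zero_outside[of R]) (use z that in auto)
  obtain M1 where M1: "M1 \<ge> 0" "\<And>x. norm (\<phi> x) \<le> M1" using continuous_bounded_support_bounded[OF D(3) z] by blast
  obtain M2 where M2: "M2 \<ge> 0" "\<And>x. norm (grad \<phi> x) \<le> M2" using continuous_bounded_support_bounded[OF D(2) gz] by blast
  show "\<exists>M\<ge>0. \<forall>x. \<bar>\<phi> x\<bar> \<le> M \<and> norm (grad \<phi> x) \<le> M"
    using M1 M2 by (intro exI[of _ "max M1 M2"]) (auto simp: le_max_iff_disj)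
  have m: "f \<in> borel_measurable (lebesgue_on \<Omega>)" if "continuous_on UNIV f" for f :: "_ \<Rightarrow> real"
    by (intro measurable_restrict_space1 borel_measurable_lebesgue_continuous that)
  show "\<phi> \<in> L2 \<Omega>" by (rule L2_bounded_measurable[OF assms(2,3) m[OF D(3)] M1(2)])
  have "continuous_on UNIV (partial_deriv i \<phi>)" using C[of 1] by simp
  moreover have "norm (partial_deriv i \<phi> x) \<le> M2" for x
    using Finite_Cartesian_Product.norm_nth_le[of "grad \<phi> x" i] M2(2)[of x] by (simp add: grad_def)
  ultimately show "partial_deriv i \<phi> \<in> L2 \<Omega>" by (intro L2_bounded_measurable[OF assms(2,3) m]) 
qed

lemma is_weak_gradient_lincomb:
  assumes "bounded \<Omega>" "\<Omega> \<in> sets lebesgue"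
    and "u \<in> L2 \<Omega>" "G \<in> L2 \<Omega>" "is_weak_gradient \<Omega> u G"
    and "v \<in> L2 \<Omega>" "H \<in> L2 \<Omega>" "is_weak_gradient \<Omega> v H"
  shows "is_weak_gradient \<Omega> (\<lambda>x. a * u x + b * v x) (\<lambda>x. a *\<^sub>R G x + b *\<^sub>R H x)"
  unfolding is_weak_gradient_def
proof (intro allI impI)
  fix \<phi> i assume \<phi>: "test_function \<Omega> \<phi>"
  note t = test_function_L2(1,2)[OF \<phi> assms(1,2)]
  have i: "integrable (lebesgue_on \<Omega>) (\<lambda>x. u x * partial_deriv i \<phi> x)" "integrable (lebesgue_on
      \<Omega>) (\<lambda>x. v x * partial_deriv i \<phi> x)"
    "integrable (lebesgue_on \<Omega>) (\<lambda>x. G x $ i * \<phi> x)" "integrable (lebesgue_on \<Omega>) (\<lambda>x. H x $ i * \<phi> x)"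
    using t assms by (auto intro!: L2_integrable_mult L2_component)
  have "(LINT x|lebesgue_on \<Omega>. (a * u x + b * v x) * partial_deriv i \<phi> x) =
     a * (LINT x|lebesgue_on \<Omega>. u x * partial_deriv i \<phi> x) + b * (LINT x|lebesgue_on \<Omega>. v x * partial_deriv i \<phi> x)"
    using i by (simp add: distrib_right mult.assoc)
  also have "\<dots> = a * - (LINT x|lebesgue_on \<Omega>. G x $ i * \<phi> x) + b * - (LINT x|lebesgue_on \<Omega>. H x $ i * \<phi> x)"
    using assms(5,8) \<phi> unfolding is_weak_gradient_def by simp
  also have "\<dots> = - (LINT x|lebesgue_on \<Omega>. (a *\<^sub>R G x + b *\<^sub>R H x) $ i * \<phi> x)"
    using i by (simp add: distrib_right mult.assoc)
  finally show "(LINT x|lebesgue_on \<Omega>. (a * u x + b * v x) * partial_deriv i \<phi> x) =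
    - (LINT x|lebesgue_on \<Omega>. (a *\<^sub>R G x + b *\<^sub>R H x) $ i * \<phi> x)" .
qed

text \<open>A relation in place of the choice \<open>weak_gradient\<close>, so that explicit
  gradients can be used; \<open>has_wgrad_unique\<close> and \<open>H1_norm_square\<close> lead back
  to the chosen one.\<close>

definition has_wgrad :: "(real^'d::finite) set \<Rightarrow> (real^'d \<Rightarrow> real) \<Rightarrow> (real^'d
    \<Rightarrow> real^'d) \<Rightarrow> bool"
  where "has_wgrad \<Omega> u G \<longleftrightarrow> u \<in> L2 \<Omega> \<and> G \<in> L2 \<Omega> \<and> is_weak_gradient \<Omega> u G"

lemma H1_iff_has_wgrad: "u \<in> H1 \<Omega> \<longleftrightarrow> (\<exists>G. has_wgrad \<Omega> u G)"
  by (auto simp: H1_def has_wgrad_def)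

lemma has_wgrad_lincomb:
  assumes "bounded \<Omega>" "\<Omega> \<in> sets lebesgue" "has_wgrad \<Omega> u G" "has_wgrad \<Omega> v H"
  shows "has_wgrad \<Omega> (\<lambda>x. a * u x + b * v x) (\<lambda>x. a *\<^sub>R G x + b *\<^sub>R H x)"
  using assms is_weak_gradient_lincomb[OF assms(1,2)] L2_add[OF L2_scaleR L2_scaleR, of u \<Omega> v a b]
    L2_add[OF L2_scaleR L2_scaleR, of G \<Omega> H a b]
  by (auto simp: has_wgrad_def)

lemma has_wgrad_zero: "has_wgrad \<Omega> (\<lambda>x. 0) (\<lambda>x. 0)"
  by (simp add: has_wgrad_def L2_zero is_weak_gradient_def)

text \<open>Transfers a gradient from a finite element function to the arbitrary representatives
  collected in \<open>ae_classes\<close>.\<close>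

lemma has_wgrad_AE:
  assumes "\<Omega> \<in> sets lebesgue" "bounded \<Omega>" "has_wgrad \<Omega> u G" "AE x in lebesgue_on \<Omega>. u x = v x"
  shows "has_wgrad \<Omega> v G"
proof -
  have u: "u \<in> L2 \<Omega>" using assms by (simp add: has_wgrad_def)
  have v: "v \<in> L2 \<Omega>" by (rule L2_AE[OF assms(1) u assms(4)])
  have "is_weak_gradient \<Omega> v G" unfolding is_weak_gradient_def
  proof (intro allI impI)
    fix \<phi> i assume \<phi>: "test_function \<Omega> \<phi>"
    note t = test_function_L2(2)[OF \<phi> assms(2,1), of i]
    have "(LINT x|lebesgue_on \<Omega>. v x * partial_deriv i \<phi> x) = (LINT x|lebesgue_on \<Omega>. u x * partial_deriv i \<phi> x)"
    proof (rule integral_cong_AE)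
      show "AE x in lebesgue_on \<Omega>. v x * partial_deriv i \<phi> x = u x * partial_deriv i \<phi> x"
        using assms(4) by eventually_elim simp
    qed (use L2_integrable_mult[OF v t] L2_integrable_mult[OF u t] in auto)
    then show "(LINT x|lebesgue_on \<Omega>. v x * partial_deriv i \<phi> x) = - (LINT x|lebesgue_on \<Omega>. G x $ i * \<phi> x)"
      using assms(3) \<phi> by (simp add: has_wgrad_def is_weak_gradient_def)
  qed
  with v assms(3) show ?thesis by (simp add: has_wgrad_def)
qed

lemma has_wgrad_unique:
  fixes \<Omega> :: "(real^'d::finite) set"
  assumes "open \<Omega>" "bounded \<Omega>" "has_wgrad \<Omega> u G" "has_wgrad \<Omega> u H"
  shows "AE x in lebesgue_on \<Omega>. G x = H x"
proof -
  have \<Omega>: "\<Omega> \<in> sets lebesgue" using \<open>open \<Omega>\<close> by (simp add: borel_open sets_completionI_sets)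
  have d: "has_wgrad \<Omega> (\<lambda>x. 1 * u x + (-1) * u x) (\<lambda>x. 1 *\<^sub>R G x + (-1) *\<^sub>R H x)"
    by (rule has_wgrad_lincomb[OF assms(2) \<Omega> assms(3,4)])
  have "AE x in lebesgue_on \<Omega>. (1 *\<^sub>R G x + (-1) *\<^sub>R H x) $ i = 0" for i
  proof (rule fundamental_lemma_variations[OF assms(1,2)])
    show "(\<lambda>x. (1 *\<^sub>R G x + (-1) *\<^sub>R H x) $ i) \<in> L2 \<Omega>"
      using d unfolding has_wgrad_def by (intro L2_component) blast
    fix \<phi> assume "test_function \<Omega> \<phi>"
    then show "(LINT x|lebesgue_on \<Omega>. (1 *\<^sub>R G x + (-1) *\<^sub>R H x) $ i * \<phi> x) = 0"
      using d unfolding has_wgrad_def is_weak_gradient_def by simp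
  qed
  then have "AE x in lebesgue_on \<Omega>. \<forall>i. (1 *\<^sub>R G x + (-1) *\<^sub>R H x) $ i = 0"
    unfolding AE_all_countable by simp
  then show ?thesis by eventually_elim (auto simp: vec_eq_iff)
qed

lemma weak_gradient_has_wgrad:
  assumes "u \<in> H1 \<Omega>"
  shows "has_wgrad \<Omega> u (weak_gradient \<Omega> u)"
proof -
  have "\<exists>G. G \<in> L2 \<Omega> \<and> is_weak_gradient \<Omega> u G" using assms by (auto simp: H1_def)
  from someI_ex[OF this] assms show ?thesis by (simp add: has_wgrad_def weak_gradient_def H1_def)
qed

lemma H1_norm_square:
  fixes \<Omega> :: "(real^'d::finite) set"
  assumes "open \<Omega>" "bounded \<Omega>" "has_wgrad \<Omega> u G"
  shows "(H1_norm \<Omega> u)\<^sup>2 = (LINT x|lebesgue_on \<Omega>. (u x)\<^sup>2) + (LINT x|lebesgue_on \<Omega>. (norm (G x))\<^sup>2)"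
proof -
  have w: "has_wgrad \<Omega> u (weak_gradient \<Omega> u)" using assms weak_gradient_has_wgrad H1_iff_has_wgrad by blast
  have "(LINT x|lebesgue_on \<Omega>. (norm (weak_gradient \<Omega> u x))\<^sup>2) = (LINT x|lebesgue_on \<Omega>. (norm (G x))\<^sup>2)"
  proof (rule integral_cong_AE)
    show "AE x in lebesgue_on \<Omega>. (norm (weak_gradient \<Omega> u x))\<^sup>2 = (norm (G x))\<^sup>2"
      using has_wgrad_unique[OF assms(1,2) w assms(3)] by eventually_elim simp
  qed (use w assms(3) L2D(2) in \<open>auto simp: has_wgrad_def\<close>)
  then show ?thesis by (simp add: H1_norm_def)
qed

lemma H1_vec_subspace:
  fixes \<Omega> :: "(real^'d::finite) set"
  assumes "bounded \<Omega>" "\<Omega> \<in> sets lebesgue"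
  shows "subspace (H1_vec \<Omega> :: (real^'d \<Rightarrow> real^'n::finite) set)"
proof (rule subspaceI)
  show "0 \<in> (H1_vec \<Omega> :: (real^'d \<Rightarrow> real^'n) set)"
    using has_wgrad_zero by (auto simp: H1_vec_def H1_iff_has_wgrad)
next
  fix u v :: "real^'d \<Rightarrow> real^'n" assume "u \<in> H1_vec \<Omega>" "v \<in> H1_vec \<Omega>"
  then show "u + v \<in> H1_vec \<Omega>"
    using has_wgrad_lincomb[OF assms, where a=1 and b=1] by (simp add: H1_vec_def H1_iff_has_wgrad) blast
next
  fix c and u :: "real^'d \<Rightarrow> real^'n" assume "u \<in> H1_vec \<Omega>"
  then show "c *\<^sub>R u \<in> H1_vec \<Omega>"
    using has_wgrad_lincomb[OF assms _ has_wgrad_zero, where a=c and b=0]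
    by (simp add: H1_vec_def H1_iff_has_wgrad scaleR_fun_def) blast
qed


subsection \<open>Weak gradients of piecewise smooth functions\<close>

text \<open>The constant is crude: the linear part contributes B and the remainder of
  \<open>gradient_linearization\<close> the oscillation 2 B. Only its finiteness matters
  later.\<close>

lemma lipschitz_of_gradient_bound:
  fixes h :: "'a::euclidean_space \<Rightarrow> real"
  assumes "convex S" and d: "\<And>z. z \<in> S \<Longrightarrow> (h has_derivative (\<lambda>v. g z \<bullet> v)) (at z)"
    and B: "\<And>z. z \<in> S \<Longrightarrow> norm (g z) \<le> B" and "0 \<le> B"
  shows "(3 * B)-lipschitz_on S h"
proof (rule lipschitz_onI)
  fix a b assume ab: "a \<in> S" "b \<in> S"
  have "\<bar>h a - h b - g b \<bullet> (a - b)\<bar> \<le> norm (a - b) * (2 * B)"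
  proof (rule gradient_linearization[OF \<open>convex S\<close> ab(2,1) d])
    show "norm (g z - g b) \<le> 2 * B" if "z \<in> S" for z
      using norm_triangle_ineq4[of "g z" "g b"] B[OF that] B[OF ab(2)] by linarith
  qed
  moreover have "\<bar>g b \<bullet> (a - b)\<bar> \<le> norm (g b) * norm (a - b)" by (rule Cauchy_Schwarz_ineq2)
  moreover have "norm (g b) * norm (a - b) \<le> B * norm (a - b)" by (intro mult_right_mono B ab) auto
  ultimately have "\<bar>h a - h b\<bar> \<le> norm (a - b) * (2 * B) + B * norm (a - b)" by linarith
  then show "dist (h a) (h b) \<le> 3 * B * dist a b" by (simp add: dist_norm algebra_simps)
qed (use assms in auto)

text \<open>On the segment from x to y the pieces have closed preimages that cover the unit
  interval, so the claim reduces to a finite closed cover of an interval, with no convexity of the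
  pieces.\<close>

lemma lipschitz_closed_cover:
  fixes f :: "'a::euclidean_space \<Rightarrow> real"
  assumes "finite F" "\<And>A. A \<in> F \<Longrightarrow> closed A" "\<Union>F = UNIV" "0 \<le> M" and lip: "\<And>A.
      A \<in> F \<Longrightarrow> M-lipschitz_on A f"
  shows "M-lipschitz_on UNIV f"
proof (rule lipschitz_onI)
  fix x y :: 'a
  define p where "p t = x + t *\<^sub>R (y - x)" for t :: real
  have pc: "continuous_on UNIV p" unfolding p_def[abs_def] by (intro continuous_intros)
  have "(M * norm (y - x))-lipschitz_on {0..1} (\<lambda>t. f (p t))"
  proof (rule lipschitz_on_closed_Union[where I=F and U="\<lambda>A. p -` A"])
    show "closed (p -` A)" if "A \<in> F" for A
      by (rule continuous_closed_vimage[OF assms(2)[OF that]]) (use pc in \<open>simp add: continuous_on_eq_continuous_at\<close>)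
    show "(M * norm (y - x))-lipschitz_on (p -` A) (\<lambda>t. f (p t))" if "A \<in> F" for A
    proof (rule lipschitz_onI)
      fix s t assume st: "s \<in> p -` A" "t \<in> p -` A"
      have "dist (f (p s)) (f (p t)) \<le> M * dist (p s) (p t)" using lipschitz_onD[OF lip[OF that]] st by auto
      also have "dist (p s) (p t) = dist s t * norm (y - x)"
        by (simp add: p_def dist_norm scaleR_diff_left[symmetric])
      finally show "dist (f (p s)) (f (p t)) \<le> M * norm (y - x) * dist s t" by (simp add: mult_ac)
    qed (use \<open>0 \<le> M\<close> in auto)
    have "\<exists>A\<in>F. p t \<in> A" for t using assms(3) by (metis UNIV_I UnionE)
    then show "{0..1} \<subseteq> (\<Union>A\<in>F. p -` A)" by auto
  qed (use assms(1,4) in auto)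
  from lipschitz_onD[OF this, of 0 1]
  show "dist (f x) (f y) \<le> M * dist x y" by (simp add: p_def dist_norm norm_minus_commute)
qed fact

lemma lborel_integral_shift:
  fixes f :: "'a::euclidean_space \<Rightarrow> real"
  assumes "f \<in> borel_measurable borel"
  shows "integrable lborel (\<lambda>x. f (x + a)) \<longleftrightarrow> integrable lborel f"
    and "integral\<^sup>L lborel (\<lambda>x. f (x + a)) = integral\<^sup>L lborel f"
proof -
  have "integrable (distr lborel borel ((+) a)) f \<longleftrightarrow> integrable lborel (\<lambda>x. f (a + x))"
    using assms by (intro integrable_distr_eq) auto
  then show "integrable lborel (\<lambda>x. f (x + a)) \<longleftrightarrow> integrable lborel f"
    by (simp add: lborel_distr_plus add.commute)
  have "integral\<^sup>L (distr lborel borel ((+) a)) f = integral\<^sup>L lborel (\<lambda>x. f (a + x))"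
    using assms by (intro integral_distr) auto
  then show "integral\<^sup>L lborel (\<lambda>x. f (x + a)) = integral\<^sup>L lborel f"
    by (simp add: lborel_distr_plus add.commute)
qed

lemma directional_difference_quotient:
  fixes f :: "'a::real_normed_vector \<Rightarrow> real"
  assumes "(f has_derivative f') (at x)"
  shows "(\<lambda>n. (f (x + (1 / real (Suc n)) *\<^sub>R e) - f x) * real (Suc n)) \<longlonglongrightarrow> f' e"
proof -
  have "((\<lambda>t. f (x + t *\<^sub>R e)) has_derivative (\<lambda>t. f' (t *\<^sub>R e))) (at 0)"
  proof (rule has_derivative_compose[of "\<lambda>t. x + t *\<^sub>R e" "\<lambda>t. t *\<^sub>R e" 0 UNIV f f'])
    show "((\<lambda>t. x + t *\<^sub>R e) has_derivative (\<lambda>t. t *\<^sub>R e)) (at 0)" by (auto intro!: derivative_eq_intros)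
  qed (use assms in simp)
  moreover have "(\<lambda>t. f' (t *\<^sub>R e)) = (*) (f' e)"
    using linear_scale[OF has_derivative_linear[OF assms]] by (auto simp: mult.commute)
  ultimately have "((\<lambda>t. f (x + t *\<^sub>R e)) has_field_derivative f' e) (at 0)"
    by (simp add: has_field_derivative_def)
  then have 1: "((\<lambda>h. (f (x + h *\<^sub>R e) - f x) / h) \<longlongrightarrow> f' e) (at 0)" by (simp add: DERIV_def)
  have 2: "filterlim (\<lambda>n. 1 / real (Suc n)) (at 0) sequentially"
    using LIMSEQ_inverse_real_of_nat by (intro filterlim_atI) (auto simp: inverse_eq_divide)
  from filterlim_compose[OF 1 2] show ?thesis by simp
qed

text \<open>For a test function \<open>\<phi>\<close>, the product \<open>u \<phi>\<close>, extended by zero, is Lipschitz on the whole space.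
  By translation invariance its difference quotients have integral zero, and
  dominated convergence yields the integration by parts formula.\<close>

lemma lipschitz_has_wgrad:
  fixes \<Omega> :: "(real^'d::finite) set"
  assumes \<Omega>: "open \<Omega>" "bounded \<Omega>" and fin: "finite \<T>" and un: "\<Union>\<T> = closure \<Omega>"
    and cl: "\<And>T. T \<in> \<T> \<Longrightarrow> closed T" and lip: "\<And>T. T \<in> \<T> \<Longrightarrow> L-lipschitz_on T u" and "0 \<le> L"
    and Gm: "G \<in> borel_measurable (lebesgue_on \<Omega>)" and Gb: "\<And>x. x \<in> \<Omega> \<Longrightarrow> norm (G x) \<le> M"
    and d: "AE x in lebesgue_on \<Omega>. (u has_derivative (\<lambda>v. G x \<bullet> v)) (at x)"
  shows "has_wgrad \<Omega> u G"
proof -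
  have \<Omega>s: "\<Omega> \<in> sets lebesgue" using \<Omega> by (simp add: borel_open sets_completionI_sets)
  have uc: "continuous_on (closure \<Omega>) u"
    using continuous_on_closed_Union[OF fin cl, of "\<lambda>T. T" u] lipschitz_on_continuous_on[OF lip] un by simp
  have "compact (closure \<Omega>)" using \<Omega> by (simp add: compact_closure)
  then have "bounded (u ` closure \<Omega>)" using uc compact_continuous_image compact_imp_bounded by blast
  then obtain B where B: "\<And>x. x \<in> closure \<Omega> \<Longrightarrow> \<bar>u x\<bar> \<le> B" unfolding
      bounded_iff by (auto simp: real_norm_def)
  have uc': "continuous_on \<Omega> u" using uc closure_subset continuous_on_subset by blast
  have um: "u \<in> borel_measurable (lebesgue_on \<Omega>)"
    by (rule continuous_imp_measurable_on_sets_lebesgue[OF uc' \<Omega>s])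
  have uL: "u \<in> L2 \<Omega>"
    by (rule L2_bounded_measurable[OF \<Omega>(2) \<Omega>s um]) (use B closure_subset in auto)
  have GL: "G \<in> L2 \<Omega>" by (rule L2_bounded_measurable[OF \<Omega>(2) \<Omega>s Gm Gb])
  have "is_weak_gradient \<Omega> u G" unfolding is_weak_gradient_def
  proof (intro allI impI)
    fix \<phi> i assume \<phi>: "test_function \<Omega> \<phi>"
    define S where "S = closure {x. \<phi> x \<noteq> 0}"
    have C: "\<And>k. C_k k \<phi>" and S: "compact S" "S \<subseteq> \<Omega>" using \<phi> by (auto simp: test_function_def S_def)
    have \<phi>z: "\<phi> x = 0" if "x \<notin> S" for x using that closure_subset[of "{x. \<phi> x \<noteq> 0}"] by (auto simp: S_def)
    note D = C_1D[OF C]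
    obtain K where K: "K \<ge> 0" "\<And>x. \<bar>\<phi> x\<bar> \<le> K" "\<And>x. norm (grad \<phi> x) \<le> K"
      using test_function_L2(3)[OF \<phi> \<Omega>(2) \<Omega>s] by blast
    have \<phi>lip: "(3 * K)-lipschitz_on UNIV \<phi>"
      by (rule lipschitz_of_gradient_bound[OF convex_UNIV D(1)]) (use K in auto)
    define f where "f x = u x * \<phi> x" for x
    \<comment> \<open>The zero set of \<phi> is the piece that completes the cells to a closed cover
      of the whole space: the product vanishes on it, whatever \<open>u\<close> is outside the
      domain.\<close>
    define Z where "Z = {x. \<phi> x = 0}"
    define N where "N = \<bar>B\<bar> * (3 * K) + K * L"
    have N0: "0 \<le> N" using K(1) \<open>0 \<le> L\<close> by (simp add: N_def)
    \<comment> \<open>N is the product rule constant: a bound of u times the Lipschitz constant 3 K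
      of \<phi>, plus a bound of \<phi> times that of u on a cell.\<close>
    have flip: "N-lipschitz_on UNIV f"
    proof (rule lipschitz_closed_cover[of "insert Z \<T>"])
      show "closed A" if "A \<in> insert Z \<T>" for A
        using that cl D(3) by (auto simp: Z_def intro!: closed_Collect_eq)
      show "\<Union>(insert Z \<T>) = UNIV" 
      proof -
        have "x \<in> \<Union>(insert Z \<T>)" for x
          using un S(2) \<phi>z[of x] closure_subset[of \<Omega>] by (cases "x \<in> S") (auto simp: Z_def)
        then show ?thesis by blast
      qed
      show "N-lipschitz_on A f" if A: "A \<in> insert Z \<T>" for A
      proof (cases "A = Z")
        case True
        then show ?thesis using N0 by (auto intro!: lipschitz_onI simp: f_def Z_def)
      next
        case False
        then have AT: "A \<in> \<T>" using A by simp
        show ?thesis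
        proof (rule lipschitz_onI[OF _ N0])
          fix x y assume xy: "x \<in> A" "y \<in> A"
          have Bx: "\<bar>u x\<bar> \<le> \<bar>B\<bar>" using B[of x] un AT xy by force
          have 1: "\<bar>u x\<bar> * \<bar>\<phi> x - \<phi> y\<bar> \<le> \<bar>B\<bar> * ((3 * K) * dist x y)"
            using lipschitz_onD[OF \<phi>lip, of x y] Bx K(1) by (intro mult_mono) (auto simp: dist_real_def)
          have 2: "\<bar>\<phi> y\<bar> * \<bar>u x - u y\<bar> \<le> K * (L * dist x y)"
            using lipschitz_onD[OF lip[OF AT] xy] K by (intro mult_mono) (auto simp: dist_real_def)
          have "f x - f y = u x * (\<phi> x - \<phi> y) + \<phi> y * (u x - u y)" by (simp add: f_def algebra_simps)
          then have "\<bar>f x - f y\<bar> \<le> \<bar>u x\<bar> * \<bar>\<phi> x - \<phi> y\<bar> + \<bar>\<phi> y\<bar> * \<bar>u x - u y\<bar>"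
            by (metis abs_mult abs_triangle_ineq)
          with 1 2 show "dist (f x) (f y) \<le> N * dist x y" by (simp add: N_def dist_real_def algebra_simps)
        qed
      qed
    qed (use fin N0 in auto)
    have fc: "continuous_on UNIV f" by (rule lipschitz_on_continuous_on[OF flip])
    obtain R where R: "\<And>x. x \<in> S \<Longrightarrow> norm x < R"
      using compact_imp_bounded[OF S(1)] unfolding bounded_pos_less by blast
    have fz: "f x = 0" if "R \<le> norm x" for x using R[of x] \<phi>z[of x] that by (auto simp: f_def)
    have fi: "integrable lborel f" by (rule integrable_cont_bounded_support[OF fc fz])
    have fm: "f \<in> borel_measurable borel" by (rule borel_measurable_continuous_onI[OF fc])
    define e where "e = (axis i 1 :: real^'d)"
    have e1: "norm e = 1" by (simp add: e_def)
    define Dq where "Dq n x = (f (x + (1 / real (Suc n)) *\<^sub>R e) - f x) * real (Suc n)" for n x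
    define lim where "lim = zero_ext \<Omega> (\<lambda>x. G x $ i * \<phi> x + u x * partial_deriv i \<phi> x)"
    note t = test_function_L2(1,2)[OF \<phi> \<Omega>(2) \<Omega>s]
    have i1: "integrable (lebesgue_on \<Omega>) (\<lambda>x. G x $ i * \<phi> x)" "integrable (lebesgue_on \<Omega>)
        (\<lambda>x. u x * partial_deriv i \<phi> x)"
      using t uL GL by (auto intro!: L2_integrable_mult L2_component)
    have shm: "(\<lambda>x. f (x + (1 / real (Suc n)) *\<^sub>R e)) \<in> borel_measurable borel" for n
      using fm by measurable
    have D0: "(LINT x|lebesgue. Dq n x) = 0" for n
    proof -
      have "(LINT x|lborel. Dq n x) = 0"
        using lborel_integral_shift[OF fm, of "(1 / real (Suc n)) *\<^sub>R e"] fi by (simp add: Dq_def del: of_nat_Suc)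
      moreover have "Dq n \<in> borel_measurable lborel" unfolding Dq_def[abs_def] using fm shm by measurable
      ultimately show ?thesis by (simp add: integral_completion)
    qed
    have dAE: "AE x in lebesgue. x \<in> \<Omega> \<longrightarrow> (u has_derivative (\<lambda>v. G x \<bullet> v)) (at x)"
      using d \<Omega>s by (subst (asm) AE_restrict_space_iff) auto
    have "(\<lambda>n. LINT x|lebesgue. Dq n x) \<longlonglongrightarrow> (LINT x|lebesgue. lim x)"
    proof (rule integral_dominated_convergence[where w="\<lambda>x. N * indicator (cball 0 (R + 1)) x"])
      show "lim \<in> borel_measurable lebesgue"
        unfolding lim_def zero_ext_measurable[OF \<Omega>s, symmetric] using i1 by auto
      show "Dq n \<in> borel_measurable lebesgue" for n
        by (rule measurable_completion) (unfold Dq_def[abs_def], use fm shm in measurable)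
      show "integrable lebesgue (\<lambda>x::real^'d. N * indicator (cball 0 (R + 1)) x :: real)"
        by (intro integrable_mult_right integrable_indicator_cball)
      \<comment> \<open>The steps have length at most 1, so all difference quotients vanish outside
        the ball of radius R + 1, and the Lipschitz constant bounds them inside.\<close>
      show "AE x in lebesgue. norm (Dq n x) \<le> N * indicator (cball 0 (R + 1)) x" for n
      proof (rule AE_I2)
        fix x
        have "\<bar>f (x + (1 / real (Suc n)) *\<^sub>R e) - f x\<bar> \<le> N * (1 / real (Suc n))"
          using lipschitz_onD[OF flip, of "x + (1 / real (Suc n)) *\<^sub>R e" x] e1 by (simp add: dist_norm)
        then have "\<bar>f (x + (1 / real (Suc n)) *\<^sub>R e) - f x\<bar> * real (Suc n) \<le> N * (1 / real (Suc n)) * real (Suc n)"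
          by (rule mult_right_mono) simp
        also have "\<dots> = N" by simp
        finally have "\<bar>Dq n x\<bar> \<le> N" by (simp add: Dq_def abs_mult del: of_nat_Suc)
        moreover have "Dq n x = 0" if "R + 1 < norm x"
        proof -
          have "norm ((1 / real (Suc n)) *\<^sub>R e) \<le> 1" using e1 by simp
          then have "R \<le> norm (x + (1 / real (Suc n)) *\<^sub>R e)"
            using norm_diff_ineq[of x "(1 / real (Suc n)) *\<^sub>R e"] that by linarith
          then show ?thesis using fz that by (simp add: Dq_def)
        qed
        ultimately show "norm (Dq n x) \<le> N * indicator (cball 0 (R + 1)) x"
          by (auto simp: indicator_def dist_norm)
      qed
      show "AE x in lebesgue. (\<lambda>n. Dq n x) \<longlonglongrightarrow> lim x"
        using dAE
      proof eventually_elim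
        case (elim x)
        show ?case
        proof (cases "x \<in> \<Omega>")
          case True
          have "(f has_derivative (\<lambda>v. u x * (grad \<phi> x \<bullet> v) + (G x \<bullet> v) * \<phi> x)) (at x)"
            unfolding f_def[abs_def] using elim True by (intro has_derivative_mult D(1)) auto
          from directional_difference_quotient[OF this, of e] True
          show ?thesis by (simp add: Dq_def lim_def zero_ext_def e_def inner_axis grad_def algebra_simps del: of_nat_Suc)
        next
          case False
          have "(f has_derivative (\<lambda>v. 0)) (at x)"
          proof (rule has_derivative_transform_within_open[where f="\<lambda>x. 0" and s="- S"])
            show "open (- S)" using S(1) compact_imp_closed by (auto simp: open_Compl)
            show "x \<in> - S" using False S(2) by blast
          qed (use \<phi>z in \<open>auto simp: f_def\<close>)
          from directional_difference_quotient[OF this, of e] False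
          show ?thesis by (simp add: Dq_def lim_def zero_ext_def del: of_nat_Suc)
        qed
      qed
    qed
    then have "(LINT x|lebesgue. lim x) = 0" unfolding D0 using LIMSEQ_unique tendsto_const by blast
    then have "(LINT x|lebesgue_on \<Omega>. G x $ i * \<phi> x + u x * partial_deriv i \<phi> x) = 0"
      by (simp add: lim_def LINT_lebesgue_on(1)[OF \<Omega>s])
    then show "(LINT x|lebesgue_on \<Omega>. u x * partial_deriv i \<phi> x) = - (LINT x|lebesgue_on \<Omega>. G x $ i * \<phi> x)"
      using i1 by simp
  qed
  then show ?thesis using uL GL by (simp add: has_wgrad_def)
qed

section \<open>Mesh geometry and gradients of finite element functions\<close>

lemma mesh_cell:
  fixes \<Omega> :: "(real^'d::finite) set"
  assumes m: "conformal_simplicial_mesh \<Omega> \<T>" and T: "T \<in> \<T>"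
  shows "compact T" "convex T" "interior T \<noteq> {}" "T \<subseteq> closure \<Omega>" "negligible (T - interior T)"
    and "\<exists>C. finite C \<and> C \<noteq> {} \<and> \<not> affine_dependent C \<and> T = convex hull C \<and> vertices T = C"
proof -
  obtain C where C: "\<not> affine_dependent C" "int (card C) = int CARD('d) + 1" "T = convex hull C"
    using assms unfolding conformal_simplicial_mesh_def simplex_def by metis
  have f: "finite C" "C \<noteq> {}" using C(1,2) aff_independent_finite by auto
  show cp: "compact T" and cv: "convex T" using C(3) f finite_imp_compact_convex_hull by auto
  show "T \<subseteq> closure \<Omega>" using assms by (auto simp: conformal_simplicial_mesh_def)
  show "\<exists>C. finite C \<and> C \<noteq> {} \<and> \<not> affine_dependent C \<and> T = convex hull C \<and> vertices T = C"
    using C f extreme_point_of_convex_hull_affine_independent[OF C(1)] by (intro exI[of _ C]) (auto simp: vertices_def)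
  have "aff_dim T = int CARD('d)" using assms aff_dim_simplex by (auto simp: conformal_simplicial_mesh_def)
  then have "affine hull T = UNIV" using aff_dim_eq_full[of T] by simp
  then have "rel_interior T = interior T" by (rule rel_interior_interior)
  moreover have "T \<noteq> {}" using C(3) f by simp
  ultimately show "interior T \<noteq> {}" using rel_interior_eq_empty[OF cv] by simp
  have "frontier T = T - interior T" using closure_closed[OF compact_imp_closed[OF cp]] by (simp add: frontier_def)
  then show "negligible (T - interior T)" using negligible_convex_frontier[OF cv] by simp
qed

lemma mesh_facts:
  assumes m: "conformal_simplicial_mesh \<Omega> \<T>"
  shows "finite \<T>" "\<Union>\<T> = closure \<Omega>" "negligible (closure \<Omega> - (\<Union>T\<in>\<T>. interior T))"
proof -
  show f: "finite \<T>" and un: "\<Union>\<T> = closure \<Omega>"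
    using m by (auto simp: conformal_simplicial_mesh_def triangulation_def)
  have "negligible (\<Union>T\<in>\<T>. T - interior T)"
    using f mesh_cell(5)[OF m] by (intro negligible_Union) auto
  then show "negligible (closure \<Omega> - (\<Union>T\<in>\<T>. interior T))"
    by (rule negligible_subset) (use un in auto)
qed

text \<open>Frontiers of convex sets are negligible and the cells are finitely many, so properties
  that hold inside cells hold almost everywhere.\<close>

lemma mesh_AE_interior:
  fixes \<Omega> :: "(real^'d::finite) set"
  assumes m: "conformal_simplicial_mesh \<Omega> \<T>" and "\<Omega> \<in> sets lebesgue"
  shows "AE x in lebesgue_on \<Omega>. \<exists>T\<in>\<T>. x \<in> interior T"
proof -
  have "AE x in lebesgue. x \<notin> closure \<Omega> - (\<Union>T\<in>\<T>. interior T)"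
    using mesh_facts(3)[OF m] unfolding negligible_iff_null_sets by (rule AE_not_in)
  then have "AE x in lebesgue. x \<in> \<Omega> \<longrightarrow> (\<exists>T\<in>\<T>. x \<in> interior T)"
    by eventually_elim (use closure_subset in auto)
  then show ?thesis using assms by (subst AE_restrict_space_iff) auto
qed

text \<open>A gradient bound yields a Lipschitz bound on convex sets only. The domain need not be
  convex, but the cells of a mesh are, and \<open>lipschitz_has_wgrad\<close> asks for no
  more.\<close>

lemma C1_has_wgrad:
  fixes \<Omega> :: "(real^'d::finite) set"
  assumes \<Omega>: "open \<Omega>" "bounded \<Omega>" and m: "conformal_simplicial_mesh \<Omega> \<T>"
    and d: "\<And>x. x \<in> closure \<Omega> \<Longrightarrow> (g has_derivative (\<lambda>v. \<Gamma> x \<bullet> v))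
        (at x)" and c: "continuous_on (closure \<Omega>) \<Gamma>"
  shows "has_wgrad \<Omega> g \<Gamma>"
proof -
  have \<Omega>s: "\<Omega> \<in> sets lebesgue" using \<Omega> by (simp add: borel_open sets_completionI_sets)
  have "compact (closure \<Omega>)" using \<Omega> by (simp add: compact_closure)
  then have "bounded (\<Gamma> ` closure \<Omega>)" using c compact_continuous_image compact_imp_bounded by blast
  then obtain B where B: "B > 0" "\<And>x. x \<in> closure \<Omega> \<Longrightarrow> norm (\<Gamma> x) \<le> B" unfolding bounded_pos by auto
  note mf = mesh_facts[OF m] and mc = mesh_cell[OF m]
  show ?thesis
  proof (rule lipschitz_has_wgrad[OF \<Omega> mf(1,2)])
    show "(3 * B)-lipschitz_on T g" if "T \<in> \<T>" for T
      by (rule lipschitz_of_gradient_bound[OF mc(2)[OF that]]) (use d B mc(4)[OF that] in auto)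
    show "\<Gamma> \<in> borel_measurable (lebesgue_on \<Omega>)"
      using c closure_subset continuous_on_subset by (intro continuous_imp_measurable_on_sets_lebesgue \<Omega>s) blast
    show "AE x in lebesgue_on \<Omega>. (g has_derivative (\<lambda>v. \<Gamma> x \<bullet> v)) (at x)"
      using d closure_subset[of \<Omega>] by (intro AE_I2) (auto simp: space_restrict_space)
  qed (use B closure_subset[of \<Omega>] mc(1) compact_imp_closed in auto)
qed

lemma P1_has_wgrad:
  fixes \<Omega> :: "(real^'d::finite) set"
  assumes \<Omega>: "open \<Omega>" "bounded \<Omega>" and m: "conformal_simplicial_mesh \<Omega> \<T>" and v: "v \<in> P1_elements \<Omega> \<T>"
  shows "\<exists>G. has_wgrad \<Omega> v G \<and> (\<forall>T\<in>\<T>. \<forall>x\<in>interior T. \<forall>y\<in>T. v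
      y = v x + G x \<bullet> (y - x))"
proof -
  have \<Omega>s: "\<Omega> \<in> sets lebesgue" using \<Omega> by (simp add: borel_open sets_completionI_sets)
  note mf = mesh_facts[OF m] and mc = mesh_cell[OF m]
  have "\<forall>T\<in>\<T>. \<exists>a. \<exists>b. \<forall>x\<in>T. v x = a \<bullet> x + b" using v by (auto simp: P1_elements_def)
  then obtain a where "\<forall>T\<in>\<T>. \<exists>b. \<forall>x\<in>T. v x = a T \<bullet> x + b" by metis
  then obtain b where ab: "\<And>T x. T \<in> \<T> \<Longrightarrow> x \<in> T \<Longrightarrow> v x = a T \<bullet> x + b T" by metis
  have dv: "(v has_derivative (\<lambda>w. a T \<bullet> w)) (at x)" if "T \<in> \<T>" "x \<in> interior T" for T x
  proof (rule has_derivative_transform_within_open[where f="\<lambda>x. a T \<bullet> x + b T" and s="interior T"])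
    show "((\<lambda>x. a T \<bullet> x + b T) has_derivative (\<lambda>w. a T \<bullet> w)) (at x)" by (auto intro!: derivative_eq_intros)
    show "a T \<bullet> y + b T = v y" if "y \<in> interior T" for y
      using ab[OF \<open>T \<in> \<T>\<close>, of y] interior_subset[of T] that by (metis subsetD)
  qed (use that in auto)
  \<comment> \<open>The slope of some cell whose interior contains x, and 0 on the negligible
    rest.\<close>
  define G where "G x = (if \<exists>T\<in>\<T>. x \<in> interior T then a (SOME T. T \<in> \<T> \<and> x \<in> interior T) else 0)" for x
  have G: "G x = a T" if "T \<in> \<T>" "x \<in> interior T" for T x
  proof -
    define T' where "T' = (SOME T. T \<in> \<T> \<and> x \<in> interior T)"
    have "T' \<in> \<T> \<and> x \<in> interior T'" unfolding T'_def by (rule someI_ex) (use that in blast)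
    \<comment> \<open>Both slopes are the derivative of \<open>v\<close> at the interior point x, so
      the choice of the cell does not matter.\<close>
    then have "(\<lambda>w. a T' \<bullet> w) = (\<lambda>w. a T \<bullet> w)" using dv[OF that] dv[of T' x] has_derivative_unique by blast
    then have "\<forall>w. w \<bullet> a T' = w \<bullet> a T" by (simp add: fun_eq_iff inner_commute)
    then have "a T' = a T" by (simp only: vector_eq_ldot)
    moreover have "G x = a T'" using that by (auto simp: G_def T'_def)
    ultimately show ?thesis by simp
  qed
  define L where "L = (\<Sum>T\<in>\<T>. norm (a T))"
  have aL: "norm (a T) \<le> L" if "T \<in> \<T>" for T
    unfolding L_def using mf(1) that by (intro member_le_sum) auto
  have L0: "0 \<le> L" by (simp add: L_def sum_nonneg)
  have "has_wgrad \<Omega> v G"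
  proof (rule lipschitz_has_wgrad[OF \<Omega> mf(1,2)])
    show "closed T" if "T \<in> \<T>" for T using mc(1)[OF that] compact_imp_closed by blast
    show "L-lipschitz_on T v" if T: "T \<in> \<T>" for T
    proof (rule lipschitz_onI[OF _ L0])
      fix x y assume "x \<in> T" "y \<in> T"
      then have "v x - v y = a T \<bullet> (x - y)" using ab[OF T] by (simp add: inner_diff_right)
      then have "\<bar>v x - v y\<bar> \<le> norm (a T) * norm (x - y)" using Cauchy_Schwarz_ineq2 by metis
      also have "\<dots> \<le> L * norm (x - y)" using aL[OF T] by (intro mult_right_mono) auto
      finally show "dist (v x) (v y) \<le> L * dist x y" by (simp add: dist_norm)
    qed
    show "norm (G x) \<le> L" for x
    proof (cases "\<exists>T\<in>\<T>. x \<in> interior T")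
      case True
      then show ?thesis using G aL by auto
    qed (use L0 in \<open>auto simp: G_def\<close>)
    show "AE x in lebesgue_on \<Omega>. (v has_derivative (\<lambda>w. G x \<bullet> w)) (at x)"
      using mesh_AE_interior[OF m \<Omega>s] by eventually_elim (use dv G in auto)
    \<comment> \<open>\<open>G\<close> is constant on each of these finitely many sets, which makes
      it measurable piece by piece.\<close>
    define C where "C = insert (- (\<Union>T\<in>\<T>. interior T)) (interior ` \<T>)"
    have Cs: "A \<in> sets lebesgue" if "A \<in> C" for A
    proof -
      have "open (\<Union>T\<in>\<T>. interior T)" by auto
      then have "open A \<or> closed A" using that unfolding C_def by (auto simp only: closed_Compl open_interior)
      then show ?thesis by (auto intro: borel_open borel_closed)
    qed
    show "G \<in> borel_measurable (lebesgue_on \<Omega>)"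
    proof (rule measurable_piecewise_restrict[of C])
      show "countable C" using mf(1) by (auto simp: C_def intro: countable_finite)
      show "A \<inter> space (lebesgue_on \<Omega>) \<in> sets (lebesgue_on \<Omega>)" if "A \<in> C" for A
        using Cs[OF that] \<Omega>s by (auto simp: sets_restrict_space space_restrict_space)
      show "space (lebesgue_on \<Omega>) \<subseteq> \<Union> C" by (auto simp: C_def)
      show "G \<in> borel_measurable (restrict_space (lebesgue_on \<Omega>) A)" if "A \<in> C" for A
      proof -
        have "\<exists>c. \<forall>x\<in>A. G x = c"
        proof (cases "A \<in> interior ` \<T>")
          case True
          then show ?thesis using G by blast
        next
          case False
          then have "A = - (\<Union>T\<in>\<T>. interior T)" using that by (auto simp: C_def)
          then have "\<forall>x\<in>A. G x = 0" by (auto simp: G_def)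
          then show ?thesis by blast
        qed
        then obtain c where c: "\<And>x. x \<in> A \<Longrightarrow> G x = c" by blast
        have "(\<lambda>x. c) \<in> borel_measurable (restrict_space (lebesgue_on \<Omega>) A)" by simp
        then show ?thesis by (rule measurable_cong[THEN iffD1, rotated]) (simp add: space_restrict_space c)
      qed
    qed
  qed (use L0 in auto)
  moreover have "v y = v x + G x \<bullet> (y - x)" if "T \<in> \<T>" "x \<in> interior T" "y \<in> T" for T x y
  proof -
    have "x \<in> T" using that interior_subset by auto
    then show ?thesis using ab[OF that(1)] that G[OF that(1,2)] by (simp add: inner_diff_right)
  qed
  ultimately show ?thesis by blast
qed


subsection \<open>Nodal interpolation\<close>

text \<open>Subtracting one point turns affine independence into linear independence, and a linear
  functional may be prescribed on the differences.\<close>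

lemma affine_interpolation:
  fixes g :: "real^'d::finite \<Rightarrow> real"
  assumes "\<not> affine_dependent C"
  shows "\<exists>a b. \<forall>v\<in>C. a \<bullet> v + b = g v"
proof (cases "C = {}")
  case False
  then obtain v0 where v0: "v0 \<in> C" by blast
  have ind: "independent ((\<lambda>x. - v0 + x) ` (C - {v0}))"
    using affine_dependent_iff_dependent2[OF v0] assms by blast
  obtain f where f: "linear f" "\<forall>x\<in>(\<lambda>x. - v0 + x) ` (C - {v0}). f x = g (v0 + x) - g v0"
    using linear_independent_extend[OF ind, of "\<lambda>x. g (v0 + x) - g v0"] by blast
  define a where "a = (\<chi> i. f (axis i 1))"
  have fa: "f v = a \<bullet> v" for v unfolding a_def by (rule linear_real_eq_inner[OF f(1)])
  have "a \<bullet> v + (g v0 - a \<bullet> v0) = g v" if "v \<in> C" for v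
  proof (cases "v = v0")
    case False
    then have "f (- v0 + v) = g v - g v0" using f(2) that by force
    then show ?thesis by (simp add: fa inner_diff_right)
  qed simp
  then show ?thesis by blast
qed simp

text \<open>Conformity is what makes the cellwise interpolants agree: the intersection of two cells
  is a face of both, its extreme points are vertices of both, and a compact convex set is the hull
  of its extreme points. Two affine functions equal there are equal on the face.\<close>

lemma P1_interpolant_exists:
  fixes \<Omega> :: "(real^'d::finite) set"
  assumes m: "conformal_simplicial_mesh \<Omega> \<T>"
  shows "\<exists>I\<in>P1_elements \<Omega> \<T>. \<forall>T\<in>\<T>. \<forall>v\<in>vertices T. I v = g v"
proof -
  note mf = mesh_facts[OF m] and mc = mesh_cell[OF m]
  have "\<exists>ab. \<forall>v\<in>vertices T. fst ab \<bullet> v + snd ab = g v" if T: "T \<in> \<T>" for T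
  proof -
    obtain C where "\<not> affine_dependent C" "vertices T = C" using mc(6)[OF T] by blast
    then show ?thesis using affine_interpolation[of C g] by auto
  qed
  then obtain ab where ab: "\<And>T v. T \<in> \<T> \<Longrightarrow> v \<in> vertices T \<Longrightarrow> fst (ab T)
      \<bullet> v + snd (ab T) = g v" by metis
  define a b where "a T = fst (ab T)" and "b T = snd (ab T)" for T
  have ab: "a T \<bullet> v + b T = g v" if "T \<in> \<T>" "v \<in> vertices T" for T v
    using ab[OF that] by (simp add: a_def b_def)
  have compat: "a T \<bullet> x + b T = a T' \<bullet> x + b T'" if T: "T \<in> \<T>" "T' \<in> \<T>" and x: "x \<in> T" "x \<in> T'" for T T' x
  proof -
    define F where "F = T \<inter> T'"
    have face: "F face_of T" "F face_of T'"
      using m T unfolding conformal_simplicial_mesh_def triangulation_def F_def by (metis Int_commute)+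
    have cF: "compact F" "convex F" unfolding F_def using mc T by (auto intro: compact_Int convex_Int)
    define E where "E = {x. x extreme_point_of F}"
    have Ev: "E \<subseteq> vertices T" "E \<subseteq> vertices T'"
      using extreme_point_of_face[OF face(1)] extreme_point_of_face[OF face(2)] by (auto simp: E_def vertices_def)
    have "x \<in> convex hull E" using Krein_Milman_Minkowski[OF cF] x unfolding E_def F_def by blast
    moreover have "convex hull E \<subseteq> {x. (a T - a T') \<bullet> x = b T' - b T}"
    proof (rule hull_minimal)
      show "E \<subseteq> {x. (a T - a T') \<bullet> x = b T' - b T}"
      proof
        fix e assume "e \<in> E"
        then have "a T \<bullet> e + b T = a T' \<bullet> e + b T'" using ab[OF T(1)] ab[OF T(2)] Ev by (metis subsetD)
        then show "e \<in> {x. (a T - a T') \<bullet> x = b T' - b T}" by (simp add: inner_diff_left)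
      qed
    qed (rule convex_hyperplane)
    ultimately show ?thesis by (auto simp: inner_diff_left)
  qed
  define cell where "cell x = (SOME T. T \<in> \<T> \<and> x \<in> T)" for x
  define I where "I x = a (cell x) \<bullet> x + b (cell x)" for x
  have I: "I x = a T \<bullet> x + b T" if "T \<in> \<T>" "x \<in> T" for T x
  proof -
    have "cell x \<in> \<T> \<and> x \<in> cell x" unfolding cell_def by (rule someI_ex) (use that in blast)
    then show ?thesis unfolding I_def using compat that by blast
  qed
  have "continuous_on (\<Union>T\<in>\<T>. T) I"
  proof (rule continuous_on_closed_Union[OF mf(1)])
    show "closed T" if "T \<in> \<T>" for T using mc(1)[OF that] compact_imp_closed by blast
    show "continuous_on T I" if "T \<in> \<T>" for T
    proof -
      have "continuous_on T (\<lambda>x. a T \<bullet> x + b T)" by (intro continuous_intros)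
      then show ?thesis by (rule continuous_on_cong[THEN iffD1, OF refl, rotated]) (simp add: I[OF that])
    qed
  qed
  then have "I \<in> P1_elements \<Omega> \<T>" using mf(2) I by (auto simp: P1_elements_def)
  moreover have "I v = g v" if "T \<in> \<T>" "v \<in> vertices T" for T v
  proof -
    have "v \<in> T" using that(2) by (auto simp: vertices_def extreme_point_of_def)
    then show ?thesis using I ab that by simp
  qed
  ultimately show ?thesis by blast
qed

section \<open>Interpolation error on shape-regular cells\<close>

lemma inball_diameter_bounds:
  fixes T :: "(real^'d::finite) set"
  assumes "bounded T" "interior T \<noteq> {}"
  shows "0 < inball_diameter T"
    and "(\<And>z r. 0 \<le> r \<Longrightarrow> cball z r \<subseteq> T \<Longrightarrow> 2 * r \<le> m) \<Longrightarrow> inball_diameter T \<le> m"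
proof -
  obtain z where "z \<in> interior T" using assms(2) by blast
  then obtain r where r: "r > 0" "cball z r \<subseteq> T" using mem_interior_cball by blast
  let ?S = "{diameter (cball x r) | x r. cball x r \<subseteq> T}"
  have mem: "diameter (cball z r) \<in> ?S" using r by blast
  have bdd: "bdd_above ?S"
    by (rule bdd_aboveI[of _ "diameter T"]) (use diameter_subset[OF _ assms(1)] in blast)
  have "2 * r = diameter (cball z r)" using r by (simp add: diameter_cball)
  also have "\<dots> \<le> inball_diameter T" unfolding inball_diameter_def by (rule cSup_upper[OF mem bdd])
  finally show "0 < inball_diameter T" using r by simp
  assume m: "\<And>z r. 0 \<le> r \<Longrightarrow> cball z r \<subseteq> T \<Longrightarrow> 2 * r \<le> m"
  \<comment> \<open>Balls of negative radius also occur in the supremum; they are empty and have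
    diameter 0.\<close>
  have "0 \<le> m" using m[of r z] r by simp
  show "inball_diameter T \<le> m" unfolding inball_diameter_def
  proof (rule cSup_least)
    fix y assume "y \<in> ?S"
    then obtain x s where "y = diameter (cball x s)" "cball x s \<subseteq> T" by blast
    then show "y \<le> m" using m[of s x] \<open>0 \<le> m\<close> by (simp add: diameter_cball)
  qed (use mem in blast)
qed

text \<open>The interpolant minus the first-order Taylor polynomial of \<open>g\<close> at x is the
  affine function \<open>q \<bullet> y + \<beta>\<close>. At the vertices it is at most M in
  absolute value, hence on the whole hull. At y = x this is the error of the values; at two
  antipodal points of an inscribed ball it bounds \<open>norm q\<close>, the error of the gradient,
  and here the ratio of diameter to inball diameter enters.\<close>

lemma interpolation_error:
  fixes T :: "(real^'d::finite) set" and g :: "real^'d \<Rightarrow> real"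
  assumes T: "compact T" "convex T" "interior T \<noteq> {}" "T = convex hull C"
    and I: "\<And>y. y \<in> T \<Longrightarrow> I y = q0 \<bullet> y + b" "\<And>v. v \<in> C \<Longrightarrow> I v = g v"
    and d: "\<And>x. x \<in> T \<Longrightarrow> (g has_derivative (\<lambda>v. \<Gamma> x \<bullet> v)) (at x)"
    and w: "\<And>x y. x \<in> T \<Longrightarrow> y \<in> T \<Longrightarrow> norm (\<Gamma> x - \<Gamma> y) \<le> w"
    and c: "diameter T / inball_diameter T \<le> c" and x: "x \<in> T"
  shows "norm (q0 - \<Gamma> x) \<le> 2 * c * w" "\<bar>I x - g x\<bar> \<le> diameter T * w"
proof -
  define M where "M = diameter T * w"
  have bT: "bounded T" using T(1) compact_imp_bounded by blast
  have w0: "0 \<le> w" using w[OF x x] by simp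
  have M0: "0 \<le> M" using w0 diameter_ge_0[OF bT] by (simp add: M_def)
  define q where "q = q0 - \<Gamma> x"
  define \<beta> where "\<beta> = b - g x + \<Gamma> x \<bullet> x"
  have lin: "\<bar>g y - g x - \<Gamma> x \<bullet> (y - x)\<bar> \<le> M" if "y \<in> T" for y
  proof -
    have "\<bar>g y - g x - \<Gamma> x \<bullet> (y - x)\<bar> \<le> norm (y - x) * w"
      by (rule gradient_linearization[OF T(2) x that d]) (use w x in auto)
    also have "\<dots> \<le> diameter T * w"
      using diameter_bounded_bound[OF bT that x] w0 by (intro mult_right_mono) (auto simp: dist_norm)
    finally show ?thesis by (simp add: M_def)
  qed
  have CT: "C \<subseteq> T" unfolding T(4) by (rule hull_subset)
  have sub: "convex hull C \<subseteq> {y. q \<bullet> y \<le> M - \<beta>} \<inter> {y. q \<bullet> y \<ge> - M - \<beta>}"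
  proof (rule hull_minimal)
    show "C \<subseteq> {y. q \<bullet> y \<le> M - \<beta>} \<inter> {y. q \<bullet> y \<ge> - M - \<beta>}"
    proof
      fix v assume v: "v \<in> C"
      then have vT: "v \<in> T" using CT by blast
      have "q0 \<bullet> v + b = g v" using I v vT by metis
      with lin[OF vT] show "v \<in> {y. q \<bullet> y \<le> M - \<beta>} \<inter> {y. q \<bullet> y \<ge> - M - \<beta>}"
        by (auto simp: q_def \<beta>_def inner_diff_left inner_diff_right abs_le_iff)
    qed
    show "convex ({y. q \<bullet> y \<le> M - \<beta>} \<inter> {y. q \<bullet> y \<ge> - M - \<beta>})"
      by (intro convex_Int convex_halfspace_le convex_halfspace_ge)
  qed
  have B: "\<bar>q \<bullet> y + \<beta>\<bar> \<le> M" if "y \<in> T" for y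
    using subsetD[OF sub, of y] that[unfolded T(4)] by (auto simp: abs_le_iff)
  show "\<bar>I x - g x\<bar> \<le> diameter T * w"
    using B[OF x] I(1)[OF x] by (simp add: q_def \<beta>_def M_def inner_diff_left)
  have "norm q * inball_diameter T \<le> 2 * M"
  proof (cases "q = 0")
    case False
    have "inball_diameter T \<le> 2 * M / norm q"
    proof (rule inball_diameter_bounds(2)[OF bT T(3)])
      fix z and r :: real assume r: "0 \<le> r" "cball z r \<subseteq> T"
      \<comment> \<open>The ends of the ball's diameter in the direction of \<open>q\<close>, along
        which the affine function changes most.\<close>
      have "z + (r / norm q) *\<^sub>R q \<in> T" "z - (r / norm q) *\<^sub>R q \<in> T"
        using r False by (auto intro!: subsetD[OF r(2)] simp: dist_norm)
      from B[OF this(1)] B[OF this(2)]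
      have "(q \<bullet> (z + (r / norm q) *\<^sub>R q)) - (q \<bullet> (z - (r / norm q) *\<^sub>R q)) \<le> 2 * M" by linarith
      moreover have "(q \<bullet> (z + (r / norm q) *\<^sub>R q)) - (q \<bullet> (z - (r / norm q) *\<^sub>R q)) = 2 * r * norm q"
        using False by (simp add: inner_add_right inner_diff_right dot_square_norm power2_eq_square)
      ultimately show "2 * r \<le> 2 * M / norm q" using False by (simp add: field_simps)
    qed
    then show ?thesis using False by (simp add: field_simps)
  qed (use M0 in simp)
  then have "norm q \<le> 2 * (diameter T / inball_diameter T) * w"
    using inball_diameter_bounds(1)[OF bT T(3)] by (simp add: M_def field_simps)
  also have "\<dots> \<le> 2 * c * w" using c w0 by (intro mult_right_mono) auto
  finally show "norm (q0 - \<Gamma> x) \<le> 2 * c * w" by (simp add: q_def)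
qed

lemma mesh_diameter_le:
  assumes "conformal_simplicial_mesh \<Omega> \<T>" "T \<in> \<T>"
  shows "diameter T \<le> mesh_size \<T>"
  unfolding mesh_size_def using mesh_facts(1)[OF assms(1)] assms(2) by (intro Max_ge) auto

lemma interpolation_converges:
  fixes \<Omega> :: "(real^'d::finite) set" and g :: "real^'d \<Rightarrow> real"
  assumes \<Omega>: "open \<Omega>" "bounded \<Omega>"
    and mesh: "\<And>h. h \<in> H \<Longrightarrow> conformal_simplicial_mesh \<Omega> (\<T> h)" "\<And>h. h \<in> H
        \<Longrightarrow> mesh_size (\<T> h) = h" "\<And>h. h \<in> H \<Longrightarrow> 0 < h"
    and sr: "shape_regular H \<T>"
    and d: "\<And>x. x \<in> closure \<Omega> \<Longrightarrow> (g has_derivative (\<lambda>v. \<Gamma> x \<bullet> v))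
        (at x)" and c: "continuous_on (closure \<Omega>) \<Gamma>"
    and "0 < e"
  shows "\<exists>h0>0. \<forall>h\<in>H. h < h0 \<longrightarrow> (\<exists>I\<in>P1_elements \<Omega> (\<T> h).
      (\<forall>T\<in>\<T> h. \<forall>v\<in>vertices T. I v = g v) \<and>
     (\<forall>x\<in>closure \<Omega>. \<bar>I x - g x\<bar> \<le> e) \<and>
     (\<exists>G. has_wgrad \<Omega> I G \<and> (AE x in lebesgue_on \<Omega>. norm (G x - \<Gamma> x) \<le> e)))"
proof -
  have \<Omega>s: "\<Omega> \<in> sets lebesgue" using \<Omega> by (simp add: borel_open sets_completionI_sets)
  obtain k where k: "k > 0" "\<And>h T. h \<in> H \<Longrightarrow> T \<in> \<T> h \<Longrightarrow> diameter T / inball_diameter T \<le> k"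
    using sr unfolding shape_regular_def by blast
  \<comment> \<open>By \<open>interpolation_error\<close> the gradient error is at most 2 k w and
    the error of the values at most diameter times w, with diameters below 1; both are then at most
    \<open>e\<close>.\<close>
  define w where "w = min e (e / (2 * k))"
  have w: "w > 0" "w \<le> e" "2 * k * w \<le> e" using \<open>e > 0\<close> k(1) by (auto simp: w_def min_def field_simps)
  have "compact (closure \<Omega>)" using \<Omega> by (simp add: compact_closure)
  then have "uniformly_continuous_on (closure \<Omega>) \<Gamma>" using c by (intro compact_uniformly_continuous)
  then obtain \<delta> where \<delta>: "\<delta> > 0" "\<And>x y. x \<in> closure \<Omega> \<Longrightarrow> y \<in>
      closure \<Omega> \<Longrightarrow> dist y x < \<delta> \<Longrightarrow> dist (\<Gamma> y) (\<Gamma> x) < w"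
    using w(1) unfolding uniformly_continuous_on_def by metis
  have "\<exists>I\<in>P1_elements \<Omega> (\<T> h). (\<forall>T\<in>\<T> h. \<forall>v\<in>vertices T. I v = g v) \<and>
     (\<forall>x\<in>closure \<Omega>. \<bar>I x - g x\<bar> \<le> e) \<and>
     (\<exists>G. has_wgrad \<Omega> I G \<and> (AE x in lebesgue_on \<Omega>. norm (G x - \<Gamma> x) \<le> e))" if h:
         "h \<in> H" "h < min \<delta> 1" for h
  proof -
    note m = mesh(1)[OF h(1)]
    note mf = mesh_facts[OF m] and mc = mesh_cell[OF m]
    obtain I where I: "I \<in> P1_elements \<Omega> (\<T> h)" "\<And>T v. T \<in> \<T> h \<Longrightarrow> v \<in>
        vertices T \<Longrightarrow> I v = g v"
      using P1_interpolant_exists[OF m, of g] by blast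
    obtain G where G: "has_wgrad \<Omega> I G" "\<And>T x y. T \<in> \<T> h \<Longrightarrow> x \<in> interior T
        \<Longrightarrow> y \<in> T \<Longrightarrow> I y = I x + G x \<bullet> (y - x)"
      using P1_has_wgrad[OF \<Omega> m I(1)] by blast
    have err: "norm (q0 - \<Gamma> x) \<le> e" "\<bar>I x - g x\<bar> \<le> e"
      if T: "T \<in> \<T> h" and x: "x \<in> T" and q: "\<And>y. y \<in> T \<Longrightarrow> I y = q0 \<bullet> y + b" for T q0 b x
    proof -
      obtain C where C: "T = convex hull C" "vertices T = C" using mc(6)[OF T] by blast
      have dT: "diameter T \<le> h" using mesh_diameter_le[OF m T] mesh(2)[OF h(1)] by simp
      have bT: "bounded T" using mc(1)[OF T] compact_imp_bounded by blast
      have osc: "norm (\<Gamma> x - \<Gamma> y) \<le> w" if "x \<in> T" "y \<in> T" for x y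
      proof -
        have "dist x y < \<delta>" using diameter_bounded_bound[OF bT that] dT h by linarith
        moreover have "x \<in> closure \<Omega>" "y \<in> closure \<Omega>" using that mc(4)[OF T] by blast+
        ultimately show ?thesis using \<delta>(2)[of y x] by (simp add: dist_norm)
      qed
      note ie = interpolation_error[OF mc(1-3)[OF T] C(1) q _ _ osc k(2)[OF h(1) T] x, of g]
      have iv: "I v = g v" if "v \<in> C" for v using I(2)[OF T] C(2) that by blast
      have dd: "(g has_derivative (\<lambda>v. \<Gamma> x \<bullet> v)) (at x)" if "x \<in> T" for x using d mc(4)[OF T] that by blast
      from ie[OF _ iv dd] w(3) show "norm (q0 - \<Gamma> x) \<le> e" by auto
      have "\<bar>I x - g x\<bar> \<le> diameter T * w" using ie[OF _ iv dd] by auto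
      also have "\<dots> \<le> 1 * w" using dT h w by (intro mult_right_mono) auto
      finally show "\<bar>I x - g x\<bar> \<le> e" using w by simp
    qed
    have "\<bar>I x - g x\<bar> \<le> e" if "x \<in> closure \<Omega>" for x
    proof -
      obtain T where T: "T \<in> \<T> h" "x \<in> T" using mf(2) \<open>x \<in> closure \<Omega>\<close> by blast
      then obtain a b where "\<forall>y\<in>T. I y = a \<bullet> y + b" using I(1) unfolding P1_elements_def by blast
      then show ?thesis using err(2)[OF T] by blast
    qed
    moreover have "AE x in lebesgue_on \<Omega>. norm (G x - \<Gamma> x) \<le> e"
      using mesh_AE_interior[OF m \<Omega>s]
    proof eventually_elim
      case (elim x)
      then obtain T where T: "T \<in> \<T> h" "x \<in> interior T" by blast
      then have "x \<in> T" using interior_subset by blast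
      moreover have "I y = G x \<bullet> y + (I x - G x \<bullet> x)" if "y \<in> T" for y
        using G(2)[OF T that] by (simp add: inner_diff_right)
      ultimately show ?case using err(1)[OF T(1)] by blast
    qed
    ultimately show ?thesis using I G(1) by blast
  qed
  then show ?thesis using \<delta>(1) by (intro exI[of _ "min \<delta> 1"]) auto
qed


subsection \<open>Norms and dual cones\<close>

definition seminorm_on_vec :: "(real^'n::finite \<Rightarrow> real) \<Rightarrow> bool"
  where "seminorm_on_vec N \<longleftrightarrow> (\<forall>x y. N (x + y) \<le> N x + N y) \<and> (\<forall>c x. N (c
      *\<^sub>R x) = \<bar>c\<bar> * N x)"

lemma seminorm_zero: "seminorm_on_vec N \<Longrightarrow> N 0 = 0"
  unfolding seminorm_on_vec_def by (metis abs_zero mult_zero_left scaleR_zero_left)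

lemma seminorm_nonneg:
  assumes "seminorm_on_vec N"
  shows "0 \<le> N x"
proof -
  have "N (x + (-1) *\<^sub>R x) \<le> N x + N ((-1) *\<^sub>R x)" "N ((-1) *\<^sub>R x) = \<bar>-1\<bar> * N x"
    using assms unfolding seminorm_on_vec_def by blast+
  then show ?thesis using seminorm_zero[OF assms] by simp
qed

lemma seminorm_sum_le:
  assumes "seminorm_on_vec N"
  shows "N (\<Sum>i\<in>I. f i) \<le> (\<Sum>i\<in>I. N (f i))"
proof (induction I rule: infinite_finite_induct)
  case (insert i I)
  have "N (f i + sum f I) \<le> N (f i) + N (sum f I)" using assms unfolding seminorm_on_vec_def by blast
  with insert show ?case by simp
qed (simp_all add: seminorm_zero[OF assms])

lemma seminorm_bound:
  assumes "seminorm_on_vec (N :: real^'n::finite \<Rightarrow> real)"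
  shows "\<exists>C>0. \<forall>x. N x \<le> C * norm x"
proof -
  define C where "C = (\<Sum>i\<in>(UNIV::'n set). N (axis i 1)) + 1"
  have C: "C > 0" using seminorm_nonneg[OF assms] by (simp add: C_def sum_nonneg add_nonneg_pos)
  have "N x \<le> C * norm x" for x
  proof -
    have "N x = N (\<Sum>i\<in>UNIV. (x $ i) *\<^sub>R axis i 1)"
      using basis_expansion[of x] by (simp add: scalar_mult_eq_scaleR)
    also have "\<dots> \<le> (\<Sum>i\<in>UNIV. N ((x $ i) *\<^sub>R axis i 1))" by (rule seminorm_sum_le[OF assms])
    also have "\<dots> = (\<Sum>i\<in>UNIV. \<bar>x $ i\<bar> * N (axis i 1))" using assms by (simp add: seminorm_on_vec_def)
    also have "\<dots> \<le> (\<Sum>i\<in>UNIV. norm x * N (axis i 1))"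
      using seminorm_nonneg[OF assms] by (intro sum_mono mult_right_mono component_le_norm_cart)
    also have "\<dots> \<le> C * norm x" by (simp add: C_def sum_distrib_left[symmetric] algebra_simps)
    finally show ?thesis .
  qed
  with C show ?thesis by blast
qed

lemma seminorm_diff_le:
  assumes "seminorm_on_vec N"
  shows "N x \<le> N y + N (x - y)"
  using assms unfolding seminorm_on_vec_def by (metis add.commute diff_add_cancel)

lemma seminorm_continuous:
  assumes "seminorm_on_vec (N :: real^'n::finite \<Rightarrow> real)"
  shows "continuous_on UNIV N"
proof -
  obtain C where C: "C > 0" "\<And>x. N x \<le> C * norm x" using seminorm_bound[OF assms] by blast
  have "C-lipschitz_on UNIV N"
  proof (rule lipschitz_onI)
    fix x y
    have "N x - N y \<le> C * norm (x - y)" using seminorm_diff_le[OF assms, of x y] C(2)[of "x - y"] by simp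
    moreover have "N y - N x \<le> C * norm (y - x)" using seminorm_diff_le[OF assms, of y x] C(2)[of "y - x"] by simp
    ultimately show "dist (N x) (N y) \<le> C * dist x y" by (simp add: dist_norm norm_minus_commute abs_le_iff)
  qed (use C in simp)
  then show ?thesis by (rule lipschitz_on_continuous_on)
qed

text \<open>The dual of the epigraph cone N x \<le> t. Its members are linear inequalities in value
  and bound jointly, so both averaging and weak limits preserve them even though the bound \<alpha>
  varies.\<close>

definition dual_cone :: "(real^'n::finite \<Rightarrow> real) \<Rightarrow> ((real^'n) \<times> real) set"
  where "dual_cone N = {z. \<forall>x t. N x \<le> t \<longrightarrow> 0 \<le> z \<bullet> (x, t)}"

lemma dual_cone_separates:
  assumes N: "seminorm_on_vec (N :: real^'n::finite \<Rightarrow> real)" and v: "s < N v"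
  shows "\<exists>z\<in>dual_cone N. z \<bullet> (v, s) < 0"
proof -
  define K where "K = {z :: (real^'n) \<times> real. N (fst z) \<le> snd z}"
  have "convex K" unfolding convex_def
  proof (intro ballI allI impI)
    fix x y :: "(real^'n) \<times> real" and a b :: real
    assume xy: "x \<in> K" "y \<in> K" and ab: "0 \<le> a" "0 \<le> b" "a + b = 1"
    have "N (a *\<^sub>R fst x + b *\<^sub>R fst y) \<le> N (a *\<^sub>R fst x) + N (b *\<^sub>R fst y)"
      using N unfolding seminorm_on_vec_def by blast
    also have "\<dots> = a * N (fst x) + b * N (fst y)" using N ab unfolding seminorm_on_vec_def by simp
    also have "\<dots> \<le> a * snd x + b * snd y" using xy ab by (intro add_mono mult_left_mono) (auto simp: K_def)
    finally show "a *\<^sub>R x + b *\<^sub>R y \<in> K" by (simp add: K_def)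
  qed
  moreover have "closed K" unfolding K_def
    by (intro closed_Collect_le continuous_on_compose2[OF seminorm_continuous[OF N]] continuous_intros) auto
  moreover have "(v, s) \<notin> K" using v by (simp add: K_def)
  ultimately obtain a b where ab: "a \<bullet> (v, s) < b" "\<And>x. x \<in> K \<Longrightarrow> b < a \<bullet> x"
    using separating_hyperplane_closed_point by metis
  have "0 \<in> K" by (simp add: K_def seminorm_zero[OF N])
  then have b: "b < 0" using ab(2) by fastforce
  have "0 \<le> a \<bullet> (x, t)" if "N x \<le> t" for x t
  proof (rule ccontr)
    assume neg: "\<not> 0 \<le> a \<bullet> (x, t)"
    \<comment> \<open>Were the functional negative on the cone, some positive multiple of the point
      would give it exactly the value b, although it exceeds b on all of \<open>K\<close>.\<close>
    define c where "c = b / (a \<bullet> (x, t))"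
    have c: "c > 0" using b neg by (simp add: c_def divide_neg_neg)
    have "c *\<^sub>R (x, t) \<in> K" using N that c unfolding K_def seminorm_on_vec_def by simp
    then have "b < a \<bullet> (c *\<^sub>R (x, t))" by (rule ab(2))
    also have "\<dots> = b" using neg by (simp only: inner_scaleR_right) (simp add: c_def)
    finally show False by simp
  qed
  then have "a \<in> dual_cone N" by (simp add: dual_cone_def)
  moreover have "a \<bullet> (v, s) < 0" using ab(1) b by simp
  ultimately show ?thesis by blast
qed

section \<open>Minkowski inequality\<close>

text \<open>Extends convexity of the power from the positive reals to the endpoint 0, where it
  amounts to c^q \<le> c for 0 \<le> c \<le> 1.\<close>

lemma convex_powr_nonneg:
  fixes q :: real
  assumes "1 \<le> q" "0 \<le> s" "0 \<le> t" "0 \<le> a" "0 \<le> b" "a + b = 1"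
  shows "(a * s + b * t) powr q \<le> a * s powr q + b * t powr q"
proof -
  have pos: "(a * s + b * t) powr q \<le> a * s powr q + b * t powr q"
    if st: "0 < s" "0 < t" for s t
  proof -
    have c: "convex_on {0<..} (\<lambda>x::real. x powr q)"
      using assms(1) by (rule powr_convex)
    have "(a *\<^sub>R s + b *\<^sub>R t) powr q \<le> a * s powr q + b * t powr q"
      using c st assms unfolding convex_on_def by auto
    then show ?thesis by simp
  qed
  have zero: "(c * x) powr q \<le> c * x powr q" if "0 \<le> c" "c \<le> 1" "0 \<le> x" for c x
  proof -
    have "c powr q \<le> c"
    proof (cases "c = 0")
      case False
      then have "c powr q \<le> c powr 1" using that assms(1) by (intro powr_mono') auto
      then show ?thesis using that False by simp
    qed (use assms in simp)
    then show ?thesis using that by (simp add: powr_mult mult_right_mono)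
  qed
  consider "s = 0" | "t = 0" | "0 < s" "0 < t" using assms by linarith
  then show ?thesis
  proof cases
    case 1
    then show ?thesis using zero[of b t] assms by simp
  next
    case 2
    then show ?thesis using zero[of a s] assms by simp
  qed (rule pos)
qed

text \<open>For finite p the triangle inequality comes from convexity of the q-th power rather than
  from Hoelder: x + y is (a + b) times the convex combination, with weights a/(a+b) and b/(a+b), of
  x/a and y/b, whose norms are 1.\<close>

lemma lp_norm_seminorm:
  assumes "1 \<le> p"
  shows "seminorm_on_vec (lp_norm p :: real^'n::finite \<Rightarrow> real)"
proof (cases "p = \<infinity>")
  case True
  then have N: "lp_norm p x = (MAX i. \<bar>x $ i\<bar>)" for x :: "real^'n" by (simp add: lp_norm_def)
  have le: "\<bar>x $ i\<bar> \<le> lp_norm p x" for x :: "real^'n" and i unfolding N by (intro Max_ge) auto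
  have ge: "lp_norm p x \<le> m" if "\<And>i. \<bar>x $ i\<bar> \<le> m" for m and x :: "real^'n"
    unfolding N using that by (subst Max_le_iff) auto
  have add: "lp_norm p (x + y) \<le> lp_norm p x + lp_norm p y" for x y :: "real^'n"
  proof (rule ge)
    show "\<bar>(x + y) $ i\<bar> \<le> lp_norm p x + lp_norm p y" for i
      using le[of x i] le[of y i] by simp
  qed
  have sc: "lp_norm p (c *\<^sub>R x) \<le> \<bar>c\<bar> * lp_norm p x" for c and x :: "real^'n"
    by (rule ge) (simp add: abs_mult mult_left_mono le)
  have "lp_norm p (c *\<^sub>R x) = \<bar>c\<bar> * lp_norm p x" for c and x :: "real^'n"
  proof (cases "c = 0")
    case True
    then show ?thesis using sc[of 0 x] le[of "0 :: real^'n"] by (auto intro!: antisym)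
  next
    case False
    \<comment> \<open>The reverse inequality is the same bound applied to the inverse
      scalar.\<close>
    have "lp_norm p x \<le> \<bar>inverse c\<bar> * lp_norm p (c *\<^sub>R x)" using sc[of "inverse c" "c *\<^sub>R x"] False by simp
    then have "\<bar>c\<bar> * lp_norm p x \<le> lp_norm p (c *\<^sub>R x)" using False by (simp add: field_simps abs_inverse)
    then show ?thesis using sc[of c x] by simp
  qed
  with add show ?thesis by (simp add: seminorm_on_vec_def)
next
  case False
  define q where "q = real_of_ereal p"
  have q: "1 \<le> q" using assms False by (cases p) (auto simp: q_def)
  have N: "lp_norm p x = (\<Sum>i\<in>UNIV. \<bar>x $ i\<bar> powr q) powr (1 / q)" for x :: "real^'n"
    using False by (simp add: lp_norm_def q_def)
  have N0: "0 \<le> lp_norm p x" for x :: "real^'n" by (simp add: N)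
  have Nq: "lp_norm p x powr q = (\<Sum>i\<in>UNIV. \<bar>x $ i\<bar> powr q)" for x :: "real^'n"
    using q by (simp add: N powr_powr sum_nonneg)
  have sc: "lp_norm p (c *\<^sub>R x) = \<bar>c\<bar> * lp_norm p x" for c and x :: "real^'n"
  proof -
    have "(\<Sum>i\<in>UNIV. \<bar>(c *\<^sub>R x) $ i\<bar> powr q) = \<bar>c\<bar> powr q * (\<Sum>i\<in>UNIV. \<bar>x $ i\<bar> powr q)"
      by (simp add: abs_mult powr_mult sum_distrib_left)
    then show ?thesis using q by (simp add: N powr_mult sum_nonneg powr_powr)
  qed
  have zero: "x = 0" if "lp_norm p x = 0" for x :: "real^'n"
  proof -
    have "(\<Sum>i\<in>UNIV. \<bar>x $ i\<bar> powr q) = 0" using Nq[of x] that q by simp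
    then have "\<forall>i. \<bar>x $ i\<bar> powr q = 0" by (subst (asm) sum_nonneg_eq_0_iff) auto
    then show ?thesis by (simp add: vec_eq_iff)
  qed
  have "lp_norm p (x + y) \<le> lp_norm p x + lp_norm p y" for x y :: "real^'n"
  proof (cases "lp_norm p x = 0 \<or> lp_norm p y = 0")
    case True
    then show ?thesis using zero[of x] zero[of y] N0[of x] N0[of y] by auto
  next
    case False
    define a b where "a = lp_norm p x" and "b = lp_norm p y"
    have ab: "a > 0" "b > 0" using False N0[of x] N0[of y] by (auto simp: a_def b_def)
    have tm: "\<bar>(x + y) $ i\<bar> powr q \<le> (a + b) powr q * ((a / (a + b)) * (\<bar>x $ i\<bar> / a) powr q +
        (b / (a + b)) * (\<bar>y $ i\<bar> / b) powr q)" for i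
    proof -
      have "\<bar>(x + y) $ i\<bar> powr q \<le> (\<bar>x $ i\<bar> + \<bar>y $ i\<bar>) powr q" using q by (intro powr_mono2) auto
      also have "\<bar>x $ i\<bar> + \<bar>y $ i\<bar> = (a + b) * ((a / (a + b)) * (\<bar>x $ i\<bar> / a) + (b / (a +
          b)) * (\<bar>y $ i\<bar> / b))"
      proof -
        have "a + b \<noteq> 0" using ab by simp
        then have *: "(a + b) * ((a / (a + b)) * X + (b / (a + b)) * Y) = a * X + b * Y" for X Y
          by (simp add: distrib_left)
        show ?thesis unfolding * using ab by simp
      qed
      also have "\<dots> powr q = (a + b) powr q * ((a / (a + b)) * (\<bar>x $ i\<bar> / a) + (b / (a + b)) * (\<bar>y $ i\<bar> / b)) powr q"
        using ab by (subst powr_mult) (auto intro!: add_nonneg_nonneg)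
      also have "\<dots> \<le> (a + b) powr q * ((a / (a + b)) * (\<bar>x $ i\<bar> / a) powr q + (b / (a + b)) * (\<bar>y $ i\<bar> / b) powr q)"
        using ab q by (intro mult_left_mono convex_powr_nonneg) (auto simp: add_divide_distrib[symmetric])
      finally show ?thesis .
    qed
    have one: "(\<Sum>i\<in>UNIV. (\<bar>z $ i\<bar> / lp_norm p z) powr q) = 1" if "lp_norm p z > 0" for z :: "real^'n"
    proof -
      have "(\<Sum>i\<in>UNIV. (\<bar>z $ i\<bar> / lp_norm p z) powr q) = (\<Sum>i\<in>UNIV. \<bar>z $ i\<bar> powr q / lp_norm p z powr q)"
        using that by (simp add: powr_divide)
      also have "\<dots> = 1" using that by (simp add: sum_divide_distrib[symmetric] Nq[symmetric])
      finally show ?thesis .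
    qed
    have "lp_norm p (x + y) powr q \<le> (\<Sum>i\<in>UNIV. (a + b) powr q * ((a / (a + b)) * (\<bar>x $ i\<bar> / a)
        powr q + (b / (a + b)) * (\<bar>y $ i\<bar> / b) powr q))"
      unfolding Nq by (intro sum_mono tm)
    also have "\<dots> = (a + b) powr q * ((a / (a + b)) * (\<Sum>i\<in>UNIV. (\<bar>x $ i\<bar> / a) powr q) + (b / (a
        + b)) * (\<Sum>i\<in>UNIV. (\<bar>y $ i\<bar> / b) powr q))"
      by (simp add: sum_distrib_left sum.distrib distrib_left)
    also have "\<dots> = (a + b) powr q"
      using one[of x] one[of y] ab by (simp add: a_def[symmetric] b_def[symmetric] add_divide_distrib[symmetric])
    finally have "lp_norm p (x + y) powr q \<le> (a + b) powr q" .
    then have "(lp_norm p (x + y) powr q) powr (1 / q) \<le> ((a + b) powr q) powr (1 / q)"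
      using q by (intro powr_mono2[of "1/q"]) auto
    then show ?thesis using q N0[of "x + y"] ab by (simp add: powr_powr a_def b_def)
  qed
  with sc show ?thesis by (simp add: seminorm_on_vec_def)
qed


subsection \<open>Approximation up to the boundary\<close>

text \<open>A uniform inner cone condition. Moving by t e raises e \<bullet> y by t and leaves the
  argument of \<gamma> unchanged, while a further displacement z can reduce the distance to the
  graph by at most (1 + 2 L) norm z.\<close>

lemma local_shift:
  fixes \<Omega> :: "(real^'d::finite) set"
  assumes lb: "lipschitz_boundary \<Omega>" and "open \<Omega>" and x0: "x0 \<in> closure \<Omega>"
  shows "\<exists>r>0. \<exists>e \<kappa> t0. norm e \<le> 1 \<and> 0 < \<kappa> \<and> \<kappa> \<le> 1 \<and> 0 < t0 \<and>
    (\<forall>y\<in>ball x0 r \<inter> closure \<Omega>. \<forall>t. 0 < t \<and> t < t0 \<longrightarrow> cball (y + t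
        *\<^sub>R e) (\<kappa> * t) \<subseteq> \<Omega>)"
proof (cases "x0 \<in> \<Omega>")
  case True
  then obtain r where r: "r > 0" "ball x0 r \<subseteq> \<Omega>" using \<open>open \<Omega>\<close> open_contains_ball by blast
  have "cball (y + t *\<^sub>R 0) (1 * t) \<subseteq> \<Omega>" if "y \<in> ball x0 (r/2)" "t < r/2" for y t
  proof
    fix z assume "z \<in> cball (y + t *\<^sub>R 0) (1 * t)"
    then have "dist y z \<le> t" by simp
    moreover have "dist x0 z \<le> dist x0 y + dist y z" by (rule dist_triangle)
    ultimately have "z \<in> ball x0 r" using that by simp
    then show "z \<in> \<Omega>" using r by blast
  qed
  then show ?thesis using r(1)
    by (intro exI[of _ "r/2"] conjI exI[of _ "0 :: real^'d"] exI[of _ "1::real"]) auto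
next
  case False
  then have "x0 \<in> frontier \<Omega>" using x0 \<open>open \<Omega>\<close> by (simp add: frontier_def interior_open)
  then obtain r e L \<gamma> where r: "r > 0" and e: "norm e = 1" and L: "L-lipschitz_on {z. e \<bullet> z = 0} \<gamma>"
    and ep: "\<And>y. y \<in> ball x0 r \<Longrightarrow> y \<in> \<Omega> \<longleftrightarrow> \<gamma> (y - (e
        \<bullet> y) *\<^sub>R e) < e \<bullet> y"
    using lb unfolding lipschitz_boundary_def by blast
  define P where "P y = y - (e \<bullet> y) *\<^sub>R e" for y
  have ee: "e \<bullet> e = 1" using e by (simp add: dot_square_norm)
  have P0: "P y \<in> {z. e \<bullet> z = 0}" for y by (simp add: P_def inner_diff_right ee)
  have L0: "0 \<le> L" using L lipschitz_on_nonneg by blast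
  have Pn: "norm (P z) \<le> 2 * norm z" for z
  proof -
    have "norm (P z) \<le> norm z + \<bar>e \<bullet> z\<bar> * norm e" unfolding P_def using norm_triangle_ineq4[of z
        "(e \<bullet> z) *\<^sub>R e"] by simp
    moreover have "\<bar>e \<bullet> z\<bar> \<le> norm e * norm z" by (rule Cauchy_Schwarz_ineq2)
    ultimately show ?thesis using e by simp
  qed
  have gP: "continuous_on UNIV (\<lambda>y. \<gamma> (P y))"
    by (rule continuous_on_compose2[OF lipschitz_on_continuous_on[OF L]]) (use P0 in \<open>auto simp: P_def intro!: continuous_intros\<close>)
  \<comment> \<open>The strict epigraph inequality passes to the closure as a weak one, inside the
    open ball where the description by \<gamma> is valid.\<close>
  have clos: "\<gamma> (P y) \<le> e \<bullet> y" if y: "y \<in> closure \<Omega>" "y \<in> ball x0 r" for y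
  proof -
    have "y \<in> closure (ball x0 r \<inter> \<Omega>)" using y open_Int_closure_subset[OF open_ball, of x0 r \<Omega>] by blast
    moreover have "closure (ball x0 r \<inter> \<Omega>) \<subseteq> {y. \<gamma> (P y) \<le> e \<bullet> y}"
      by (rule closure_minimal) (use ep gP in \<open>auto simp: P_def less_imp_le intro!: closed_Collect_le continuous_intros\<close>)
    ultimately show ?thesis by blast
  qed
  \<comment> \<open>The projection \<open>P\<close> at most doubles lengths, so \<gamma> and the
    inner product change by at most (1 + 2 L) norm z; this \<kappa> makes that at most t/2.\<close>
  define \<kappa> where "\<kappa> = 1 / (2 * (1 + 2 * L))"
  have \<kappa>: "0 < \<kappa>" "\<kappa> \<le> 1" "(1 + 2 * L) * \<kappa> < 1" using L0 by (auto simp: \<kappa>_def field_simps)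
  \<comment> \<open>The total displacement is at most 2 t < r/2, so starting in the half ball one
    stays in the ball of radius r.\<close>
  have "cball (y + t *\<^sub>R e) (\<kappa> * t) \<subseteq> \<Omega>" if y: "y \<in> ball x0 (r/2)" "y \<in> closure
      \<Omega>" and t: "0 < t" "t < r/4" for y t
  proof
    fix x assume x: "x \<in> cball (y + t *\<^sub>R e) (\<kappa> * t)"
    define z where "z = x - y - t *\<^sub>R e"
    have z: "norm z \<le> \<kappa> * t" using x by (simp add: z_def dist_norm norm_minus_commute algebra_simps)
    have xe: "x = y + t *\<^sub>R e + z" by (simp add: z_def)
    have zt: "norm z \<le> t" using z \<kappa> t by (smt (verit) mult_left_le_one_le)
    have "norm (x - y) \<le> norm (t *\<^sub>R e) + norm z" 
      using norm_triangle_ineq[of "t *\<^sub>R e" z] unfolding xe by simp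
    then have "dist y x \<le> 2 * t" using zt e t by (simp add: dist_norm norm_minus_commute)
    then have xb: "x \<in> ball x0 r" using dist_triangle[of x0 x y] y t by simp
    have yb: "y \<in> ball x0 r" using y(1) r by simp
    have Px: "P x = P y + P z" unfolding xe P_def by (simp add: inner_add_right ee algebra_simps)
    have "dist (\<gamma> (P x)) (\<gamma> (P y)) \<le> L * dist (P x) (P y)" by (rule lipschitz_onD[OF L P0 P0])
    also have "\<dots> \<le> L * (2 * norm z)" using Px Pn[of z] L0 by (intro mult_left_mono) (auto simp: dist_norm)
    finally have "\<gamma> (P x) \<le> e \<bullet> y + L * (2 * norm z)" using clos[OF y(2) yb] by (simp add: dist_real_def abs_le_iff)
    moreover have "e \<bullet> x = e \<bullet> y + t + e \<bullet> z" unfolding xe by (simp add: inner_add_right ee)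
    moreover have "\<bar>e \<bullet> z\<bar> \<le> norm z" using Cauchy_Schwarz_ineq2[of e z] e by simp
    moreover have "(1 + 2 * L) * norm z < t"
    proof -
      have "(1 + 2 * L) * norm z \<le> (1 + 2 * L) * (\<kappa> * t)" using z L0 by (intro mult_left_mono) auto
      also have "\<dots> < 1 * t" using mult_strict_right_mono[OF \<kappa>(3) t(1)] by simp
      finally show ?thesis by simp
    qed
    ultimately have "\<gamma> (P x) < e \<bullet> x" by (simp add: algebra_simps)
    then show "x \<in> \<Omega>" using ep[OF xb] by (simp add: P_def)
  qed
  then show ?thesis using r e \<kappa>
    by (intro exI[of _ "r/2"] conjI exI[of _ e] exI[of _ \<kappa>] exI[of _ "r/4"]) auto
qed

text \<open>The profile of the partition functions: squaring removes the kink of the positive part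
  at 0.\<close>

lemma DERIV_pos_part_square: "((\<lambda>t::real. (max 0 t)\<^sup>2) has_real_derivative 2 * max 0 t) (at t)"
proof -
  consider "t > 0" | "t < 0" | "t = 0" by linarith
  then show ?thesis
  proof cases
    case 1
    have "((\<lambda>t::real. t\<^sup>2) has_real_derivative 2 * max 0 t) (at t)" using 1 by (auto intro!: derivative_eq_intros)
    then show ?thesis
      by (rule has_field_derivative_transform_within_open[where S="{0<..}"]) (use 1 in auto)
  next
    case 2
    have "((\<lambda>t::real. 0) has_real_derivative 2 * max 0 t) (at t)" using 2 by simp
    then show ?thesis
      by (rule has_field_derivative_transform_within_open[where S="{..<0}"]) (use 2 in auto)
  next
    case 3
    have "((\<lambda>h::real. max 0 h) \<longlongrightarrow> max 0 0) (at 0)" by (intro tendsto_intros)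
    then have "((\<lambda>h::real. max 0 h) \<longlongrightarrow> 0) (at 0)" by simp
    then have "((\<lambda>h::real. ((max 0 (0 + h))\<^sup>2 - (max 0 (0::real))\<^sup>2) / h) \<longlongrightarrow> 0) (at 0)"
      by (rule Lim_transform_eventually) (auto simp: eventually_at_filter max_def power2_eq_square)
    then show ?thesis using 3 by (simp add: DERIV_def)
  qed
qed

text \<open>The bumps (max 0 (r^2 - |y - j|^2))^2 divided by their sum, which is positive on
  \<open>K\<close>. The gradients are returned as explicit fields \<open>Z\<close> because later
  both their bound on \<open>K\<close> and their vanishing sum are used.\<close>

lemma C1_partition_of_unity:
  fixes K :: "('a::euclidean_space) set"
  assumes "compact K" and r: "\<forall>x\<in>K. 0 < r x"
  shows "\<exists>J \<zeta> Z. finite J \<and> J \<subseteq> K \<and>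
    (\<forall>j\<in>J. \<forall>y\<in>K. 0 \<le> \<zeta> j y \<and> (\<zeta> j has_derivative (\<lambda>v. Z j y \<bullet> v)) (at y) \<and>
       (y \<notin> ball j (r j) \<longrightarrow> \<zeta> j y = 0 \<and> Z j y = (0::'a))) \<and>
    (\<forall>j\<in>J. continuous_on K (Z j)) \<and>
    (\<forall>y\<in>K. (\<Sum>j\<in>J. \<zeta> j y) = (1::real) \<and> (\<Sum>j\<in>J. Z j y) = 0)"
proof -
  have "K \<subseteq> (\<Union>x\<in>K. ball x (r x))" using r by force
  then obtain J where J: "J \<subseteq> K" "finite J" "K \<subseteq> (\<Union>x\<in>J. ball x (r x))"
    using compactE_image[OF \<open>compact K\<close>, of K "\<lambda>x. ball x (r x)"] by auto
  define q where "q j y = (r j)\<^sup>2 - (y - j) \<bullet> (y - j)" for j y :: 'a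
  define b where "b j y = (max 0 (q j y))\<^sup>2" for j y
  define B where "B j y = (-4 * max 0 (q j y)) *\<^sub>R (y - j)" for j y
  have bd: "(b j has_derivative (\<lambda>v. B j y \<bullet> v)) (at y)" for j y
  proof -
    have "(q j has_derivative (\<lambda>v. - 2 * ((y - j) \<bullet> v))) (at y)"
      unfolding q_def[abs_def] by (auto intro!: derivative_eq_intros simp: inner_commute)
    from DERIV_compose_FDERIV[OF DERIV_pos_part_square this]
    show ?thesis unfolding b_def[abs_def] B_def by (simp add: mult_ac)
  qed
  have b0: "0 \<le> b j y" for j y by (simp add: b_def)
  have bz: "b j y = 0" "B j y = 0" if "y \<notin> ball j (r j)" "j \<in> J" for j y
  proof -
    have "r j \<le> norm (y - j)" using that(1) by (simp add: dist_norm norm_minus_commute)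
    moreover have "0 < r j" using r J(1) that(2) by blast
    ultimately have "(r j)\<^sup>2 \<le> (norm (y - j))\<^sup>2" by (intro power_mono) auto
    then have "q j y \<le> 0" by (simp add: q_def dot_square_norm)
    then show "b j y = 0" "B j y = 0" by (auto simp: b_def B_def)
  qed
  have bp: "0 < b j y" if "y \<in> ball j (r j)" for j y
  proof -
    have "norm (y - j) < r j" using that by (simp add: dist_norm norm_minus_commute)
    then have "(norm (y - j))\<^sup>2 < (r j)\<^sup>2" by (intro power_strict_mono) auto
    then show ?thesis by (simp add: b_def q_def dot_square_norm)
  qed
  define S where "S y = (\<Sum>j\<in>J. b j y)" for y
  define D where "D y = (\<Sum>j\<in>J. B j y)" for y
  have Sp: "0 < S y" if "y \<in> K" for y
  proof -
    have "y \<in> (\<Union>x\<in>J. ball x (r x))" using J(3) that by (rule subsetD)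
    then obtain j where "j \<in> J" "y \<in> ball j (r j)" by (rule UN_E)
    then show ?thesis unfolding S_def using bp b0 J(2) by (intro sum_pos2) auto
  qed
  have Sd: "(S has_derivative (\<lambda>v. D y \<bullet> v)) (at y)" for y
    unfolding S_def[abs_def] D_def inner_sum_left by (intro has_derivative_sum bd)
  have Bc: "continuous_on K (B j)" for j unfolding B_def q_def by (intro continuous_intros)
  have bc: "continuous_on K (b j)" for j unfolding b_def q_def by (intro continuous_intros)
  have Dc: "continuous_on K D" unfolding D_def[abs_def] by (intro continuous_on_sum Bc)
  have Sc: "continuous_on K S" unfolding S_def[abs_def] by (intro continuous_on_sum bc)
  define \<zeta> where "\<zeta> j y = b j y / S y" for j y
  define Z where "Z j y = (1 / S y) *\<^sub>R B j y - (b j y / (S y)\<^sup>2) *\<^sub>R D y" for j y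
  have \<zeta>d: "(\<zeta> j has_derivative (\<lambda>v. Z j y \<bullet> v)) (at y)" if "y \<in> K" for j y
  proof -
    have "((\<lambda>y. b j y / S y) has_derivative
        (\<lambda>v. - b j y * (inverse (S y) * (D y \<bullet> v) * inverse (S y)) + (B j y \<bullet> v) / S y)) (at y)"
      by (intro has_derivative_divide bd Sd) (use Sp[OF that] in simp)
    then show ?thesis unfolding \<zeta>_def[abs_def] Z_def
      by (simp add: inner_diff_left power2_eq_square divide_inverse algebra_simps)
  qed
  have Zc: "continuous_on K (Z j)" for j
  proof -
    have "S y \<noteq> 0" if "y \<in> K" for y using Sp[OF that] by simp
    then show ?thesis unfolding Z_def[abs_def] by (intro continuous_intros Bc Dc bc Sc) auto
  qed
  have "(\<Sum>j\<in>J. \<zeta> j y) = 1" if "y \<in> K" for y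
    using Sp[OF that] by (simp add: \<zeta>_def sum_divide_distrib[symmetric] S_def)
  moreover have "(\<Sum>j\<in>J. Z j y) = 0" if "y \<in> K" for y
  proof -
    have "(\<Sum>j\<in>J. Z j y) = (1 / S y) *\<^sub>R D y - (S y / (S y)\<^sup>2) *\<^sub>R D y"
      by (simp add: Z_def sum_subtractf scaleR_sum_right[symmetric] scaleR_sum_left[symmetric] D_def[symmetric]
          sum_divide_distrib[symmetric] S_def[symmetric])
    then show ?thesis using Sp[OF that] by (simp add: power2_eq_square)
  qed
  moreover have "0 \<le> \<zeta> j y" if "y \<in> K" for j y using b0 Sp[OF that] by (simp add: \<zeta>_def)
  moreover have "\<zeta> j y = 0 \<and> Z j y = 0" if "j \<in> J" "y \<notin> ball j (r j)" for j y
    using bz[OF that(2,1)] by (simp add: \<zeta>_def Z_def)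
  ultimately show ?thesis using J(1,2) \<zeta>d Zc by (intro exI[of _ J] exI[of _ \<zeta>] exI[of _ Z]) auto
qed

lemma moll_close_finite:
  fixes F :: "(real^'d::finite \<Rightarrow> real) set"
  assumes "finite F" "\<And>f. f \<in> F \<Longrightarrow> f \<in> L2 UNIV" "\<And>f x. f \<in> F \<Longrightarrow> R
      \<le> norm x \<Longrightarrow> f x = 0" and "e > 0"
  shows "\<exists>\<delta>>0. \<forall>f\<in>F. \<forall>r \<rho> c. mollifier r \<rho> \<and> r + norm c < \<delta>
      \<longrightarrow> (LINT x|lebesgue. (moll \<rho> c f x - f x)\<^sup>2) < e"
  using assms(1-3)
proof (induction F rule: finite_induct)
  case (insert f F)
  then obtain \<delta>1 where \<delta>1: "\<delta>1 > 0" "\<forall>f\<in>F. \<forall>r \<rho> c. mollifier r \<rho>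
      \<and> r + norm c < \<delta>1 \<longrightarrow> (LINT x|lebesgue. (moll \<rho> c f x - f x)\<^sup>2) < e"
    by auto
  obtain \<delta>2 where \<delta>2: "\<delta>2 > 0" "\<forall>r \<rho> c. mollifier r \<rho> \<and> r + norm c <
      \<delta>2 \<longrightarrow> (LINT x|lebesgue. (moll \<rho> c f x - f x)\<^sup>2) < e"
    using moll_close[of f R e] insert.prems \<open>e > 0\<close> by auto
  show ?case using \<delta>1 \<delta>2 by (intro exI[of _ "min \<delta>1 \<delta>2"]) auto
qed (auto intro: exI[of _ 1])

lemma finite_positive_lower_bound:
  fixes t :: "'a \<Rightarrow> real"
  assumes "finite J" "\<And>j. j \<in> J \<Longrightarrow> 0 < t j"
  shows "\<exists>m>0. \<forall>j\<in>J. m \<le> t j"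
  using assms
proof (induction J rule: finite_induct)
  case (insert j J)
  then obtain m where "m > 0" "\<forall>j\<in>J. m \<le> t j" by auto
  then show ?case using insert.prems by (intro exI[of _ "min m (t j)"]) auto
qed (auto intro: exI[of _ 1])

text \<open>Jensen's inequality for \<open>N\<close>: if the average left the epigraph cone, one
  element of \<open>dual_cone N\<close> would detect it, yet the pairing with that element is the
  integral of a nonnegative function.\<close>

lemma mollified_constraint:
  fixes w :: "real^'d::finite \<Rightarrow> real^'n::finite"
  assumes N: "seminorm_on_vec N" and \<Omega>: "\<Omega> \<in> sets lebesgue" "bounded \<Omega>" and \<rho>: "mollifier
      r \<rho>" and sub: "cball (y + c) r \<subseteq> \<Omega>"
    and w: "\<And>i. (\<lambda>x. w x $ i) \<in> L2 \<Omega>"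
    and con: "AE s in lebesgue_on \<Omega>. s \<in> cball (y + c) r \<longrightarrow> N (w s) \<le> A"
  shows "N (\<chi> i. moll \<rho> c (zero_ext \<Omega> (\<lambda>x. w x $ i)) y) \<le> A"
proof (rule ccontr)
  assume "\<not> N (\<chi> i. moll \<rho> c (zero_ext \<Omega> (\<lambda>x. w x $ i)) y) \<le> A"
  then obtain z where z: "z \<in> dual_cone N" and neg: "z \<bullet> ((\<chi> i. moll \<rho> c (zero_ext \<Omega> (\<lambda>x. w x $ i)) y), A) < 0"
    using dual_cone_separates[OF N, of A] by force
  define m where "m i = zero_ext \<Omega> (\<lambda>x. w x $ i)" for i
  have mi: "integrable lebesgue (m i)" for i
    using L2_integrable[OF \<Omega>(2,1) w] LINT_lebesgue_on(2)[OF \<Omega>(1)] unfolding m_def by blast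
  note ii = moll_has_derivative(3)[OF \<rho> mi]
  note i1 = mollifier_shift_integral(1,2)[OF \<rho>]
  have "z \<bullet> ((\<chi> i. moll \<rho> c (m i) y), A) = (\<Sum>i\<in>UNIV. fst z $ i * moll \<rho> c (m i) y) + snd z * A"
    by (simp add: inner_prod_def inner_vec_def)
  \<comment> \<open>Unit mass of the kernel turns the constant A into an integral against the same
    weight.\<close>
  also have "\<dots> = (LINT s|lebesgue. (\<Sum>i\<in>UNIV. fst z $ i * (\<rho> (s - y - c) * m i s)) + (snd z * A) * \<rho> (s - y - c))"
    using ii i1 by (subst Bochner_Integration.integral_add) (auto simp: moll_def)
  also have "\<dots> \<ge> 0"
  proof (rule integral_nonneg_AE)
    have "AE s in lebesgue. s \<in> \<Omega> \<longrightarrow> s \<in> cball (y + c) r \<longrightarrow> N (w s) \<le> A"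
      using con \<Omega>(1) by (subst (asm) AE_restrict_space_iff) auto
    then show "AE s in lebesgue. 0 \<le> (\<Sum>i\<in>UNIV. fst z $ i * (\<rho> (s - y - c) * m i s)) + (snd z * A) * \<rho> (s - y - c)"
    proof eventually_elim
      case (elim s)
      show ?case
      proof (cases "\<rho> (s - y - c) = 0")
        case False
        then have "norm (s - y - c) < r" using mollifierD(3)[OF \<rho>, of "s - y - c"] by force
        then have sb: "s \<in> cball (y + c) r" by (simp add: dist_norm norm_minus_commute algebra_simps)
        then have s\<Omega>: "s \<in> \<Omega>" using sub by blast
        have "0 \<le> z \<bullet> (w s, A)" using z elim s\<Omega> sb unfolding dual_cone_def by blast
        then have "0 \<le> \<rho> (s - y - c) * (z \<bullet> (w s, A))" using mollifierD(2)[OF \<rho>] by simp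
        also have "\<dots> = (\<Sum>i\<in>UNIV. fst z $ i * (\<rho> (s - y - c) * m i s)) + (snd z * A) * \<rho> (s - y - c)"
          using s\<Omega> by (simp add: inner_prod_def inner_vec_def m_def zero_ext_def sum_distrib_left algebra_simps)
        finally show ?thesis .
      qed simp
    qed
  qed
  finally show False using neg by (simp add: m_def)
qed

lemma integral_lebesgue_on_le:
  fixes h :: "'a::euclidean_space \<Rightarrow> real"
  assumes "\<Omega> \<in> sets lebesgue" "integrable lebesgue h" "\<And>x. 0 \<le> h x"
  shows "integrable (lebesgue_on \<Omega>) h" "(LINT x|lebesgue_on \<Omega>. h x) \<le> (LINT x|lebesgue. h x)"
proof -
  have eq: "zero_ext \<Omega> h = (\<lambda>x. indicator \<Omega> x *\<^sub>R h x)" by (auto simp: zero_ext_def fun_eq_iff indicator_def)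
  have i: "integrable lebesgue (zero_ext \<Omega> h)"
    unfolding eq by (rule integrable_mult_indicator[OF assms(1,2)])
  then show "integrable (lebesgue_on \<Omega>) h" using LINT_lebesgue_on(2)[OF assms(1)] by blast
  show "(LINT x|lebesgue_on \<Omega>. h x) \<le> (LINT x|lebesgue. h x)"
    unfolding LINT_lebesgue_on(1)[OF assms(1)]
    by (rule integral_mono[OF i assms(2)]) (simp add: zero_ext_def assms(3))
qed

lemma norm_sum_square_le:
  fixes f :: "'i \<Rightarrow> 'a::real_normed_vector"
  shows "(norm (\<Sum>j\<in>J. f j))\<^sup>2 \<le> real (card J) * (\<Sum>j\<in>J. (norm (f j))\<^sup>2)"
proof -
  have "(norm (\<Sum>j\<in>J. f j))\<^sup>2 \<le> (\<Sum>j\<in>J. norm (f j))\<^sup>2"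
    by (intro power_mono norm_sum) auto
  also have "\<dots> \<le> (\<Sum>j\<in>J. (norm (f j))\<^sup>2) * real (card J)"
    using sum_squared_le_sum_of_squares[of "\<lambda>j. norm (f j)" J] by (cases "finite J") auto
  finally show ?thesis by (simp add: mult.commute)
qed

text \<open>Gluing adds to the gradient the mollified functions times the fields \<open>Z j\<close>,
  which need not be small individually. Since the \<open>Z j\<close> sum to zero, the value of w can
  be subtracted from each mollification, and only small differences remain.\<close>

lemma H1_constrained_density:
  fixes \<Omega> :: "(real^'d::finite) set" and w :: "real^'d \<Rightarrow> real^'n::finite"
  assumes \<Omega>: "open \<Omega>" "bounded \<Omega>" "lipschitz_boundary \<Omega>"
    and N: "seminorm_on_vec N"
    and w: "\<And>i. has_wgrad \<Omega> (\<lambda>x. w x $ i) (G i)"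
    and \<alpha>: "continuous_on (closure \<Omega>) \<alpha>"
    and con: "AE x in lebesgue_on \<Omega>. N (w x) \<le> \<alpha> x"
    and "0 < e"
  shows "\<exists>g \<Gamma>. (\<forall>i. (\<forall>x\<in>closure \<Omega>. (g i has_derivative (\<lambda>v. \<Gamma>
      i x \<bullet> v)) (at x)) \<and> continuous_on (closure \<Omega>) (\<Gamma> i) \<and>
      (LINT x|lebesgue_on \<Omega>. (g i x - w x $ i)\<^sup>2) \<le> e \<and> (LINT x|lebesgue_on \<Omega>. (norm
          (\<Gamma> i x - G i x))\<^sup>2) \<le> e) \<and>
     (\<forall>x\<in>closure \<Omega>. N (\<chi> i. g i x) \<le> \<alpha> x + e)"
proof -
  have \<Omega>s: "\<Omega> \<in> sets lebesgue" using \<Omega> by (simp add: borel_open sets_completionI_sets)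
  define K where "K = closure \<Omega>"
  have K: "compact K" "\<Omega> \<subseteq> K" using \<Omega> closure_subset by (auto simp: K_def compact_closure)
  have "\<forall>x\<in>K. \<exists>r E \<kappa> t0. r > 0 \<and> norm E \<le> 1 \<and> 0 < \<kappa> \<and> \<kappa> \<le> 1 \<and> 0 < t0 \<and>
    (\<forall>y\<in>ball x r \<inter> K. \<forall>t. 0 < t \<and> t < t0 \<longrightarrow> cball (y + t *\<^sub>R E)
        (\<kappa> * t) \<subseteq> \<Omega>)"
    using local_shift[OF \<Omega>(3,1)] unfolding K_def by blast
  then obtain r E \<kappa> t0 where loc: "\<And>x. x \<in> K \<Longrightarrow> r x > 0 \<and> norm (E x) \<le> 1 \<and>
      0 < \<kappa> x \<and> \<kappa> x \<le> 1 \<and> 0 < t0 x \<and>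
    (\<forall>y\<in>ball x (r x) \<inter> K. \<forall>t. 0 < t \<and> t < t0 x \<longrightarrow> cball (y + t *\<^sub>R
        E x) (\<kappa> x * t) \<subseteq> \<Omega>)"
    by metis
  have rpos: "\<forall>x\<in>K. 0 < r x" using loc by simp
  obtain J \<zeta> Z where PU: "finite J \<and> J \<subseteq> K \<and>
    (\<forall>j\<in>J. \<forall>y\<in>K. 0 \<le> \<zeta> j y \<and> (\<zeta> j has_derivative (\<lambda>v. Z j y \<bullet> v)) (at y) \<and>
       (y \<notin> ball j (r j) \<longrightarrow> \<zeta> j y = 0 \<and> Z j y = 0)) \<and>
    (\<forall>j\<in>J. continuous_on K (Z j)) \<and>
    (\<forall>y\<in>K. (\<Sum>j\<in>J. \<zeta> j y) = 1 \<and> (\<Sum>j\<in>J. Z j y) = 0)"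
    using C1_partition_of_unity[OF K(1) rpos] by (elim exE) (rule that)
  have J: "finite J" "J \<subseteq> K" using PU by simp_all
  have \<zeta>0: "0 \<le> \<zeta> j y" and \<zeta>d: "(\<zeta> j has_derivative (\<lambda>v. Z j y \<bullet> v)) (at y)"
    and \<zeta>z: "y \<notin> ball j (r j) \<Longrightarrow> \<zeta> j y = 0 \<and> Z j y = 0" if "j \<in> J" "y \<in> K" for j y
    using PU that by simp_all
  have Zc: "continuous_on K (Z j)" if "j \<in> J" for j using PU that by simp
  have \<zeta>1: "(\<Sum>j\<in>J. \<zeta> j y) = 1" and Z0: "(\<Sum>j\<in>J. Z j y) = 0" if "y \<in> K" for y
    using PU that by simp_all
  have \<zeta>le: "\<zeta> j y \<le> 1" if "j \<in> J" "y \<in> K" for j y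
    using member_le_sum[of j J "\<lambda>j. \<zeta> j y"] J(1) \<zeta>0 \<zeta>1[OF that(2)] that by auto
  have "bounded (\<Union>j\<in>J. Z j ` K)"
    using J(1) Zc K(1) by (intro bounded_UN ballI compact_imp_bounded compact_continuous_image) auto
  then obtain B where B: "B > 0" "\<And>j y. j \<in> J \<Longrightarrow> y \<in> K \<Longrightarrow> norm (Z j y) \<le> B"
    unfolding bounded_pos by blast
  define n where "n = real (card J)"
  \<comment> \<open>Collects the constants of \<open>I1\<close> and \<open>I2\<close>: the first
    error is at most n^2 e' and the second 2 n^2 (B^2 + d) e', where d is the dimension and e' = e /
    A.\<close>
  define A where "A = 2 * n * n * (B\<^sup>2 + CARD('d)) + n * n + 1"
  have A: "A > 0" by (simp add: A_def n_def add_nonneg_pos)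
  define e' where "e' = e / A"
  have e': "e' > 0" using A \<open>0 < e\<close> by (simp add: e'_def)
  define m where "m i = zero_ext \<Omega> (\<lambda>x. w x $ i)" for i
  define M where "M i l = zero_ext \<Omega> (\<lambda>x. G i x $ l)" for i l
  have wL: "(\<lambda>x. w x $ i) \<in> L2 \<Omega>" and GL: "(\<lambda>x. G i x $ l) \<in> L2 \<Omega>" for i l
    using w[of i] by (auto simp: has_wgrad_def L2_component)
  obtain R where R: "\<And>x. x \<in> \<Omega> \<Longrightarrow> norm x < R" using \<open>bounded \<Omega>\<close> unfolding bounded_pos_less by blast
  have zz: "zero_ext \<Omega> f x = 0" if "R \<le> norm x" for f x using R[of x] that by (auto simp: zero_ext_def)
  \<comment> \<open>All components and all partial derivatives at once; being finitely many, they
    share one threshold \<delta>1.\<close>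
  define F where "F = range m \<union> range (\<lambda>(i, l). M i l)"
  have FL: "f \<in> L2 UNIV" if "f \<in> F" for f
    using that wL GL zero_ext_L2[OF \<Omega>s] by (auto simp: F_def m_def M_def)
  have Fz: "f x = 0" if "f \<in> F" "R \<le> norm x" for f x
    using that zz by (auto simp: F_def m_def M_def)
  have Fi: "integrable lebesgue f" if "f \<in> F" for f
    by (rule L2_bounded_support_integrable[OF FL[OF that] Fz[OF that]])
  have "finite F" by (simp add: F_def)
  have "\<exists>\<delta>>0. \<forall>f\<in>F. \<forall>r \<rho> c. mollifier r \<rho> \<and> r + norm c < \<delta>
      \<longrightarrow> (LINT x|lebesgue. (moll \<rho> c f x - f x)\<^sup>2) < e'"
    by (rule moll_close_finite[where R=R]) (use \<open>finite F\<close> FL Fz e' in blast)+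
  then obtain \<delta>1 where \<delta>1: "\<delta>1 > 0" "\<And>f r \<rho> c. f \<in> F \<Longrightarrow> mollifier r
      \<rho> \<Longrightarrow> r + norm c < \<delta>1 \<Longrightarrow> (LINT x|lebesgue. (moll \<rho> c f x - f x)\<^sup>2) < e'"
    by blast
  have "uniformly_continuous_on K \<alpha>" using \<alpha> K(1) by (intro compact_uniformly_continuous) (auto simp: K_def)
  then obtain \<delta>2 where \<delta>2: "\<delta>2 > 0" "\<And>x y. x \<in> K \<Longrightarrow> y \<in> K
      \<Longrightarrow> dist y x < \<delta>2 \<Longrightarrow> dist (\<alpha> y) (\<alpha> x) < e"
    using \<open>0 < e\<close> unfolding uniformly_continuous_on_def by metis
  obtain tm where tm: "tm > 0" "\<And>j. j \<in> J \<Longrightarrow> tm \<le> t0 j"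
    using finite_positive_lower_bound[OF J(1), of t0] loc J(2) by blast
  \<comment> \<open>Every kernel ball lies within 2 t of its point, so thirds make 2 t smaller than
    both \<delta>1 and \<delta>2; tm/2 keeps t admissible for every patch.\<close>
  define t where "t = min (\<delta>1/3) (min (\<delta>2/3) (tm/2))"
  have t: "0 < t" "2 * t < \<delta>1" "2 * t < \<delta>2" "t < tm" using \<delta>1(1) \<delta>2(1) tm(1) by (auto simp: t_def)
  define rr where "rr j = \<kappa> j * t" for j
  define cc where "cc j = t *\<^sub>R E j" for j
  have rr: "0 < rr j" "rr j + norm (cc j) \<le> 2 * t" if "j \<in> J" for j
  proof -
    have j: "0 < \<kappa> j" "\<kappa> j \<le> 1" "norm (E j) \<le> 1" using loc that J(2) by blast+
    show "0 < rr j" using j t(1) by (simp add: rr_def)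
    have "\<kappa> j * t \<le> 1 * t" "t * norm (E j) \<le> t * 1" using j t(1) by (intro mult_right_mono mult_left_mono; simp)+
    moreover have "norm (cc j) = t * norm (E j)" using t(1) by (simp add: cc_def)
    ultimately show "rr j + norm (cc j) \<le> 2 * t" unfolding rr_def by linarith
  qed
  have sub: "cball (y + cc j) (rr j) \<subseteq> \<Omega>" if "j \<in> J" "y \<in> K" "\<zeta> j y \<noteq> 0" for j y
  proof -
    have "y \<in> ball j (r j) \<inter> K" using \<zeta>z[OF that(1,2)] that by blast
    moreover have "t < t0 j" using t(4) tm(2)[OF that(1)] by simp
    ultimately show ?thesis using loc that(1) J(2) t(1) unfolding cc_def rr_def by blast
  qed
  have "\<forall>j\<in>J. \<exists>\<rho>::real^'d \<Rightarrow> real. mollifier (rr j) \<rho>" using rr(1) mollifier_exists by blast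
  then obtain \<rho> :: "real^'d \<Rightarrow> real^'d \<Rightarrow> real" where \<rho>: "\<And>j. j \<in> J
      \<Longrightarrow> mollifier (rr j) (\<rho> j)" by metis
  have mF: "m i \<in> F" and MF: "M i l \<in> F" for i l by (auto simp: F_def)
  define D where "D j i y = - (LINT s|lebesgue. m i s *\<^sub>R grad (\<rho> j) (s - y - cc j))" for j i y
  have Dd: "(moll (\<rho> j) (cc j) (m i) has_derivative (\<lambda>v. D j i y \<bullet> v)) (at y)"
    and Dc: "continuous_on UNIV (D j i)" if "j \<in> J" for j i y
    using moll_has_derivative(1,2)[OF \<rho>[OF that] Fi[OF mF], where c="cc j"] unfolding D_def[abs_def] by auto
  have mc: "continuous_on UNIV (moll (\<rho> j) (cc j) (m i))" if "j \<in> J" for j i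
    by (rule moll_continuous[OF \<rho>[OF that] Fi[OF mF]])
  define Q where "Q j f y = (moll (\<rho> j) (cc j) f y - f y)\<^sup>2" for j f y
  have Q0: "0 \<le> Q j f y" for j f y by (simp add: Q_def)
  have Qi: "integrable (lebesgue_on \<Omega>) (Q j f)" "(LINT y|lebesgue_on \<Omega>. Q j f y) \<le> e'" if "j \<in> J" "f \<in> F" for j f
  proof -
    have "(\<lambda>y. moll (\<rho> j) (cc j) f y - f y) \<in> L2 UNIV"
      by (intro L2_diff moll_L2_bound(1)[OF \<rho>[OF that(1)]] FL Fi that)
    then have i: "integrable lebesgue (Q j f)" by (simp add: Q_def[abs_def] L2_UNIV_real)
    show "integrable (lebesgue_on \<Omega>) (Q j f)" by (rule integral_lebesgue_on_le(1)[OF \<Omega>s i Q0])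
    have "(LINT y|lebesgue. Q j f y) < e'"
      unfolding Q_def using rr(2)[OF that(1)] t(2) by (intro \<delta>1(2)[OF that(2) \<rho>[OF that(1)]]) simp
    then show "(LINT y|lebesgue_on \<Omega>. Q j f y) \<le> e'"
      using integral_lebesgue_on_le(2)[OF \<Omega>s i Q0] by simp
  qed
  define g where "g i y = (\<Sum>j\<in>J. \<zeta> j y * moll (\<rho> j) (cc j) (m i) y)" for i y
  define \<Gamma> where "\<Gamma> i y = (\<Sum>j\<in>J. \<zeta> j y *\<^sub>R D j i y + moll (\<rho> j) (cc j) (m i) y *\<^sub>R Z j y)" for i y
  have gd: "(g i has_derivative (\<lambda>v. \<Gamma> i y \<bullet> v)) (at y)" if "y \<in> K" for i y
  proof -
    have "((\<lambda>y. \<Sum>j\<in>J. \<zeta> j y * moll (\<rho> j) (cc j) (m i) y) has_derivative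
       (\<lambda>v. \<Sum>j\<in>J. \<zeta> j y * (D j i y \<bullet> v) + (Z j y \<bullet> v) * moll (\<rho> j) (cc j) (m i) y)) (at y)"
      by (intro has_derivative_sum has_derivative_mult \<zeta>d Dd that)
    then show ?thesis unfolding g_def[abs_def] \<Gamma>_def by (simp add: inner_sum_left inner_add_left mult.commute)
  qed
  have \<zeta>c: "continuous_on K (\<zeta> j)" if "j \<in> J" for j
    by (rule has_derivative_continuous_on[where f'="\<lambda>y v. Z j y \<bullet> v"]) (rule has_derivative_at_withinI[OF \<zeta>d[OF that]])
  have \<Gamma>c: "continuous_on K (\<Gamma> i)" for i
    unfolding \<Gamma>_def[abs_def]
    by (intro continuous_on_sum continuous_on_add continuous_on_scaleR \<zeta>c Zc continuous_on_subset[OF Dc] continuous_on_subset[OF mc]) auto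
  have mw: "m i y = w y $ i" "M i l y = G i y $ l" if "y \<in> \<Omega>" for i l y
    using that by (auto simp: m_def M_def zero_ext_def)
  have est1: "(g i y - w y $ i)\<^sup>2 \<le> n * (\<Sum>j\<in>J. Q j (m i) y)" if y: "y \<in> \<Omega>" for i y
  proof -
    have yK: "y \<in> K" using y K(2) by blast
    have "g i y - w y $ i = g i y - (\<Sum>j\<in>J. \<zeta> j y) * m i y" using \<zeta>1[OF yK] mw[OF y] by simp
    also have "\<dots> = (\<Sum>j\<in>J. \<zeta> j y * (moll (\<rho> j) (cc j) (m i) y - m i y))"
      by (simp add: g_def right_diff_distrib sum_subtractf sum_distrib_right)
    finally have "(g i y - w y $ i)\<^sup>2 \<le> n * (\<Sum>j\<in>J. (\<zeta> j y * (moll (\<rho> j) (cc j) (m i) y - m i y))\<^sup>2)"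
      using norm_sum_square_le[of "\<lambda>j. \<zeta> j y * (moll (\<rho> j) (cc j) (m i) y - m i y)" J] by (simp add: n_def)
    also have "\<dots> \<le> n * (\<Sum>j\<in>J. Q j (m i) y)"
    proof (intro mult_left_mono sum_mono)
      fix j assume j: "j \<in> J"
      have "(\<zeta> j y)\<^sup>2 \<le> 1" using \<zeta>0[OF j yK] \<zeta>le[OF j yK] by (simp add: power_le_one)
      then have "(\<zeta> j y)\<^sup>2 * Q j (m i) y \<le> 1 * Q j (m i) y" by (rule mult_right_mono) (rule Q0)
      then show "(\<zeta> j y * (moll (\<rho> j) (cc j) (m i) y - m i y))\<^sup>2 \<le> Q j (m i) y"
        by (simp add: Q_def power_mult_distrib)
    qed (simp add: n_def)
    finally show ?thesis .
  qed
  have est2: "(norm (\<Gamma> i y - G i y))\<^sup>2 \<le> n * (\<Sum>j\<in>J. 2 * (\<Sum>l\<in>UNIV. Q j (M i l) y) + 2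
      * B\<^sup>2 * Q j (m i) y)" if y: "y \<in> \<Omega>" for i y
  proof -
    have yK: "y \<in> K" using y K(2) by blast
    define a where "a j = \<zeta> j y *\<^sub>R (D j i y - G i y)" for j
    define b where "b j = (moll (\<rho> j) (cc j) (m i) y - m i y) *\<^sub>R Z j y" for j
    \<comment> \<open>Subtracting the gradient and the value costs nothing, because the \<zeta> sum
      to 1 and the \<open>Z\<close> to 0.\<close>
    have "(\<Sum>j\<in>J. a j + b j) = \<Gamma> i y - (\<Sum>j\<in>J. \<zeta> j y) *\<^sub>R G i y - m i y *\<^sub>R (\<Sum>j\<in>J. Z j y)"
      by (simp add: a_def b_def \<Gamma>_def sum.distrib sum_subtractf scaleR_diff_right scaleR_diff_left scaleR_sum_left scaleR_sum_right)
    also have "\<dots> = \<Gamma> i y - G i y" using \<zeta>1[OF yK] Z0[OF yK] by simp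
    finally have "(norm (\<Gamma> i y - G i y))\<^sup>2 \<le> n * (\<Sum>j\<in>J. (norm (a j + b j))\<^sup>2)"
      using norm_sum_square_le[of "\<lambda>j. a j + b j" J] by (simp add: n_def)
    also have "\<dots> \<le> n * (\<Sum>j\<in>J. 2 * (\<Sum>l\<in>UNIV. Q j (M i l) y) + 2 * B\<^sup>2 * Q j (m i) y)"
    proof (intro mult_left_mono sum_mono)
      fix j assume j: "j \<in> J"
      have "(norm (a j))\<^sup>2 \<le> (\<Sum>l\<in>UNIV. Q j (M i l) y)"
      \<comment> \<open>Only where \<zeta> j is nonzero is the kernel's ball known to lie in
        \<Omega>, so that \<open>D\<close> is the mollified weak gradient; elsewhere the term is
        absent.\<close>
      proof (cases "\<zeta> j y = 0")
        case True
        then show ?thesis by (simp add: a_def sum_nonneg Q0)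
      next
        case False
        have Dl: "D j i y $ l = moll (\<rho> j) (cc j) (M i l) y" for l
          unfolding D_def m_def M_def
          using w[of i] by (intro moll_weak_gradient[OF \<Omega>s \<Omega>(2) \<rho>[OF j] sub[OF j yK False]]) (auto simp: has_wgrad_def)
        have "norm (a j) \<le> 1 * norm (D j i y - G i y)"
          unfolding a_def norm_scaleR using \<zeta>0[OF j yK] \<zeta>le[OF j yK] by (intro mult_right_mono) auto
        then have "(norm (a j))\<^sup>2 \<le> (norm (D j i y - G i y))\<^sup>2" by (intro power_mono) auto
        also have "\<dots> = (\<Sum>l\<in>UNIV. Q j (M i l) y)"
          by (simp add: norm_vec_def L2_set_def sum_nonneg Q_def Dl mw[OF y])
        finally show ?thesis .
      qed
      moreover have "(norm (b j))\<^sup>2 \<le> B\<^sup>2 * Q j (m i) y"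
      proof -
        have "(norm (b j))\<^sup>2 = (norm (Z j y))\<^sup>2 * Q j (m i) y" by (simp add: b_def Q_def power_mult_distrib mult.commute)
        also have "\<dots> \<le> B\<^sup>2 * Q j (m i) y" using B(2)[OF j yK] Q0 by (intro mult_right_mono power_mono) auto
        finally show ?thesis .
      qed
      ultimately show "(norm (a j + b j))\<^sup>2 \<le> 2 * (\<Sum>l\<in>UNIV. Q j (M i l) y) + 2 * B\<^sup>2 * Q j (m i) y"
        using norm_add_square_le[of "a j" "b j"] by linarith
    qed (simp add: n_def)
    finally show ?thesis .
  qed
  have n0: "n \<ge> 0" by (simp add: n_def)
  have I1: "(LINT x|lebesgue_on \<Omega>. (g i x - w x $ i)\<^sup>2) \<le> e" for i
  proof -
    have "(LINT x|lebesgue_on \<Omega>. (g i x - w x $ i)\<^sup>2) \<le> (LINT x|lebesgue_on \<Omega>. n * (\<Sum>j\<in>J. Q j (m i) x))"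
      using Qi(1)[OF _ mF] est1 n0 Q0 by (intro integral_mono') (auto simp: space_restrict_space sum_nonneg)
    also have "\<dots> = n * (\<Sum>j\<in>J. LINT x|lebesgue_on \<Omega>. Q j (m i) x)" using Qi(1)[OF _ mF] by simp
    also have "\<dots> \<le> n * (\<Sum>j\<in>J. e')" using Qi(2)[OF _ mF] n0 by (intro mult_left_mono sum_mono) auto
    also have "\<dots> = (n * n) * e'" by (simp add: n_def)
    also have "\<dots> \<le> A * e'" using e' n0 by (intro mult_right_mono) (auto simp: A_def)
    also have "\<dots> = e" using A by (simp add: e'_def)
    finally show ?thesis .
  qed
  have I2: "(LINT x|lebesgue_on \<Omega>. (norm (\<Gamma> i x - G i x))\<^sup>2) \<le> e" for i
  proof -
    have "(LINT x|lebesgue_on \<Omega>. (norm (\<Gamma> i x - G i x))\<^sup>2)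
        \<le> (LINT x|lebesgue_on \<Omega>. n * (\<Sum>j\<in>J. 2 * (\<Sum>l\<in>UNIV. Q j (M i l) x) + 2 * B\<^sup>2 * Q j (m i) x))"
      using Qi(1)[OF _ mF] Qi(1)[OF _ MF] est2 n0 Q0
      by (intro integral_mono') (auto simp: space_restrict_space intro!: sum_nonneg mult_nonneg_nonneg add_nonneg_nonneg
         Bochner_Integration.integrable_sum integrable_mult_right Bochner_Integration.integrable_add)
    also have "\<dots> = n * (\<Sum>j\<in>J. 2 * (\<Sum>l\<in>UNIV. LINT x|lebesgue_on \<Omega>. Q j (M i l) x) + 2 *
        B\<^sup>2 * (LINT x|lebesgue_on \<Omega>. Q j (m i) x))"
      using Qi(1)[OF _ mF] Qi(1)[OF _ MF] by simp
    also have "\<dots> \<le> n * (\<Sum>j\<in>J. 2 * (\<Sum>l\<in>(UNIV::'d set). e') + 2 * B\<^sup>2 * e')"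
      using Qi(2)[OF _ mF] Qi(2)[OF _ MF] n0 by (intro mult_left_mono sum_mono add_mono) auto
    also have "\<dots> = (2 * n * n * (B\<^sup>2 + CARD('d))) * e'" by (simp add: n_def algebra_simps)
    also have "\<dots> \<le> A * e'" using e' n0 by (intro mult_right_mono) (auto simp: A_def)
    also have "\<dots> = e" using A by (simp add: e'_def)
    finally show ?thesis .
  qed
  have cons: "N (\<chi> i. g i y) \<le> \<alpha> y + e" if y: "y \<in> K" for y
  proof -
    have "(\<chi> i. g i y) = (\<Sum>j\<in>J. \<zeta> j y *\<^sub>R (\<chi> i. moll (\<rho> j) (cc j) (m i) y))"
      by (simp add: vec_eq_iff g_def)
    then have "N (\<chi> i. g i y) \<le> (\<Sum>j\<in>J. N (\<zeta> j y *\<^sub>R (\<chi> i. moll (\<rho> j) (cc j) (m i) y)))"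
      by (simp only: seminorm_sum_le[OF N])
    also have "\<dots> = (\<Sum>j\<in>J. \<zeta> j y * N (\<chi> i. moll (\<rho> j) (cc j) (m i) y))"
      using N \<zeta>0[OF _ y] unfolding seminorm_on_vec_def by (intro sum.cong) auto
    also have "\<dots> \<le> (\<Sum>j\<in>J. \<zeta> j y * (\<alpha> y + e))"
    proof (rule sum_mono)
      fix j assume j: "j \<in> J"
      show "\<zeta> j y * N (\<chi> i. moll (\<rho> j) (cc j) (m i) y) \<le> \<zeta> j y * (\<alpha> y + e)"
      proof (cases "\<zeta> j y = 0")
        case False
        have "N (\<chi> i. moll (\<rho> j) (cc j) (m i) y) \<le> \<alpha> y + e"
          unfolding m_def
        proof (rule mollified_constraint[OF N \<Omega>s \<Omega>(2) \<rho>[OF j] sub[OF j y False] wL])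
          \<comment> \<open>Points of the ball are closer than \<delta>2 to y, so \<alpha> y + e
            dominates \<alpha> on all of it.\<close>
          show "AE s in lebesgue_on \<Omega>. s \<in> cball (y + cc j) (rr j) \<longrightarrow> N (w s) \<le> \<alpha> y + e"
            using con
          proof eventually_elim
            case (elim s)
            show ?case
            proof
              assume s: "s \<in> cball (y + cc j) (rr j)"
              then have "s \<in> K" using sub[OF j y False] K(2) by blast
              have "dist s y \<le> dist s (y + cc j) + dist (y + cc j) y" by (rule dist_triangle)
              then have "dist s y < \<delta>2" using s rr(2)[OF j] t(3) by (simp add: dist_norm norm_minus_commute)
              then show "N (w s) \<le> \<alpha> y + e" using \<delta>2(2)[OF y \<open>s \<in> K\<close>] elim by (simp
                  add: dist_real_def abs_less_iff)
            qed
          qed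
        qed
        then show ?thesis using \<zeta>0[OF j y] by (rule mult_left_mono)
      qed simp
    qed
    also have "\<dots> = \<alpha> y + e" using \<zeta>1[OF y] by (simp add: sum_distrib_right[symmetric])
    finally show ?thesis .
  qed
  show ?thesis
    by (intro exI[of _ g] exI[of _ \<Gamma>]) (use gd \<Gamma>c I1 I2 cons in \<open>auto simp: K_def\<close>)
qed


subsection \<open>Weak limits of finite element functions\<close>

text \<open>\<^const>\<open>weakly_converges\<close> tests with functionals on the whole function space, so integral
  functionals, which are linear only on \<open>V\<close>, have to be extended.\<close>

lemma linear_functional_extension:
  fixes \<phi> :: "'v::real_vector \<Rightarrow> real"
  assumes V: "subspace V"
    and add: "\<And>u v. u \<in> V \<Longrightarrow> v \<in> V \<Longrightarrow> \<phi> (u + v) = \<phi> u + \<phi> v"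
    and sc: "\<And>c v. v \<in> V \<Longrightarrow> \<phi> (c *\<^sub>R v) = c * \<phi> v"
  shows "\<exists>\<psi>. linear \<psi> \<and> (\<forall>v\<in>V. \<psi> v = \<phi> v)"
proof -
  have "linear (\<lambda>x::'v. x)" by (rule linear_ident)
  \<comment> \<open>A linear left inverse of the identity on V with range in V is a linear
    projection onto V.\<close>
  then obtain P :: "'v \<Rightarrow> 'v" where P: "range P \<subseteq> V" "linear P" "\<And>v. v \<in> V \<Longrightarrow> P v = v"
    using linear_exists_left_inverse_on[of "\<lambda>x::'v. x" V] V by auto
  have "linear (\<lambda>x. \<phi> (P x))"
  proof (rule linearI)
    have PV: "P x \<in> V" for x using P(1) by auto
    show "\<phi> (P (x + y)) = \<phi> (P x) + \<phi> (P y)" for x y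
      using add[OF PV PV] by (simp add: linear_add[OF P(2)])
    show "\<phi> (P (c *\<^sub>R x)) = c *\<^sub>R \<phi> (P x)" for c x
      using sc[OF PV] by (simp add: linear_scale[OF P(2)])
  qed
  then show ?thesis using P(3) by (intro exI[of _ "\<lambda>x. \<phi> (P x)"]) simp
qed

lemma weakly_convergesD:
  fixes \<phi> :: "'v::real_vector \<Rightarrow> real"
  assumes "weakly_converges V nrm u w" and V: "subspace V" and "\<And>k. u k \<in> V" "w \<in> V"
    and "\<And>u v. u \<in> V \<Longrightarrow> v \<in> V \<Longrightarrow> \<phi> (u + v) = \<phi> u + \<phi> v"
    and "\<And>c v. v \<in> V \<Longrightarrow> \<phi> (c *\<^sub>R v) = c * \<phi> v"
    and bd: "\<And>v. v \<in> V \<Longrightarrow> \<bar>\<phi> v\<bar> \<le> C * nrm v"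
  shows "(\<lambda>k. \<phi> (u k)) \<longlonglongrightarrow> \<phi> w"
proof -
  obtain \<psi> where \<psi>: "linear \<psi>" "\<And>v. v \<in> V \<Longrightarrow> \<psi> v = \<phi> v"
    using linear_functional_extension[OF V, of \<phi>] assms(5,6) by auto
  have "\<forall>v\<in>V. \<bar>\<psi> v\<bar> \<le> C * nrm v" using bd \<psi>(2) by simp
  then have "(\<lambda>k. \<psi> (u k)) \<longlonglongrightarrow> \<psi> w"
    using assms(1) \<psi>(1) unfolding weakly_converges_def by blast
  then show ?thesis using \<psi>(2) assms(3,4) by simp
qed

text \<open>One of the two signs prevents cancellation; this is the choice made by \<sigma> in the
  next construction.\<close>

lemma max_abs_add_diff: "\<bar>y\<bar> \<le> \<bar>x + y\<bar> \<or> \<bar>y\<bar> \<le> \<bar>x - (y::real)\<bar>"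
  by linarith

text \<open>After Sokal: along indices whose \<open>L\<^sup>1\<close> norms exceed \<open>4\<^sup>j\<close>, the test function
  \<open>\<Sum>j. \<plusminus>3\<^sup>-\<^sup>j sgn (F j)\<close> with suitably chosen signs has unbounded integrals. Its values are bounded
  by \<open>3/2\<close>, hence the bound \<open>2\<close> in the hypothesis.\<close>

lemma uniform_boundedness_L1:
  fixes f :: "nat \<Rightarrow> 'a \<Rightarrow> real"
  assumes f: "\<And>k. integrable M (f k)"
    and bd: "\<And>\<psi>. \<psi> \<in> borel_measurable M \<Longrightarrow> (\<forall>x. \<bar>\<psi> x\<bar> \<le> 2)
        \<Longrightarrow> \<exists>B. \<forall>k. \<bar>LINT x|M. f k x * \<psi> x\<bar> \<le> B"
  shows "\<exists>B. \<forall>k. (LINT x|M. \<bar>f k x\<bar>) \<le> B"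
proof (rule ccontr)
  assume "\<nexists>B. \<forall>k. (LINT x|M. \<bar>f k x\<bar>) \<le> B"
  then have "\<forall>j. \<exists>k. (4::real) ^ j < (LINT x|M. \<bar>f k x\<bar>)" by (meson not_le)
  then obtain \<kappa> where \<kappa>: "\<And>j. (4::real) ^ j < (LINT x|M. \<bar>f (\<kappa> j) x\<bar>)" by metis
  define F where "F j = f (\<kappa> j)" for j
  define a where "a j = (LINT x|M. \<bar>F j x\<bar>)" for j
  have a: "4 ^ j < a j" for j using \<kappa> by (simp add: a_def F_def)
  have a0: "0 < a j" for j using a[of j] by (smt (verit) zero_less_power)
  have Fi: "integrable M (F j)" and Fm: "F j \<in> borel_measurable M" for j using f by (auto simp: F_def)
  define T where "T j \<psi> = (LINT x|M. F j x * \<psi> x)" for j \<psi>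
  have Ti: "integrable M (\<lambda>x. F j x * \<psi> x)" if "\<psi> \<in> borel_measurable M" "\<And>x. \<bar>\<psi> x\<bar> \<le> B" for j \<psi> B
  proof (rule Bochner_Integration.integrable_bound)
    show "integrable M (\<lambda>x. B * \<bar>F j x\<bar>)" using Fi by simp
    show "(\<lambda>x. F j x * \<psi> x) \<in> borel_measurable M" using Fm that(1) by measurable
    have "0 \<le> B" using that(2) by (meson abs_ge_zero order_trans)
    then show "AE x in M. norm (F j x * \<psi> x) \<le> norm (B * \<bar>F j x\<bar>)"
      using that(2) by (intro AE_I2) (simp add: abs_mult mult.commute mult_right_mono)
  qed
  \<comment> \<open>The sign for which adding the j-th term to the partial sum \<open>p\<close>
    gives an integral of at least a j 3^-j in absolute value.\<close>
  define \<sigma> where "\<sigma> j p = (if a j * (1/3) ^ j \<le> \<bar>T j p + a j * (1/3) ^ j\<bar> then 1 else - 1 :: real)" for j p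
  define P where "P = rec_nat (\<lambda>x. 0) (\<lambda>j p x. p x + \<sigma> j p * (1/3) ^ j * sgn (F j x))"
  have P0: "P 0 = (\<lambda>x. 0)" and PS: "P (Suc j) = (\<lambda>x. P j x + \<sigma> j (P j) * (1/3) ^ j * sgn (F j x))" for j
    by (simp_all add: P_def)
  define c where "c j x = \<sigma> j (P j) * (1/3) ^ j * sgn (F j x)" for j x
  have cb: "\<bar>c j x\<bar> \<le> (1/3) ^ j" for j x by (auto simp: c_def \<sigma>_def abs_mult abs_sgn_eq)
  have cm: "c j \<in> borel_measurable M" for j unfolding c_def[abs_def] using Fm by measurable
  have Pc: "P n x = (\<Sum>j<n. c j x)" for n x
    by (induction n) (simp_all add: P0 PS c_def)
  have Pm: "P n \<in> borel_measurable M" for n unfolding Pc[abs_def] using cm by measurable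
  have geo: "summable (\<lambda>j. (1/3::real) ^ j)" by (rule summable_geometric) simp
  have cs: "summable (\<lambda>j. c j x)" for x
    by (rule summable_comparison_test'[OF geo, of 0]) (use cb in auto)
  define \<psi> where "\<psi> x = (\<Sum>j. c j x)" for x
  have \<psi>m: "\<psi> \<in> borel_measurable M" unfolding \<psi>_def[abs_def] using cm by (rule borel_measurable_suminf)
  have tail: "\<bar>\<psi> x - P n x\<bar> \<le> (1/3) ^ n * (3/2)" for x n
  proof -
    have "\<psi> x - P n x = (\<Sum>i. c (i + n) x)"
      unfolding \<psi>_def Pc using suminf_minus_initial_segment[OF cs] by simp
    also have "\<bar>\<dots>\<bar> \<le> (\<Sum>i. (1/3) ^ (i + n))"
    proof -
      have "norm (\<Sum>i. c (i + n) x) \<le> (\<Sum>i. (1/3) ^ (i + n))"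
        by (rule norm_suminf_le) (use cb summable_ignore_initial_segment[OF geo] in auto)
      then show ?thesis by simp
    qed
    also have "\<dots> = (1/3) ^ n * (3/2)"
      by (simp add: power_add suminf_mult2[OF geo, symmetric] suminf_geometric)
    finally show ?thesis .
  qed
  have \<psi>b: "\<bar>\<psi> x\<bar> \<le> 2" for x using tail[of x 0] by (simp add: P0)
  have Pb: "\<bar>P n x\<bar> \<le> 4" for n x
  proof -
    have "(1/3::real) ^ n * (3/2) \<le> 1 * (3/2)" by (intro mult_right_mono) (auto simp: power_le_one)
    then show ?thesis using tail[of x n] \<psi>b[of x] by linarith
  qed
  have sg: "(LINT x|M. F j x * sgn (F j x)) = a j" for j unfolding a_def by (simp add: abs_sgn)
  have si: "integrable M (\<lambda>x. F j x * sgn (F j x))" for j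
    by (rule Ti[of _ 1]) (use Fm in \<open>auto simp: abs_sgn_eq\<close>)
  have TS: "T j (P (Suc j)) = T j (P j) + \<sigma> j (P j) * (a j * (1/3) ^ j)" for j
  proof -
    have "T j (P (Suc j)) = (LINT x|M. F j x * P j x + (\<sigma> j (P j) * (1/3) ^ j) * (F j x * sgn (F j x)))"
      unfolding T_def PS by (intro Bochner_Integration.integral_cong refl) (simp add: algebra_simps)
    also have "\<dots> = T j (P j) + (\<sigma> j (P j) * (1/3) ^ j) * a j"
      using Ti[OF Pm Pb] si by (simp add: T_def sg)
    finally show ?thesis by simp
  qed
  have low: "a j * (1/3) ^ j \<le> \<bar>T j (P (Suc j))\<bar>" for j
    using max_abs_add_diff[of "a j * (1/3) ^ j" "T j (P j)"] a0[of j] unfolding TS by (auto simp: \<sigma>_def)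
  \<comment> \<open>The terms after the j-th add up to at most 3^-(j+1) * 3/2 = 3^-j / 2, half of
    what the j-th achieves. At least a j 3^-j / 2 > (4/3)^j / 2 survives, which is
    unbounded.\<close>
  have up: "\<bar>T j \<psi> - T j (P (Suc j))\<bar> \<le> a j * (1/3) ^ j / 2" for j
  proof -
    have "T j \<psi> - T j (P (Suc j)) = (LINT x|M. F j x * \<psi> x - F j x * P (Suc j) x)"
      using Ti[OF \<psi>m \<psi>b] Ti[OF Pm Pb] by (simp add: T_def)
    also have "\<bar>\<dots>\<bar> \<le> (LINT x|M. \<bar>F j x\<bar> * ((1/3) ^ j / 2))"
    proof -
      have "norm (LINT x|M. F j x * \<psi> x - F j x * P (Suc j) x) \<le> (LINT x|M. \<bar>F j x\<bar> * ((1/3) ^ j / 2))"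
      proof (rule order_trans[OF integral_norm_bound integral_mono])
        show "integrable M (\<lambda>x. norm (F j x * \<psi> x - F j x * P (Suc j) x))" using Ti[OF \<psi>m \<psi>b] Ti[OF Pm Pb] by simp
        show "integrable M (\<lambda>x. \<bar>F j x\<bar> * ((1/3) ^ j / 2))" using Fi by simp
        fix x
        have "\<bar>\<psi> x - P (Suc j) x\<bar> \<le> (1/3) ^ j / 2" using tail[of x "Suc j"] by simp
        then have "\<bar>F j x\<bar> * \<bar>\<psi> x - P (Suc j) x\<bar> \<le> \<bar>F j x\<bar> * ((1/3) ^ j / 2)" by (intro mult_left_mono) auto
        then show "norm (F j x * \<psi> x - F j x * P (Suc j) x) \<le> \<bar>F j x\<bar> * ((1/3) ^ j / 2)"
          by (simp add: right_diff_distrib[symmetric] abs_mult)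
      qed
      then show ?thesis by simp
    qed
    also have "\<dots> = a j * (1/3) ^ j / 2" by (simp add: a_def)
    finally show ?thesis .
  qed
  obtain B where B: "\<And>k. \<bar>LINT x|M. f k x * \<psi> x\<bar> \<le> B" using bd[OF \<psi>m] \<psi>b by blast
  have "(4/3) ^ j / 2 \<le> B" for j :: nat
  proof -
    have "a j * (1/3) ^ j / 2 \<le> \<bar>T j \<psi>\<bar>" using low[of j] up[of j] by linarith
    also have "\<dots> \<le> B" unfolding T_def F_def by (rule B)
    finally have "a j * (1/3) ^ j / 2 \<le> B" .
    moreover have "4 ^ j * (1/3) ^ j \<le> a j * (1/3) ^ j" using a[of j] by (intro mult_right_mono) auto
    moreover have "(4/3::real) ^ j = 4 ^ j * (1/3) ^ j" by (simp add: power_mult_distrib[symmetric])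
    ultimately show ?thesis by linarith
  qed
  moreover obtain j where "2 * B < (4/3::real) ^ j" using real_arch_pow[of "4/3"] by auto
  ultimately show False by (smt (verit) field_sum_of_halves)
qed

lemma H1_norm_le_vec:
  "H1_norm \<Omega> (\<lambda>x. v x $ i) \<le> H1_vec_norm \<Omega> v"
proof -
  have "(H1_norm \<Omega> (\<lambda>x. v x $ i))\<^sup>2 \<le> (\<Sum>i\<in>UNIV. (H1_norm \<Omega> (\<lambda>x. v x $ i))\<^sup>2)"
    by (rule member_le_sum) auto
  then show ?thesis unfolding H1_vec_norm_def by (rule real_le_rsqrt)
qed

lemma H1_norm_nonneg: "0 \<le> H1_norm \<Omega> u"
  by (simp add: H1_norm_def)

text \<open>Cauchy-Schwarz: integration of a component or of a partial derivative against an L2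
  weight is continuous for the H1 norm, hence admissible in \<open>weakly_converges\<close>.\<close>

lemma H1_dual_bounds:
  fixes \<Omega> :: "(real^'d::finite) set"
  assumes \<Omega>: "open \<Omega>" "bounded \<Omega>" and u: "has_wgrad \<Omega> u G" and \<psi>: "\<psi> \<in> L2 \<Omega>"
  shows "\<bar>LINT x|lebesgue_on \<Omega>. u x * \<psi> x\<bar> \<le> sqrt (LINT x|lebesgue_on \<Omega>. (\<psi> x)\<^sup>2) * H1_norm \<Omega> u"
    and "\<bar>LINT x|lebesgue_on \<Omega>. G x $ l * \<psi> x\<bar> \<le> sqrt (LINT x|lebesgue_on \<Omega>. (\<psi>
        x)\<^sup>2) * H1_norm \<Omega> u"
proof -
  have uL: "u \<in> L2 \<Omega>" and GL: "G \<in> L2 \<Omega>" using u by (auto simp: has_wgrad_def)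
  have gen: "\<bar>LINT x|lebesgue_on \<Omega>. f x * \<psi> x\<bar> \<le> sqrt (LINT x|lebesgue_on \<Omega>. (\<psi>
      x)\<^sup>2) * H1_norm \<Omega> u"
    if f: "f \<in> L2 \<Omega>" "(LINT x|lebesgue_on \<Omega>. (f x)\<^sup>2) \<le> (H1_norm \<Omega> u)\<^sup>2" for f
  proof -
    define S where "S = (LINT x|lebesgue_on \<Omega>. (\<psi> x)\<^sup>2)"
    have S0: "0 \<le> S" by (simp add: S_def)
    have "(LINT x|lebesgue_on \<Omega>. f x * \<psi> x)\<^sup>2 \<le> (LINT x|lebesgue_on \<Omega>. (f x)\<^sup>2) * S"
      unfolding S_def by (rule L2_Cauchy_Schwarz[OF f(1) \<psi>])
    also have "\<dots> \<le> (H1_norm \<Omega> u)\<^sup>2 * S" using f(2) S0 by (rule mult_right_mono)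
    also have "\<dots> = (sqrt S * H1_norm \<Omega> u)\<^sup>2" using S0 by (simp add: power_mult_distrib)
    finally have "\<bar>LINT x|lebesgue_on \<Omega>. f x * \<psi> x\<bar> \<le> \<bar>sqrt S * H1_norm \<Omega> u\<bar>"
      by (simp only: abs_le_square_iff)
    moreover have "0 \<le> sqrt S * H1_norm \<Omega> u" using H1_norm_nonneg[of \<Omega> u] S0 by simp
    ultimately show ?thesis by (simp add: S_def)
  qed
  have sq: "(H1_norm \<Omega> u)\<^sup>2 = (LINT x|lebesgue_on \<Omega>. (u x)\<^sup>2) + (LINT x|lebesgue_on \<Omega>. (norm (G x))\<^sup>2)"
    by (rule H1_norm_square[OF \<Omega> u])
  show "\<bar>LINT x|lebesgue_on \<Omega>. u x * \<psi> x\<bar> \<le> sqrt (LINT x|lebesgue_on \<Omega>. (\<psi> x)\<^sup>2) * H1_norm \<Omega> u"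
    by (rule gen[OF uL]) (simp add: sq)
  have "(LINT x|lebesgue_on \<Omega>. (G x $ l)\<^sup>2) \<le> (LINT x|lebesgue_on \<Omega>. (norm (G x))\<^sup>2)"
    by (rule integral_mono'[OF L2D(2)[OF GL]])
      (auto simp: abs_le_square_iff[symmetric] component_le_norm_cart)
  moreover have "0 \<le> (LINT x|lebesgue_on \<Omega>. (u x)\<^sup>2)" by simp
  ultimately have "(LINT x|lebesgue_on \<Omega>. (G x $ l)\<^sup>2) \<le> (H1_norm \<Omega> u)\<^sup>2" unfolding sq by linarith
  then show "\<bar>LINT x|lebesgue_on \<Omega>. G x $ l * \<psi> x\<bar> \<le> sqrt (LINT x|lebesgue_on \<Omega>.
      (\<psi> x)\<^sup>2) * H1_norm \<Omega> u"
    by (rule gen[OF L2_component[OF GL]])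
qed

lemma weak_limit_functionals:
  fixes \<Omega> :: "(real^'d::finite) set" and u :: "nat \<Rightarrow> real^'d \<Rightarrow> real^'n::finite"
  assumes \<Omega>: "open \<Omega>" "bounded \<Omega>"
    and wc: "weakly_converges (H1_vec \<Omega>) (H1_vec_norm \<Omega>) u w" and V: "\<And>k. u k \<in> H1_vec \<Omega>" "w \<in> H1_vec \<Omega>"
    and \<psi>: "\<psi> \<in> L2 \<Omega>"
  shows "(\<lambda>k. LINT x|lebesgue_on \<Omega>. u k x $ i * \<psi> x) \<longlonglongrightarrow> (LINT x|lebesgue_on \<Omega>. w x $ i * \<psi> x)"
    and "(\<lambda>k. LINT x|lebesgue_on \<Omega>. weak_gradient \<Omega> (\<lambda>x. u k x $ i) x $ l * \<psi> x) \<longlonglongrightarrow>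
         (LINT x|lebesgue_on \<Omega>. weak_gradient \<Omega> (\<lambda>x. w x $ i) x $ l * \<psi> x)"
proof -
  have \<Omega>s: "\<Omega> \<in> sets lebesgue" using \<Omega> by (simp add: borel_open sets_completionI_sets)
  have sub: "subspace (H1_vec \<Omega> :: (real^'d \<Rightarrow> real^'n) set)" by (rule H1_vec_subspace[OF \<Omega>(2) \<Omega>s])
  define g where "g v = weak_gradient \<Omega> (\<lambda>x. v x $ i)" for v :: "real^'d \<Rightarrow> real^'n"
  have hw: "has_wgrad \<Omega> (\<lambda>x. v x $ i) (g v)" if "v \<in> H1_vec \<Omega>" for v
    unfolding g_def by (rule weak_gradient_has_wgrad) (use that in \<open>auto simp: H1_vec_def\<close>)
  define C where "C = sqrt (LINT x|lebesgue_on \<Omega>. (\<psi> x)\<^sup>2)"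
  have C0: "0 \<le> C" by (simp add: C_def)
  have bd: "C * H1_norm \<Omega> (\<lambda>x. v x $ i) \<le> C * H1_vec_norm \<Omega> v" for v :: "real^'d \<Rightarrow> real^'n"
    using H1_norm_le_vec C0 by (intro mult_left_mono)
  have int: "integrable (lebesgue_on \<Omega>) (\<lambda>x. v x $ i * \<psi> x)" "integrable (lebesgue_on \<Omega>)
      (\<lambda>x. g v x $ l * \<psi> x)"
    if "v \<in> H1_vec \<Omega>" for v
    using hw[OF that] \<psi> by (auto simp: has_wgrad_def intro!: L2_integrable_mult L2_component)
  show "(\<lambda>k. LINT x|lebesgue_on \<Omega>. u k x $ i * \<psi> x) \<longlonglongrightarrow> (LINT x|lebesgue_on \<Omega>. w x $ i * \<psi> x)"
  proof (rule weakly_convergesD[where \<phi>="\<lambda>v. LINT x|lebesgue_on \<Omega>. v x $ i * \<psi> x" and C=C, OF wc sub V])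
    fix v z :: "real^'d \<Rightarrow> real^'n" and c :: real assume v: "v \<in> H1_vec \<Omega>"
    show "(LINT x|lebesgue_on \<Omega>. (c *\<^sub>R v) x $ i * \<psi> x) = c * (LINT x|lebesgue_on \<Omega>. v x $ i * \<psi> x)"
      by (simp add: scaleR_fun_def mult.assoc)
    show "\<bar>LINT x|lebesgue_on \<Omega>. v x $ i * \<psi> x\<bar> \<le> C * H1_vec_norm \<Omega> v"
      using H1_dual_bounds(1)[OF \<Omega> hw[OF v] \<psi>] bd[of v] unfolding C_def by linarith
    assume z: "z \<in> H1_vec \<Omega>"
    show "(LINT x|lebesgue_on \<Omega>. (v + z) x $ i * \<psi> x) = (LINT x|lebesgue_on \<Omega>. v x $ i * \<psi> x) +
        (LINT x|lebesgue_on \<Omega>. z x $ i * \<psi> x)"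
      using int(1)[OF v] int(1)[OF z] by (simp add: distrib_right)
  qed
  \<comment> \<open>\<open>weak_gradient\<close> is a choice, so it is additive and homogeneous only
    almost everywhere; linearity has to be established for the integrals.\<close>
  have eqI: "(LINT x|lebesgue_on \<Omega>. g v x $ l * \<psi> x) = (LINT x|lebesgue_on \<Omega>. G x $ l * \<psi> x)"
    if v: "v \<in> H1_vec \<Omega>" and G: "has_wgrad \<Omega> (\<lambda>x. v x $ i) G" for v G
  proof (rule integral_cong_AE)
    show "AE x in lebesgue_on \<Omega>. g v x $ l * \<psi> x = G x $ l * \<psi> x"
      using has_wgrad_unique[OF \<Omega> hw[OF v] G] by eventually_elim simp
    show "(\<lambda>x. g v x $ l * \<psi> x) \<in> borel_measurable (lebesgue_on \<Omega>)" using int(2)[OF v] by auto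
    show "(\<lambda>x. G x $ l * \<psi> x) \<in> borel_measurable (lebesgue_on \<Omega>)"
      using L2_integrable_mult[OF L2_component \<psi>] G by (auto simp: has_wgrad_def)
  qed
  have "(\<lambda>k. LINT x|lebesgue_on \<Omega>. g (u k) x $ l * \<psi> x) \<longlonglongrightarrow> (LINT
      x|lebesgue_on \<Omega>. g w x $ l * \<psi> x)"
  proof (rule weakly_convergesD[where \<phi>="\<lambda>v. LINT x|lebesgue_on \<Omega>. g v x $ l * \<psi> x" and C=C, OF wc sub V])
    fix v z :: "real^'d \<Rightarrow> real^'n" and c :: real assume v: "v \<in> H1_vec \<Omega>"
    have "has_wgrad \<Omega> (\<lambda>x. (c *\<^sub>R v) x $ i) (\<lambda>x. c *\<^sub>R g v x)"
      using has_wgrad_lincomb[OF \<Omega>(2) \<Omega>s hw[OF v] has_wgrad_zero, of c 0] by (simp add: scaleR_fun_def)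
    from eqI[OF subspace_scale[OF sub v] this]
    show "(LINT x|lebesgue_on \<Omega>. g (c *\<^sub>R v) x $ l * \<psi> x) = c * (LINT x|lebesgue_on \<Omega>. g v x $ l * \<psi> x)"
      by (simp add: mult.assoc)
    show "\<bar>LINT x|lebesgue_on \<Omega>. g v x $ l * \<psi> x\<bar> \<le> C * H1_vec_norm \<Omega> v"
      using H1_dual_bounds(2)[OF \<Omega> hw[OF v] \<psi>, of l] bd[of v] unfolding C_def by linarith
    assume z: "z \<in> H1_vec \<Omega>"
    have "has_wgrad \<Omega> (\<lambda>x. (v + z) x $ i) (\<lambda>x. g v x + g z x)"
      using has_wgrad_lincomb[OF \<Omega>(2) \<Omega>s hw[OF v] hw[OF z], of 1 1] by simp
    note eq = eqI[OF subspace_add[OF sub v z] this]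
    have "(LINT x|lebesgue_on \<Omega>. (g v x + g z x) $ l * \<psi> x) = (LINT x|lebesgue_on \<Omega>. g v x $ l *
        \<psi> x) + (LINT x|lebesgue_on \<Omega>. g z x $ l * \<psi> x)"
      using int(2)[OF v] int(2)[OF z] by (simp add: distrib_right)
    with eq show "(LINT x|lebesgue_on \<Omega>. g (v + z) x $ l * \<psi> x) = (LINT x|lebesgue_on \<Omega>. g v x $ l *
        \<psi> x) + (LINT x|lebesgue_on \<Omega>. g z x $ l * \<psi> x)"
      by (simp only:)
  qed
  then show "(\<lambda>k. LINT x|lebesgue_on \<Omega>. weak_gradient \<Omega> (\<lambda>x. u k x $ i) x $ l * \<psi> x) \<longlonglongrightarrow>
         (LINT x|lebesgue_on \<Omega>. weak_gradient \<Omega> (\<lambda>x. w x $ i) x $ l * \<psi> x)"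
    unfolding g_def .
qed

lemma AE_nonneg_of_integrals:
  fixes f :: "'a \<Rightarrow> real"
  assumes f: "integrable M f"
    and nn: "\<And>\<psi>. \<psi> \<in> borel_measurable M \<Longrightarrow> (\<And>x. 0 \<le> \<psi> x \<and> \<psi> x
        \<le> 1) \<Longrightarrow> 0 \<le> (LINT x|M. f x * \<psi> x)"
  shows "AE x in M. 0 \<le> f x"
proof -
  have fm: "f \<in> borel_measurable M" using f by auto
  \<comment> \<open>Testing with the indicator of the set where \<open>f\<close> is
    negative.\<close>
  define \<psi> where "\<psi> x = (if f x < 0 then 1 else 0 :: real)" for x
  have \<psi>m: "\<psi> \<in> borel_measurable M" unfolding \<psi>_def[abs_def] using fm by measurable
  have i: "integrable M (\<lambda>x. - (f x * \<psi> x))"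
    by (rule Bochner_Integration.integrable_bound[OF f]) (use fm \<psi>m in \<open>auto simp: \<psi>_def\<close>)
  have "0 \<le> (LINT x|M. f x * \<psi> x)" by (rule nn[OF \<psi>m]) (simp add: \<psi>_def)
  moreover have "0 \<le> (LINT x|M. - (f x * \<psi> x))" by (intro integral_nonneg_AE AE_I2) (auto simp: \<psi>_def)
  ultimately have "(LINT x|M. - (f x * \<psi> x)) = 0" by simp
  moreover have "AE x in M. 0 \<le> - (f x * \<psi> x)" by (intro AE_I2) (auto simp: \<psi>_def)
  ultimately have "AE x in M. - (f x * \<psi> x) = 0"
    using integral_nonneg_eq_0_iff_AE[OF i] by blast
  then show ?thesis by eventually_elim (auto simp: \<psi>_def split: if_splits)
qed

text \<open>The exceptional null set may depend on \<open>z\<close>, and there are uncountably many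
  \<open>z\<close>. The violated half-spaces are open, so by Lindeloef countably many of them have
  the same union.\<close>

lemma AE_dual_cone:
  fixes w :: "'a \<Rightarrow> real^'n::finite"
  assumes N: "seminorm_on_vec N" and dual: "\<And>z. z \<in> dual_cone N \<Longrightarrow> AE x in M. 0 \<le> z \<bullet> (w x, \<alpha> x)"
  shows "AE x in M. N (w x) \<le> \<alpha> x"
proof -
  define F where "F = (\<lambda>z. {y. z \<bullet> y < 0}) ` dual_cone N"
  have "open S" if "S \<in> F" for S using that by (auto simp: F_def open_halfspace_lt)
  then obtain F' where F': "F' \<subseteq> F" "countable F'" "\<Union>F' = \<Union>F" by (rule Lindelof)
  have "AE x in M. \<forall>S\<in>F'. (w x, \<alpha> x) \<notin> S"
  proof (subst AE_ball_countable[OF F'(2)], intro ballI)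
    fix S assume "S \<in> F'"
    then obtain z where z: "z \<in> dual_cone N" "S = {y. z \<bullet> y < 0}" using F'(1) by (auto simp: F_def)
    show "AE x in M. (w x, \<alpha> x) \<notin> S" using dual[OF z(1)] by eventually_elim (simp add: z(2))
  qed
  then show ?thesis
  proof eventually_elim
    case (elim x)
    show ?case
    proof (rule ccontr)
      assume "\<not> N (w x) \<le> \<alpha> x"
      then obtain z where "z \<in> dual_cone N" "z \<bullet> (w x, \<alpha> x) < 0" using dual_cone_separates[OF N, of "\<alpha> x" "w x"] by auto
      then have "(w x, \<alpha> x) \<in> \<Union>F" by (auto simp: F_def)
      with F'(3) elim show False by blast
    qed
  qed
qed

text \<open>For \<open>z\<close> in the dual cone,
  \<open>z \<bullet> (v k \<xi>, \<alpha> \<xi>)\<close> is nonnegative at one point \<xi> of each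
  cell, so inside that cell it is at least minus mesh size times gradient minus the oscillation of
  \<alpha>. Integrated against a weight \<psi>, this is a statement linear in \<open>u k\<close> and
  passes to the weak limit.\<close>

lemma weak_limit_constraint:
  fixes \<Omega> :: "(real^'d::finite) set" and u :: "nat \<Rightarrow> real^'d \<Rightarrow> real^'n::finite"
  assumes \<Omega>: "open \<Omega>" "bounded \<Omega>" "\<Omega> \<noteq> {}" and N: "seminorm_on_vec N"
    and \<alpha>: "continuous_on (closure \<Omega>) \<alpha>"
    and mesh: "\<And>k. conformal_simplicial_mesh \<Omega> (\<T> k)" and h: "(\<lambda>k. mesh_size (\<T> k)) \<longlonglongrightarrow> 0"
    and v: "\<And>k i. (\<lambda>x. v k x $ i) \<in> P1_elements \<Omega> (\<T> k)"
    and con: "\<And>k T. T \<in> \<T> k \<Longrightarrow> \<exists>\<xi>\<in>T. N (v k \<xi>) \<le> \<alpha> \<xi>"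
    and uv: "\<And>k. AE x in lebesgue_on \<Omega>. u k x = v k x"
    and wc: "weakly_converges (H1_vec \<Omega>) (H1_vec_norm \<Omega>) u w" and w: "w \<in> H1_vec \<Omega>"
  shows "AE x in lebesgue_on \<Omega>. N (w x) \<le> \<alpha> x"
proof (rule AE_dual_cone[OF N])
  fix z assume z: "z \<in> dual_cone N"
  let ?M = "lebesgue_on \<Omega>"
  have \<Omega>s: "\<Omega> \<in> sets lebesgue" using \<Omega> by (simp add: borel_open sets_completionI_sets)
  have "\<forall>k i. \<exists>G. has_wgrad \<Omega> (\<lambda>x. v k x $ i) G \<and> (\<forall>T\<in>\<T> k.
      \<forall>x\<in>interior T. \<forall>y\<in>T. v k y $ i = v k x $ i + G x \<bullet> (y - x))"
    using P1_has_wgrad[OF \<Omega>(1,2) mesh v] by blast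
  then obtain G where G: "\<And>k i. has_wgrad \<Omega> (\<lambda>x. v k x $ i) (G k i)"
    "\<And>k i T x y. T \<in> \<T> k \<Longrightarrow> x \<in> interior T \<Longrightarrow> y \<in> T \<Longrightarrow>
        v k y $ i = v k x $ i + G k i x \<bullet> (y - x)"
    by metis
  have Gu: "has_wgrad \<Omega> (\<lambda>x. u k x $ i) (G k i)" for k i
  proof (rule has_wgrad_AE[OF \<Omega>s \<Omega>(2) G(1)])
    show "AE x in ?M. v k x $ i = u k x $ i" using uv[of k] by eventually_elim simp
  qed
  then have uV: "u k \<in> H1_vec \<Omega>" for k unfolding H1_vec_def H1_iff_has_wgrad by blast
  have wL: "(\<lambda>x. w x $ i) \<in> L2 \<Omega>" for i using w by (auto simp: H1_vec_def H1_def)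
  have GL: "G k i \<in> L2 \<Omega>" and uL: "(\<lambda>x. u k x $ i) \<in> L2 \<Omega>" for k i using Gu[of k i] by (auto simp: has_wgrad_def)
  have Gi: "integrable ?M (\<lambda>x. G k i x $ l)" for k i l by (rule L2_integrable[OF \<Omega>(2) \<Omega>s L2_component[OF GL]])
  \<comment> \<open>Weak convergence makes the integrals against each bounded \<psi> converge, hence
    bounded in k, and \<open>uniform_boundedness_L1\<close> turns this into a bound of the
    norms.\<close>
  have "\<exists>B. \<forall>k. (LINT x|?M. \<bar>G k i x $ l\<bar>) \<le> B" for i l
  proof (rule uniform_boundedness_L1[OF Gi])
    fix \<psi> :: "real^'d \<Rightarrow> real" assume \<psi>: "\<psi> \<in> borel_measurable ?M" "\<forall>x. \<bar>\<psi> x\<bar> \<le> 2"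
    have \<psi>L: "\<psi> \<in> L2 \<Omega>" by (rule L2_bounded_measurable[OF \<Omega>(2) \<Omega>s \<psi>(1), of 2]) (use \<psi>(2) in simp)
    have eq: "(LINT x|?M. weak_gradient \<Omega> (\<lambda>x. u k x $ i) x $ l * \<psi> x) = (LINT x|?M. G k i x $ l * \<psi> x)" for k
    proof (rule integral_cong_AE)
      have g: "has_wgrad \<Omega> (\<lambda>x. u k x $ i) (weak_gradient \<Omega> (\<lambda>x. u k x $ i))"
        using uV by (intro weak_gradient_has_wgrad) (auto simp: H1_vec_def)
      show "AE x in ?M. weak_gradient \<Omega> (\<lambda>x. u k x $ i) x $ l * \<psi> x = G k i x $ l * \<psi> x"
        using has_wgrad_unique[OF \<Omega>(1,2) g Gu] by eventually_elim simp
      show "(\<lambda>x. weak_gradient \<Omega> (\<lambda>x. u k x $ i) x $ l * \<psi> x) \<in> borel_measurable ?M"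
        using L2_integrable_mult[OF L2_component \<psi>L] g by (auto simp: has_wgrad_def)
      show "(\<lambda>x. G k i x $ l * \<psi> x) \<in> borel_measurable ?M"
        using L2_integrable_mult[OF L2_component[OF GL] \<psi>L] by auto
    qed
    have "(\<lambda>k. LINT x|?M. G k i x $ l * \<psi> x) \<longlonglongrightarrow> (LINT x|?M. weak_gradient \<Omega>
        (\<lambda>x. w x $ i) x $ l * \<psi> x)"
      using weak_limit_functionals(2)[OF \<Omega>(1,2) wc uV w \<psi>L, of i l] unfolding eq .
    then have "Bseq (\<lambda>k. LINT x|?M. G k i x $ l * \<psi> x)" by (intro convergent_imp_Bseq) (auto simp: convergent_def)
    then show "\<exists>B. \<forall>k. \<bar>LINT x|?M. G k i x $ l * \<psi> x\<bar> \<le> B" by (auto simp: Bseq_def)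
  qed
  then obtain Bd where Bd: "\<And>i l k. (LINT x|?M. \<bar>G k i x $ l\<bar>) \<le> Bd i l" by metis
  define \<gamma> where "\<gamma> k x = (\<Sum>i\<in>UNIV. \<Sum>l\<in>UNIV. \<bar>G k i x $ l\<bar>)" for k x
  define B where "B = (\<Sum>i\<in>UNIV. \<Sum>l\<in>UNIV. Bd i l)"
  have \<gamma>i: "integrable ?M (\<gamma> k)" for k unfolding \<gamma>_def[abs_def] using Gi by simp
  have \<gamma>B: "(LINT x|?M. \<gamma> k x) \<le> B" for k
    unfolding \<gamma>_def B_def using Gi Bd by (simp add: sum_mono)
  have \<gamma>0: "0 \<le> \<gamma> k x" for k x by (simp add: \<gamma>_def sum_nonneg)
  have B0: "0 \<le> B"
  proof -
    have "0 \<le> (LINT x|?M. \<gamma> 0 x)" using \<gamma>0 by (intro integral_nonneg_AE AE_I2)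
    then show ?thesis using \<gamma>B[of 0] by simp
  qed
  have K: "compact (closure \<Omega>)" using \<Omega> by (simp add: compact_closure)
  have \<alpha>m: "\<alpha> \<in> borel_measurable ?M"
    using \<alpha> closure_subset continuous_on_subset by (intro continuous_imp_measurable_on_sets_lebesgue \<Omega>s) blast
  have "bounded (\<alpha> ` closure \<Omega>)" using K \<alpha> compact_continuous_image compact_imp_bounded by blast
  then obtain A where A: "\<And>x. x \<in> closure \<Omega> \<Longrightarrow> \<bar>\<alpha> x\<bar> \<le> A" unfolding bounded_iff by auto
  have \<alpha>L: "\<alpha> \<in> L2 \<Omega>"
    by (rule L2_bounded_measurable[OF \<Omega>(2) \<Omega>s \<alpha>m, of A]) (use A closure_subset in auto)
  have uc: "uniformly_continuous_on (closure \<Omega>) \<alpha>" by (rule compact_uniformly_continuous[OF \<alpha> K])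
  interpret fm: finite_measure ?M by (rule finite_measure_lebesgue_on_bounded[OF \<Omega>(2) \<Omega>s])
  have pair: "z \<bullet> (y, s) = (\<Sum>i\<in>UNIV. fst z $ i * y $ i) + snd z * s" for y s
    by (simp add: inner_prod_def inner_vec_def)
  have pairi: "integrable ?M (\<lambda>x. z \<bullet> (f x, \<alpha> x) * \<psi> x)"
    "(LINT x|?M. z \<bullet> (f x, \<alpha> x) * \<psi> x) = (\<Sum>i\<in>UNIV. fst z $ i * (LINT x|?M. f x $ i *
        \<psi> x)) + snd z * (LINT x|?M. \<alpha> x * \<psi> x)"
    if f: "\<And>i. (\<lambda>x. f x $ i) \<in> L2 \<Omega>" and \<psi>: "\<psi> \<in> L2 \<Omega>" for f \<psi>
  proof -
    have i: "integrable ?M (\<lambda>x. f x $ i * \<psi> x)" "integrable ?M (\<lambda>x. \<alpha> x * \<psi> x)" for i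
      using f \<psi> \<alpha>L by (auto intro!: L2_integrable_mult)
    have eq: "(\<lambda>x. z \<bullet> (f x, \<alpha> x) * \<psi> x) = (\<lambda>x. (\<Sum>i\<in>UNIV. fst z $ i * (f x
        $ i * \<psi> x)) + snd z * (\<alpha> x * \<psi> x))"
      by (simp add: pair fun_eq_iff distrib_right sum_distrib_right mult.assoc)
    show "integrable ?M (\<lambda>x. z \<bullet> (f x, \<alpha> x) * \<psi> x)" unfolding eq using i by simp
    show "(LINT x|?M. z \<bullet> (f x, \<alpha> x) * \<psi> x) = (\<Sum>i\<in>UNIV. fst z $ i * (LINT x|?M. f x $ i *
        \<psi> x)) + snd z * (LINT x|?M. \<alpha> x * \<psi> x)"
      unfolding eq using i by simp
  qed
  have oneL: "(\<lambda>x. 1 :: real) \<in> L2 \<Omega>" by (rule L2_bounded_measurable[OF \<Omega>(2) \<Omega>s, of _ 1]) auto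
  show "AE x in ?M. 0 \<le> z \<bullet> (w x, \<alpha> x)"
  proof (rule AE_nonneg_of_integrals)
    show "integrable ?M (\<lambda>x. z \<bullet> (w x, \<alpha> x))" using pairi(1)[OF wL oneL] by simp
    fix \<psi> :: "real^'d \<Rightarrow> real" assume \<psi>m: "\<psi> \<in> borel_measurable ?M" and \<psi>01:
        "\<And>x. 0 \<le> \<psi> x \<and> \<psi> x \<le> 1"
    have \<psi>L: "\<psi> \<in> L2 \<Omega>" by (rule L2_bounded_measurable[OF \<Omega>(2) \<Omega>s \<psi>m, of 1]) (use \<psi>01 in auto)
    define a where "a k = (LINT x|?M. z \<bullet> (u k x, \<alpha> x) * \<psi> x)" for k
    define a0 where "a0 = (LINT x|?M. z \<bullet> (w x, \<alpha> x) * \<psi> x)"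
    have lim: "a \<longlonglongrightarrow> a0"
      unfolding a_def[abs_def] a0_def pairi(2)[OF uL \<psi>L] pairi(2)[OF wL \<psi>L]
      by (intro tendsto_intros weak_limit_functionals(1)[OF \<Omega>(1,2) wc uV w \<psi>L])
    define c where "c = norm (fst z)"
    define d where "d = \<bar>snd z\<bar>"
    \<comment> \<open>The mesh term disappears in the limit, while the oscillation \<open>e\<close>
      of \<alpha> is kept as a parameter and removed at the end.\<close>
    have "- (d * e * measure ?M \<Omega>) \<le> a0" if "0 < e" for e
    proof -
      obtain \<delta> where \<delta>: "\<delta> > 0" "\<And>x y. x \<in> closure \<Omega> \<Longrightarrow> y \<in>
          closure \<Omega> \<Longrightarrow> dist y x < \<delta> \<Longrightarrow> dist (\<alpha> y) (\<alpha> x) < e"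
        using uc \<open>0 < e\<close> unfolding uniformly_continuous_on_def by metis
      have ev: "eventually (\<lambda>k. mesh_size (\<T> k) < \<delta>) sequentially"
        using h \<delta>(1) by (rule order_tendstoD)
      have "eventually (\<lambda>k. - (c * mesh_size (\<T> k) * B) - d * e * measure ?M \<Omega> \<le> a k) sequentially"
        using ev
      proof eventually_elim
        case (elim k)
        define hk where "hk = mesh_size (\<T> k)"
        have low: "AE x in ?M. - (c * hk) * \<gamma> k x - d * e \<le> z \<bullet> (u k x, \<alpha> x) * \<psi> x"
          using mesh_AE_interior[OF mesh[of k] \<Omega>s] uv[of k]
        proof eventually_elim
          case (elim x)
          obtain T where T: "T \<in> \<T> k" "x \<in> interior T" using elim(1) by blast
          then have xT: "x \<in> T" using interior_subset by blast
          obtain \<xi> where \<xi>: "\<xi> \<in> T" "N (v k \<xi>) \<le> \<alpha> \<xi>" using con[OF T(1)] by blast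
          note mc = mesh_cell[OF mesh T(1)]
          have dT: "dist \<xi> x \<le> hk"
            using diameter_bounded_bound[OF compact_imp_bounded[OF mc(1)] \<xi>(1) xT] mesh_diameter_le[OF mesh T(1)] by (simp add: hk_def)
          have hk0: "0 \<le> hk" using dT zero_le_dist order_trans by blast
          have "norm (v k x - v k \<xi>) \<le> (\<Sum>i\<in>UNIV. \<bar>(v k x - v k \<xi>) $ i\<bar>)" by (rule norm_le_l1_cart)
          also have "\<dots> \<le> (\<Sum>i\<in>UNIV. (\<Sum>l\<in>UNIV. \<bar>G k i x $ l\<bar>) * hk)"
          proof (rule sum_mono)
            fix i
            have "(v k x - v k \<xi>) $ i = - (G k i x \<bullet> (\<xi> - x))" using G(2)[OF T \<xi>(1), of i] by simp
            then have "\<bar>(v k x - v k \<xi>) $ i\<bar> \<le> norm (G k i x) * norm (\<xi> - x)"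
              using Cauchy_Schwarz_ineq2[of "G k i x" "\<xi> - x"] by simp
            also have "\<dots> \<le> (\<Sum>l\<in>UNIV. \<bar>G k i x $ l\<bar>) * hk"
              using dT hk0 by (intro mult_mono norm_le_l1_cart) (auto simp: dist_norm)
            finally show "\<bar>(v k x - v k \<xi>) $ i\<bar> \<le> (\<Sum>l\<in>UNIV. \<bar>G k i x $ l\<bar>) * hk" .
          qed
          also have "\<dots> = \<gamma> k x * hk" by (simp add: \<gamma>_def sum_distrib_right)
          finally have dv: "norm (v k x - v k \<xi>) \<le> \<gamma> k x * hk" .
          have x\<xi>: "x \<in> closure \<Omega>" "\<xi> \<in> closure \<Omega>" using mc(4) xT \<xi>(1) by blast+
          have d\<alpha>: "\<bar>\<alpha> x - \<alpha> \<xi>\<bar> \<le> e"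
            using \<delta>(2)[OF x\<xi>] dT \<open>mesh_size (\<T> k) < \<delta>\<close> by (simp add: hk_def dist_real_def abs_minus_commute)
          have "z \<bullet> (v k x, \<alpha> x) = z \<bullet> (v k \<xi>, \<alpha> \<xi>) + fst z \<bullet> (v k x - v
              k \<xi>) + snd z * (\<alpha> x - \<alpha> \<xi>)"
            by (simp add: inner_prod_def inner_diff_right algebra_simps)
          moreover have "0 \<le> z \<bullet> (v k \<xi>, \<alpha> \<xi>)" using z \<xi>(2) unfolding dual_cone_def by blast
          moreover have "\<bar>fst z \<bullet> (v k x - v k \<xi>)\<bar> \<le> c * (\<gamma> k x * hk)"
            using Cauchy_Schwarz_ineq2[of "fst z" "v k x - v k \<xi>"] mult_left_mono[OF dv, of c] by (simp add: c_def)
          moreover have "\<bar>snd z * (\<alpha> x - \<alpha> \<xi>)\<bar> \<le> d * e"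
            using d\<alpha> by (simp add: abs_mult d_def mult_left_mono)
          ultimately have lo: "- (c * (\<gamma> k x * hk)) - d * e \<le> z \<bullet> (v k x, \<alpha> x)" by linarith
          have nn: "0 \<le> c * (\<gamma> k x * hk) + d * e"
            using \<gamma>0 hk0 \<open>0 < e\<close> by (auto simp: c_def d_def)
          \<comment> \<open>A weight between 0 and 1 only moves a negative value towards 0, so the
            lower bound survives multiplication.\<close>
          have "- (c * (\<gamma> k x * hk)) - d * e \<le> z \<bullet> (v k x, \<alpha> x) * \<psi> x"
          proof (cases "0 \<le> z \<bullet> (v k x, \<alpha> x)")
            case True
            then have "0 \<le> z \<bullet> (v k x, \<alpha> x) * \<psi> x" using \<psi>01[of x] by simp
            with nn show ?thesis by linarith
          next
            case False
            then have "z \<bullet> (v k x, \<alpha> x) * 1 \<le> z \<bullet> (v k x, \<alpha> x) * \<psi> x" using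
                \<psi>01[of x] by (intro mult_left_mono_neg) auto
            with lo show ?thesis by simp
          qed
          then show ?case using elim(2) by (simp add: mult_ac)
        qed
        \<comment> \<open>The maximum over an empty mesh would be unspecified; a nonempty domain
          excludes this case.\<close>
        have hk0: "0 \<le> hk"
        proof (cases "\<T> k = {}")
          case False
          then obtain T where "T \<in> \<T> k" by blast
          then show ?thesis using mesh_diameter_le[OF mesh] diameter_ge_0 compact_imp_bounded mesh_cell(1)[OF mesh]
            unfolding hk_def by (meson order_trans)
        next
          case True
          then have "closure \<Omega> = {}" using mesh_facts(2)[OF mesh[of k]] by simp
          then show ?thesis using \<Omega>(3) by simp
        qed
        have "- (c * hk * B) - d * e * measure ?M \<Omega> \<le> - (c * hk * (LINT x|?M. \<gamma> k x)) - d * e * measure ?M \<Omega>"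
          using mult_left_mono[OF \<gamma>B[of k], of "c * hk"] hk0 by (simp add: c_def)
        also have "\<dots> = (LINT x|?M. - (c * hk) * \<gamma> k x - d * e)"
          using \<gamma>i[of k] by (simp add: space_restrict_space)
        also have "\<dots> \<le> a k"
          unfolding a_def by (rule integral_mono_AE[OF _ pairi(1)[OF uL \<psi>L] low]) (use \<gamma>i in auto)
        finally show ?case by (simp add: hk_def)
      qed
      moreover have "(\<lambda>k. - (c * mesh_size (\<T> k) * B) - d * e * measure ?M \<Omega>)
          \<longlonglongrightarrow> - (c * 0 * B) - d * e * measure ?M \<Omega>"
        by (intro tendsto_intros h)
      ultimately have "- (c * 0 * B) - d * e * measure ?M \<Omega> \<le> a0" using lim by (intro tendsto_le[OF sequentially_bot lim]) 
      then show ?thesis by simp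
    qed
    note low = this
    have "- a0 \<le> 0"
    proof (rule field_le_epsilon)
      fix e :: real assume "0 < e"
      \<comment> \<open>Adding 1 permits division even if \<open>snd z\<close> is zero.\<close>
      define q where "q = d * measure ?M \<Omega> + 1"
      have q: "q > 0" by (simp add: q_def d_def add_nonneg_pos)
      have "- (d * (e / q) * measure ?M \<Omega>) \<le> a0" using low[of "e / q"] q \<open>0 < e\<close> by simp
      moreover have "d * (e / q) * measure ?M \<Omega> \<le> e"
      proof -
        have "d * (e / q) * measure ?M \<Omega> = e * ((q - 1) / q)" using q by (simp add: q_def)
        also have "\<dots> \<le> e * 1" using q \<open>0 < e\<close> by (intro mult_left_mono) auto
        finally show ?thesis by simp
      qed
      ultimately show "- a0 \<le> 0 + e" by linarith
    qed
    then show "0 \<le> (LINT x|?M. z \<bullet> (w x, \<alpha> x) * \<psi> x)" by (simp add: a0_def)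
  qed
qed


subsection \<open>Mosco convergence\<close>

lemma has_wgrad_vec_diff:
  fixes \<Omega> :: "(real^'d::finite) set" and u w :: "real^'d \<Rightarrow> real^'n::finite"
  assumes "bounded \<Omega>" "\<Omega> \<in> sets lebesgue" "has_wgrad \<Omega> (\<lambda>x. u x $ i) G" "has_wgrad \<Omega> (\<lambda>x. w x $ i) H"
  shows "has_wgrad \<Omega> (\<lambda>x. (u - w) x $ i) (\<lambda>x. G x - H x)"
  using has_wgrad_lincomb[OF assms, of 1 "-1"] by simp

lemma H1_vec_norm_square:
  "(H1_vec_norm \<Omega> v)\<^sup>2 = (\<Sum>i\<in>UNIV. (H1_norm \<Omega> (\<lambda>x. v x $ i))\<^sup>2)"
  by (simp add: H1_vec_norm_def sum_nonneg)

text \<open>Norm convergence sends the squared Euclidean distance to 0 in L1, and L1 convergence has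
  an almost everywhere convergent subsequence. Closedness of all constraint sets rests on
  it.\<close>

lemma strong_convergence_AE_subseq:
  fixes \<Omega> :: "(real^'d::finite) set" and u :: "nat \<Rightarrow> real^'d \<Rightarrow> real^'n::finite"
  assumes \<Omega>: "open \<Omega>" "bounded \<Omega>" and u: "\<And>k. u k \<in> H1_vec \<Omega>" and w: "w \<in> H1_vec \<Omega>"
    and conv: "strongly_converges (H1_vec_norm \<Omega>) u w"
  shows "\<exists>r::nat \<Rightarrow> nat. strict_mono r \<and> (AE x in lebesgue_on \<Omega>. (\<lambda>k. u (r k) x)
      \<longlonglongrightarrow> w x)"
proof -
  have \<Omega>s: "\<Omega> \<in> sets lebesgue" using \<Omega> by (simp add: borel_open sets_completionI_sets)
  define f where "f k x = (\<Sum>i\<in>UNIV. ((u k - w) x $ i)\<^sup>2)" for k x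
  have L: "\<exists>G. has_wgrad \<Omega> (\<lambda>x. (u k - w) x $ i) G" for k i
    using u[of k] w has_wgrad_vec_diff[OF \<Omega>(2) \<Omega>s, of "u k" i _ w] unfolding H1_vec_def H1_iff_has_wgrad by blast
  have i: "integrable (lebesgue_on \<Omega>) (\<lambda>x. ((u k - w) x $ i)\<^sup>2)" for k i
    using L[of k i] L2_square_integrable[of "\<lambda>x. (u k - w) x $ i" \<Omega>] by (auto simp: has_wgrad_def)
  have fi: "integrable (lebesgue_on \<Omega>) (f k)" for k unfolding f_def[abs_def] using i by (intro Bochner_Integration.integrable_sum)
  have fb: "(LINT x|lebesgue_on \<Omega>. norm (f k x)) \<le> (H1_vec_norm \<Omega> (u k - w))\<^sup>2" for k
  proof -
    have "(LINT x|lebesgue_on \<Omega>. norm (f k x)) = (LINT x|lebesgue_on \<Omega>. f k x)" by (simp add: f_def sum_nonneg)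
    also have "\<dots> = (\<Sum>i\<in>UNIV. LINT x|lebesgue_on \<Omega>. ((u k - w) x $ i)\<^sup>2)" unfolding f_def
        using i by (rule Bochner_Integration.integral_sum)
    also have "\<dots> \<le> (\<Sum>i\<in>UNIV. (H1_norm \<Omega> (\<lambda>x. (u k - w) x $ i))\<^sup>2)"
    proof (rule sum_mono)
      fix i
      obtain G where "has_wgrad \<Omega> (\<lambda>x. (u k - w) x $ i) G" using L by blast
      from H1_norm_square[OF \<Omega> this]
      show "(LINT x|lebesgue_on \<Omega>. ((u k - w) x $ i)\<^sup>2) \<le> (H1_norm \<Omega> (\<lambda>x. (u k - w) x $ i))\<^sup>2" by simp
    qed
    finally show ?thesis by (simp only: H1_vec_norm_square)
  qed
  have "(\<lambda>k. (H1_vec_norm \<Omega> (u k - w))\<^sup>2) \<longlonglongrightarrow> 0\<^sup>2"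
    using conv unfolding strongly_converges_def by (rule tendsto_power)
  then have "(\<lambda>k. (H1_vec_norm \<Omega> (u k - w))\<^sup>2) \<longlonglongrightarrow> 0" by simp
  then have "(\<lambda>k. LINT x|lebesgue_on \<Omega>. norm (f k x)) \<longlonglongrightarrow> 0"
    by (rule tendsto_sandwich[OF _ _ tendsto_const, rotated 2]) (use fb in auto)
  from tendsto_L1_AE_subseq[OF fi this] obtain r :: "nat \<Rightarrow> nat"
    where r: "strict_mono r" "AE x in lebesgue_on \<Omega>. (\<lambda>k. f (r k) x) \<longlonglongrightarrow> 0" by blast
  have "AE x in lebesgue_on \<Omega>. (\<lambda>k. u (r k) x) \<longlonglongrightarrow> w x"
    using r(2)
  proof eventually_elim
    case (elim x)
    have eq: "f k x = (norm (u k x - w x))\<^sup>2" for k by (simp add: f_def norm_vec_def L2_set_def sum_nonneg)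
    have "(\<lambda>k. sqrt (f (r k) x)) \<longlonglongrightarrow> sqrt 0" using elim by (rule tendsto_real_sqrt)
    then have "(\<lambda>k. norm (u (r k) x - w x)) \<longlonglongrightarrow> 0" by (simp add: eq)
    then show ?case using LIM_zero_iff tendsto_norm_zero_iff by blast
  qed
  with r(1) show ?thesis by blast
qed

lemma seminorm_convex_comb:
  assumes N: "seminorm_on_vec N" and "0 \<le> a" "0 \<le> b" "a + b = 1" "N x \<le> s" "N y \<le> s"
  shows "N (a *\<^sub>R x + b *\<^sub>R y) \<le> s"
proof -
  have "N (a *\<^sub>R x + b *\<^sub>R y) \<le> N (a *\<^sub>R x) + N (b *\<^sub>R y)" using N unfolding seminorm_on_vec_def by blast
  also have "\<dots> = a * N x + b * N y" using N assms unfolding seminorm_on_vec_def by simp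
  also have "\<dots> \<le> a * s + b * s" using assms by (intro add_mono mult_left_mono)
  finally show ?thesis using assms(4) by (simp add: distrib_right[symmetric])
qed

lemma K_cont_nonempty_closed_convex:
  fixes \<Omega> :: "(real^'d::finite) set"
  assumes \<Omega>: "open \<Omega>" "bounded \<Omega>" and p: "1 \<le> p" and \<alpha>: "\<And>x. x \<in> \<Omega>
      \<Longrightarrow> 0 \<le> \<alpha> x"
  shows "nonempty_closed_convex (H1_vec \<Omega>) (H1_vec_norm \<Omega>) (K_cont \<Omega> p \<alpha> :: (real^'d \<Rightarrow> real^'n::finite) set)"
    (is "nonempty_closed_convex _ _ ?K")
proof -
  have \<Omega>s: "\<Omega> \<in> sets lebesgue" using \<Omega> by (simp add: borel_open sets_completionI_sets)
  note N = lp_norm_seminorm[OF p, where 'n='n]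
  have sub: "subspace (H1_vec \<Omega> :: (real^'d \<Rightarrow> real^'n) set)" by (rule H1_vec_subspace[OF \<Omega>(2) \<Omega>s])
  have "(0 :: real^'d \<Rightarrow> real^'n) \<in> ?K"
    using subspace_0[OF sub] \<alpha> seminorm_zero[OF N]
    by (auto simp: K_cont_def space_restrict_space intro!: AE_I2)
  moreover have "convex ?K" unfolding convex_def
  proof (intro ballI allI impI)
    fix u v :: "real^'d \<Rightarrow> real^'n" and a b :: real
    assume uv: "u \<in> ?K" "v \<in> ?K" and ab: "0 \<le> a" "0 \<le> b" "a + b = 1"
    have "a *\<^sub>R u + b *\<^sub>R v \<in> H1_vec \<Omega>"
      using uv by (intro subspace_add[OF sub] subspace_scale[OF sub]) (auto simp: K_cont_def)
    moreover have "AE x in lebesgue_on \<Omega>. lp_norm p (u x) \<le> \<alpha> x" "AE x in lebesgue_on \<Omega>. lp_norm p (v x) \<le> \<alpha> x"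
      using uv by (auto simp: K_cont_def)
    then have "AE x in lebesgue_on \<Omega>. lp_norm p ((a *\<^sub>R u + b *\<^sub>R v) x) \<le> \<alpha> x"
      by eventually_elim (simp add: scaleR_fun_def seminorm_convex_comb[OF N ab])
    ultimately show "a *\<^sub>R u + b *\<^sub>R v \<in> ?K" by (simp add: K_cont_def)
  qed
  moreover have "w \<in> ?K" if w: "w \<in> H1_vec \<Omega>" and u: "\<And>k. u k \<in> ?K" and c: "strongly_converges
      (H1_vec_norm \<Omega>) u w" for u w
  proof -
    have uV: "u k \<in> H1_vec \<Omega>" for k using u by (auto simp: K_cont_def)
    obtain r :: "nat \<Rightarrow> nat" where r: "AE x in lebesgue_on \<Omega>. (\<lambda>k. u (r k) x) \<longlonglongrightarrow> w x"
      using strong_convergence_AE_subseq[OF \<Omega> uV w c] by blast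
    have "AE x in lebesgue_on \<Omega>. lp_norm p (u (r k) x) \<le> \<alpha> x" for k using u by (auto simp: K_cont_def)
    then have "AE x in lebesgue_on \<Omega>. \<forall>k. lp_norm p (u (r k) x) \<le> \<alpha> x" unfolding AE_all_countable by blast
    with r have "AE x in lebesgue_on \<Omega>. lp_norm p (w x) \<le> \<alpha> x"
    proof eventually_elim
      case (elim x)
      have "(\<lambda>k. lp_norm p (u (r k) x)) \<longlonglongrightarrow> lp_norm p (w x)"
        using continuous_on_tendsto_compose[OF seminorm_continuous[OF N] elim(1)] by simp
      then show ?case using elim(2) by (intro LIMSEQ_le_const2) auto
    qed
    with w show ?thesis by (simp add: K_cont_def)
  qed
  ultimately show ?thesis unfolding nonempty_closed_convex_def K_cont_def by blast
qed

section \<open>Closedness of the discrete constraint sets\<close>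

text \<open>The set of points of convergence is affine, and it is not negligible because it fills an
  open set up to a null set; an affine set of this kind is the whole space. The limit coefficients
  are then read off at 0 and at the unit vectors.\<close>

lemma affine_functions_converge:
  fixes a :: "nat \<Rightarrow> real^'d::finite" and b :: "nat \<Rightarrow> real"
  assumes conv: "\<And>x. x \<in> T - N \<Longrightarrow> convergent (\<lambda>k. a k \<bullet> x + b k)" and N:
      "negligible N" and T: "interior T \<noteq> {}"
  shows "\<exists>a0 b0. \<forall>x. (\<lambda>k. a k \<bullet> x + b k) \<longlonglongrightarrow> a0 \<bullet> x + b0"
proof -
  define A where "A = {x. convergent (\<lambda>k. a k \<bullet> x + b k)}"
  have "affine A" unfolding affine_def
  proof (intro ballI allI impI)
    fix x y and s t :: real assume xy: "x \<in> A" "y \<in> A" and st: "s + t = 1"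
    have eq: "a k \<bullet> (s *\<^sub>R x + t *\<^sub>R y) + b k = s * (a k \<bullet> x + b k) + t * (a k \<bullet> y + b k)" for k
    proof -
      have "b k = (s + t) * b k" using st by simp
      then show ?thesis by (simp add: inner_add_right algebra_simps)
    qed
    obtain lx ly where "(\<lambda>k. a k \<bullet> x + b k) \<longlonglongrightarrow> lx" "(\<lambda>k. a k \<bullet> y
        + b k) \<longlonglongrightarrow> ly"
      using xy by (auto simp: A_def convergent_def)
    then have "(\<lambda>k. s * (a k \<bullet> x + b k) + t * (a k \<bullet> y + b k)) \<longlonglongrightarrow> s * lx
        + t * ly" by (intro tendsto_intros)
    then show "s *\<^sub>R x + t *\<^sub>R y \<in> A" unfolding A_def eq[symmetric] by (auto simp: convergent_def)
  qed
  have "\<not> negligible A"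
  proof
    assume "negligible A"
    then have "negligible (A \<union> N)" using N by (rule negligible_Un)
    moreover have "interior T \<subseteq> A \<union> N" using conv interior_subset by (auto simp: A_def)
    ultimately have "negligible (interior T)" using negligible_subset by blast
    then show False using T open_not_negligible by blast
  qed
  then have "interior A \<noteq> {}" using negligible_convex_interior[OF affine_imp_convex[OF \<open>affine A\<close>]] by blast
  then have "A = UNIV" using affine_hull_nonempty_interior[of A] affine_hull_eq[of A] \<open>affine A\<close> by simp
  then have "\<forall>x. \<exists>l. (\<lambda>k. a k \<bullet> x + b k) \<longlonglongrightarrow> l" by (auto simp: A_def convergent_def)
  then obtain l where l: "\<And>x. (\<lambda>k. a k \<bullet> x + b k) \<longlonglongrightarrow> l x" by metis
  define a0 where "a0 = (\<chi> i. l (axis i 1) - l 0)"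
  have b: "b \<longlonglongrightarrow> l 0" using l[of 0] by simp
  have ai: "(\<lambda>k. a k $ i) \<longlonglongrightarrow> a0 $ i" for i
    using tendsto_diff[OF l[of "axis i 1"] b] b by (simp add: a0_def inner_axis)
  have "(\<lambda>k. a k) \<longlonglongrightarrow> a0" by (rule vec_tendstoI) (rule ai)
  then have "(\<lambda>k. a k \<bullet> x + b k) \<longlonglongrightarrow> a0 \<bullet> x + l 0" for x by (intro tendsto_intros b)
  then show ?thesis by blast
qed

lemma P1_pointwise_limit:
  fixes \<Omega> :: "(real^'d::finite) set"
  assumes m: "conformal_simplicial_mesh \<Omega> \<T>" and "open \<Omega>"
    and f: "\<And>k. f k \<in> P1_elements \<Omega> \<T>" and conv: "AE x in lebesgue_on \<Omega>. convergent (\<lambda>k::nat. f k x)"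
  shows "\<exists>g\<in>P1_elements \<Omega> \<T>. \<forall>x\<in>closure \<Omega>. (\<lambda>k. f k x) \<longlonglongrightarrow> g x"
proof -
  have \<Omega>s: "\<Omega> \<in> sets lebesgue" using \<open>open \<Omega>\<close> by (simp add: borel_open sets_completionI_sets)
  note mf = mesh_facts[OF m] and mc = mesh_cell[OF m]
  have "AE x in lebesgue. x \<in> \<Omega> \<longrightarrow> convergent (\<lambda>k. f k x)"
    using conv \<Omega>s by (subst (asm) AE_restrict_space_iff) auto
  then obtain N0 where N0: "N0 \<in> null_sets lebesgue" "{x. \<not> (x \<in> \<Omega> \<longrightarrow> convergent
      (\<lambda>k. f k x))} \<subseteq> N0"
    by (auto simp: eventually_ae_filter)
  have conv: "convergent (\<lambda>k. f k x)" if "x \<in> \<Omega> - N0" for x using that N0(2) by blast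
  have loc: "\<exists>a0 b0. \<forall>x\<in>T. (\<lambda>k. f k x) \<longlonglongrightarrow> a0 \<bullet> x + b0" if T: "T \<in> \<T>" for T
  proof -
    have "\<forall>k. \<exists>a b. \<forall>x\<in>T. f k x = a \<bullet> x + b" using f T unfolding P1_elements_def by blast
    then obtain a b where ab: "\<And>k x. x \<in> T \<Longrightarrow> f k x = a k \<bullet> x + b k" by metis
    have "\<exists>a0 b0. \<forall>x. (\<lambda>k. a k \<bullet> x + b k) \<longlonglongrightarrow> a0 \<bullet> x + b0"
    proof (rule affine_functions_converge)
      show "convergent (\<lambda>k. a k \<bullet> x + b k)" if "x \<in> interior T \<inter> \<Omega> - N0" for x
      proof -
        have "x \<in> T" using that interior_subset by blast
        then show ?thesis using conv[of x] that by (simp add: ab[symmetric])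
      qed
      show "negligible N0" using N0(1) by (simp add: negligible_iff_null_sets)
      \<comment> \<open>Convergence is known almost everywhere in \<Omega> only; an open subset of
        its closure meets \<Omega>.\<close>
      have "interior T \<inter> \<Omega> \<noteq> {}"
        using mc(3,4)[OF T] interior_subset[of T] open_Int_closure_eq_empty[OF open_interior, of T \<Omega>] by blast
      then show "interior (interior T \<inter> \<Omega>) \<noteq> {}" using \<open>open \<Omega>\<close> by (simp add: interior_open)
    qed
    then obtain a0 b0 where "\<And>x. (\<lambda>k. a k \<bullet> x + b k) \<longlonglongrightarrow> a0 \<bullet> x + b0" by blast
    then show ?thesis using ab by (intro exI[of _ a0] exI[of _ b0]) simp
  qed
  define g where "g x = lim (\<lambda>k. f k x)" for x
  have gT: "\<exists>a0 b0. \<forall>x\<in>T. g x = a0 \<bullet> x + b0" if "T \<in> \<T>" for T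
    using loc[OF that] limI unfolding g_def by metis
  have lim: "(\<lambda>k. f k x) \<longlonglongrightarrow> g x" if "x \<in> closure \<Omega>" for x
  proof -
    have "x \<in> \<Union>\<T>" using that mf(2) by simp
    then obtain T where T: "T \<in> \<T>" "x \<in> T" by blast
    then obtain l where "(\<lambda>k. f k x) \<longlonglongrightarrow> l" using loc[OF T(1)] by blast
    then show ?thesis unfolding g_def using limI by blast
  qed
  have "continuous_on (\<Union>T\<in>\<T>. T) g"
  proof (rule continuous_on_closed_Union[OF mf(1)])
    show "closed T" if "T \<in> \<T>" for T using mc(1)[OF that] compact_imp_closed by blast
    show "continuous_on T g" if T: "T \<in> \<T>" for T
    proof -
      obtain a0 b0 where ab: "\<forall>x\<in>T. g x = a0 \<bullet> x + b0" using gT[OF T] by blast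
      have "continuous_on T (\<lambda>x. a0 \<bullet> x + b0)" by (intro continuous_intros)
      then show ?thesis by (rule continuous_on_cong[THEN iffD1, OF refl, rotated]) (simp add: ab)
    qed
  qed
  then have "g \<in> P1_elements \<Omega> \<T>" using mf(2) gT by (simp add: P1_elements_def)
  with lim show ?thesis by blast
qed

text \<open>A common form of the midpoint and the nodal set, with an arbitrary norm and an arbitrary
  set \<open>X\<close> of points where the constraint is imposed.\<close>

definition P1_constrained ::
    "(real^'d::finite) set \<Rightarrow> (real^'d) set set \<Rightarrow> (real^'n::finite \<Rightarrow> real)
        \<Rightarrow> (real^'d \<Rightarrow> real) \<Rightarrow> (real^'d) set \<Rightarrow> (real^'d \<Rightarrow> real^'n) set"
  where "P1_constrained \<Omega> \<T> N \<alpha> X = {w. (\<forall>i. (\<lambda>x. w x $ i) \<in> P1_elements \<Omega>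
      \<T>) \<and> (\<forall>x\<in>X. N (w x) \<le> \<alpha> x)}"

lemma P1_lincomb:
  assumes u: "u \<in> P1_elements \<Omega> \<T>" and v: "v \<in> P1_elements \<Omega> \<T>"
  shows "(\<lambda>x. a * u x + b * v x) \<in> P1_elements \<Omega> \<T>"
proof -
  have "\<exists>c d. \<forall>x\<in>T. a * u x + b * v x = c \<bullet> x + d" if T: "T \<in> \<T>" for T
  proof -
    obtain c1 d1 where 1: "\<And>x. x \<in> T \<Longrightarrow> u x = c1 \<bullet> x + d1" using u T unfolding P1_elements_def by blast
    obtain c2 d2 where 2: "\<And>x. x \<in> T \<Longrightarrow> v x = c2 \<bullet> x + d2" using v T unfolding P1_elements_def by blast
    show ?thesis
      by (intro exI[of _ "a *\<^sub>R c1 + b *\<^sub>R c2"] exI[of _ "a * d1 + b * d2"])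
         (simp add: 1 2 inner_add_left algebra_simps)
  qed
  moreover have "continuous_on (closure \<Omega>) (\<lambda>x. a * u x + b * v x)"
    using u v by (intro continuous_intros) (auto simp: P1_elements_def)
  ultimately show ?thesis by (simp add: P1_elements_def)
qed

lemma ae_P1_in_H1_vec:
  fixes \<Omega> :: "(real^'d::finite) set"
  assumes \<Omega>: "open \<Omega>" "bounded \<Omega>" and m: "conformal_simplicial_mesh \<Omega> \<T>"
    and w: "w \<in> ae_classes \<Omega> (P1_constrained \<Omega> \<T> N \<alpha> X)"
  shows "w \<in> H1_vec \<Omega>"
proof -
  have \<Omega>s: "\<Omega> \<in> sets lebesgue" using \<Omega> by (simp add: borel_open sets_completionI_sets)
  obtain v where v: "\<And>i. (\<lambda>x. v x $ i) \<in> P1_elements \<Omega> \<T>" "AE x in lebesgue_on \<Omega>. w x = v x"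
    using w unfolding ae_classes_def P1_constrained_def by blast
  have "\<exists>G. has_wgrad \<Omega> (\<lambda>x. w x $ i) G" for i
  proof -
    obtain G where G: "has_wgrad \<Omega> (\<lambda>x. v x $ i) G" using P1_has_wgrad[OF \<Omega> m v(1)] by blast
    have "AE x in lebesgue_on \<Omega>. v x $ i = w x $ i" using v(2) by eventually_elim simp
    from has_wgrad_AE[OF \<Omega>s \<Omega>(2) G this] show ?thesis by blast
  qed
  then show ?thesis by (simp add: H1_vec_def H1_iff_has_wgrad)
qed

lemma ae_classesI: "v \<in> S \<Longrightarrow> AE x in lebesgue_on \<Omega>. w x = v x \<Longrightarrow> w \<in> ae_classes \<Omega> S"
  unfolding ae_classes_def by blast

text \<open>\<open>X\<close> may be a null set, so almost everywhere convergence says nothing about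
  it directly. By \<open>P1_pointwise_limit\<close> the finite element representatives converge on
  the whole closure, and there the constraint can be followed to the limit.\<close>

lemma P1_constrained_nonempty_closed_convex:
  fixes \<Omega> :: "(real^'d::finite) set" and N :: "real^'n::finite \<Rightarrow> real"
  assumes \<Omega>: "open \<Omega>" "bounded \<Omega>" and m: "conformal_simplicial_mesh \<Omega> \<T>" and N: "seminorm_on_vec N"
    and X: "X \<subseteq> closure \<Omega>" and \<alpha>: "\<And>x. x \<in> closure \<Omega> \<Longrightarrow> 0 \<le> \<alpha> x"
  shows "nonempty_closed_convex (H1_vec \<Omega>) (H1_vec_norm \<Omega>) (ae_classes \<Omega> (P1_constrained \<Omega> \<T> N \<alpha> X))"
    (is "nonempty_closed_convex _ _ ?K")
proof -
  have "(\<lambda>x. 0) \<in> P1_elements \<Omega> \<T>"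
    by (auto simp: P1_elements_def intro!: exI[of _ 0])
  then have "(\<lambda>x. 0) \<in> P1_constrained \<Omega> \<T> N \<alpha> X"
    using \<alpha> X seminorm_zero[OF N] by (auto simp: P1_constrained_def)
  then have "(\<lambda>x. 0) \<in> ?K" by (auto simp: ae_classes_def)
  moreover have sub: "?K \<subseteq> H1_vec \<Omega>" using ae_P1_in_H1_vec[OF \<Omega> m] by blast
  moreover have "convex ?K" unfolding convex_def
  proof (intro ballI allI impI)
    fix u v :: "real^'d \<Rightarrow> real^'n" and a b :: real
    assume uv: "u \<in> ?K" "v \<in> ?K" and ab: "0 \<le> a" "0 \<le> b" "a + b = 1"
    obtain u' where u': "u' \<in> P1_constrained \<Omega> \<T> N \<alpha> X" "AE x in lebesgue_on \<Omega>. u x = u' x"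
        using uv by (auto simp: ae_classes_def)
    obtain v' where v': "v' \<in> P1_constrained \<Omega> \<T> N \<alpha> X" "AE x in lebesgue_on \<Omega>. v x = v' x"
        using uv by (auto simp: ae_classes_def)
    have "(\<lambda>x. a *\<^sub>R u' x + b *\<^sub>R v' x) \<in> P1_constrained \<Omega> \<T> N \<alpha> X"
      using u'(1) v'(1) by (auto simp: P1_constrained_def intro!: P1_lincomb seminorm_convex_comb[OF N ab])
    moreover have "AE x in lebesgue_on \<Omega>. (a *\<^sub>R u + b *\<^sub>R v) x = a *\<^sub>R u' x + b *\<^sub>R v' x"
      using u'(2) v'(2) by eventually_elim (simp add: scaleR_fun_def)
    ultimately show "a *\<^sub>R u + b *\<^sub>R v \<in> ?K" by (rule ae_classesI)
  qed
  moreover have "w \<in> ?K" if w: "w \<in> H1_vec \<Omega>" and u: "\<And>k. u k \<in> ?K" and c: "strongly_converges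
      (H1_vec_norm \<Omega>) u w" for u w
  proof -
    have uV: "u k \<in> H1_vec \<Omega>" for k using u sub by blast
    obtain r :: "nat \<Rightarrow> nat" where r: "AE x in lebesgue_on \<Omega>. (\<lambda>k. u (r k) x) \<longlonglongrightarrow> w x"
      using strong_convergence_AE_subseq[OF \<Omega> uV w c] by blast
    have "\<forall>k. \<exists>v. v \<in> P1_constrained \<Omega> \<T> N \<alpha> X \<and> (AE x in lebesgue_on \<Omega>. u (r k) x = v x)"
      using u unfolding ae_classes_def by blast
    then obtain v where v: "\<And>k. v k \<in> P1_constrained \<Omega> \<T> N \<alpha> X" "\<And>k. AE x in lebesgue_on
        \<Omega>. u (r k) x = v k x" by metis
    have "AE x in lebesgue_on \<Omega>. \<forall>k. u (r k) x = v k x" using v(2) unfolding AE_all_countable by blast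
    with r have vw: "AE x in lebesgue_on \<Omega>. (\<lambda>k. v k x) \<longlonglongrightarrow> w x" by eventually_elim simp
    have "\<exists>g\<in>P1_elements \<Omega> \<T>. \<forall>x\<in>closure \<Omega>. (\<lambda>k. v k x $ i) \<longlonglongrightarrow> g x" for i
    proof (rule P1_pointwise_limit[OF m \<Omega>(1)])
      show "(\<lambda>x. v k x $ i) \<in> P1_elements \<Omega> \<T>" for k using v(1) by (auto simp: P1_constrained_def)
      show "AE x in lebesgue_on \<Omega>. convergent (\<lambda>k. v k x $ i)"
        using vw by eventually_elim (auto simp: convergent_def intro: tendsto_vec_nth)
    qed
    then obtain g where g: "\<And>i. g i \<in> P1_elements \<Omega> \<T>" "\<And>i x. x \<in> closure \<Omega>
        \<Longrightarrow> (\<lambda>k. v k x $ i) \<longlonglongrightarrow> g i x" by metis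
    define w' where "w' x = (\<chi> i. g i x)" for x
    have lim: "(\<lambda>k. v k x) \<longlonglongrightarrow> w' x" if "x \<in> closure \<Omega>" for x
      by (rule vec_tendstoI) (simp add: w'_def g(2)[OF that])
    have "N (w' x) \<le> \<alpha> x" if "x \<in> X" for x
    proof -
      have "(\<lambda>k. N (v k x)) \<longlonglongrightarrow> N (w' x)"
        using continuous_on_tendsto_compose[OF seminorm_continuous[OF N] lim] that X by auto
      moreover have "N (v k x) \<le> \<alpha> x" for k using v(1) that by (auto simp: P1_constrained_def)
      ultimately show ?thesis by (intro LIMSEQ_le_const2) auto
    qed
    then have "w' \<in> P1_constrained \<Omega> \<T> N \<alpha> X" using g(1) by (simp add: P1_constrained_def w'_def)
    moreover have "AE x in lebesgue_on \<Omega>. x \<in> \<Omega>" by (rule AE_I2) (simp add: space_restrict_space)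
    then have "AE x in lebesgue_on \<Omega>. w x = w' x"
      using vw by eventually_elim (use lim closure_subset LIMSEQ_unique in blast)
    ultimately show ?thesis by (intro ae_classesI)
  qed
  ultimately show ?thesis unfolding nonempty_closed_convex_def by blast
qed

section \<open>Recovery sequences\<close>

text \<open>Splits f - w into the perturbation f - (1 - \<theta>) g, the scaled approximation error
  (1 - \<theta>) (g - w) and -\<theta> w. Two applications of \<open>norm_add_square_le\<close> give
  the weights 4, 4 and 2, and squares of numbers in [0,1] are bounded by the numbers
  themselves.\<close>

lemma perturbed_L2_error:
  fixes f g w :: "real^'d::finite \<Rightarrow> 'b::euclidean_space"
  assumes \<Omega>: "bounded \<Omega>" "\<Omega> \<in> sets lebesgue"
    and L: "f \<in> L2 \<Omega>" "g \<in> L2 \<Omega>" "w \<in> L2 \<Omega>"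
    and \<theta>: "0 \<le> \<theta>" "\<theta> \<le> 1" and d: "0 \<le> d" "d \<le> 1"
    and ae: "AE x in lebesgue_on \<Omega>. norm (f x - (1 - \<theta>) *\<^sub>R g x) \<le> d"
  shows "(LINT x|lebesgue_on \<Omega>. (norm (f x - w x))\<^sup>2) \<le>
    4 * d * measure (lebesgue_on \<Omega>) \<Omega> + 4 * (LINT x|lebesgue_on \<Omega>. (norm (g x - w x))\<^sup>2) + 2
        * \<theta> * (LINT x|lebesgue_on \<Omega>. (norm (w x))\<^sup>2)"
proof -
  interpret fm: finite_measure "lebesgue_on \<Omega>" by (rule finite_measure_lebesgue_on_bounded[OF \<Omega>])
  note i = L2D(2)[OF L2_diff[OF L(1,3)]] L2D(2)[OF L2_diff[OF L(2,3)]] L2D(2)[OF L(3)]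
  have "(LINT x|lebesgue_on \<Omega>. (norm (f x - w x))\<^sup>2) \<le>
    (LINT x|lebesgue_on \<Omega>. 4 * d + 4 * (norm (g x - w x))\<^sup>2 + 2 * \<theta> * (norm (w x))\<^sup>2)"
  proof (rule integral_mono_AE)
    show "AE x in lebesgue_on \<Omega>. (norm (f x - w x))\<^sup>2 \<le> 4 * d + 4 * (norm (g x - w x))\<^sup>2 + 2 * \<theta> * (norm (w x))\<^sup>2"
      using ae
    proof eventually_elim
      case (elim x)
      define p where "p = f x - (1 - \<theta>) *\<^sub>R g x"
      define q where "q = (1 - \<theta>) *\<^sub>R (g x - w x)"
      have "f x - w x = (p + q) + (- \<theta>) *\<^sub>R w x" by (simp add: p_def q_def algebra_simps)
      then have "(norm (f x - w x))\<^sup>2 \<le> 2 * (norm (p + q))\<^sup>2 + 2 * (norm ((- \<theta>) *\<^sub>R w x))\<^sup>2"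
        using norm_add_square_le[of "p + q" "(- \<theta>) *\<^sub>R w x"] by simp
      moreover have "(norm (p + q))\<^sup>2 \<le> 2 * (norm p)\<^sup>2 + 2 * (norm q)\<^sup>2" by (rule norm_add_square_le)
      moreover have "(norm p)\<^sup>2 \<le> d"
      proof -
        have "(norm p)\<^sup>2 \<le> d\<^sup>2" using elim by (intro power_mono) (auto simp: p_def)
        also have "\<dots> \<le> d" using d by (simp add: power2_eq_square mult_left_le_one_le)
        finally show ?thesis .
      qed
      moreover have "(norm q)\<^sup>2 \<le> (norm (g x - w x))\<^sup>2"
        using \<theta> by (intro power_mono) (auto simp: q_def mult_left_le_one_le)
      moreover have "(norm ((- \<theta>) *\<^sub>R w x))\<^sup>2 \<le> \<theta> * (norm (w x))\<^sup>2"
      proof -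
        have "\<theta>\<^sup>2 \<le> \<theta>" using \<theta> by (simp add: power2_eq_square mult_left_le_one_le)
        then have "\<theta>\<^sup>2 * (norm (w x))\<^sup>2 \<le> \<theta> * (norm (w x))\<^sup>2" by (rule mult_right_mono) simp
        then show ?thesis by (simp add: power_mult_distrib)
      qed
      ultimately show ?case by linarith
    qed
  qed (use i in auto)
  also have "\<dots> = 4 * d * measure (lebesgue_on \<Omega>) \<Omega> + 4 * (LINT x|lebesgue_on \<Omega>. (norm (g x -
      w x))\<^sup>2) + 2 * \<theta> * (LINT x|lebesgue_on \<Omega>. (norm (w x))\<^sup>2)"
    using i by (simp add: space_restrict_space)
  finally show ?thesis .
qed

text \<open>The constraint is obtained on the whole closure, so one approximation serves every
  admissible \<open>X\<close>. Scaling by 1 - \<theta> creates a gap of at least \<theta> a; one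
  half pays for the excess \<open>e2\<close> of the smooth approximation, the other for the
  interpolation error.\<close>

lemma P1_constrained_recovery:
  fixes \<Omega> :: "(real^'d::finite) set" and w :: "real^'d \<Rightarrow> real^'n::finite" and N :: "real^'n \<Rightarrow> real"
  assumes \<Omega>: "open \<Omega>" "bounded \<Omega>" "lipschitz_boundary \<Omega>"
    and mesh: "\<And>h. h \<in> H \<Longrightarrow> conformal_simplicial_mesh \<Omega> (\<T> h)" "\<And>h. h \<in> H
        \<Longrightarrow> mesh_size (\<T> h) = h" "\<And>h. h \<in> H \<Longrightarrow> 0 < h"
    and sr: "shape_regular H \<T>"
    and N: "seminorm_on_vec N" and \<alpha>: "continuous_on (closure \<Omega>) \<alpha>"
    and a: "0 < a" "\<And>x. x \<in> closure \<Omega> \<Longrightarrow> a \<le> \<alpha> x"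
    and w: "w \<in> H1_vec \<Omega>" "AE x in lebesgue_on \<Omega>. N (w x) \<le> \<alpha> x" and e: "0 < e"
  shows "\<exists>h0>0. \<forall>h\<in>H. h < h0 \<longrightarrow> (\<exists>v. (\<forall>i. (\<lambda>x. v x $ i)
      \<in> P1_elements \<Omega> (\<T> h)) \<and>
    (\<forall>x\<in>closure \<Omega>. N (v x) \<le> \<alpha> x) \<and> H1_vec_norm \<Omega> (v - w) < e)"
proof -
  have \<Omega>s: "\<Omega> \<in> sets lebesgue" using \<Omega> by (simp add: borel_open sets_completionI_sets)
  define G where "G i = weak_gradient \<Omega> (\<lambda>x. w x $ i)" for i
  have G: "has_wgrad \<Omega> (\<lambda>x. w x $ i) (G i)" for i
    unfolding G_def by (rule weak_gradient_has_wgrad) (use w in \<open>auto simp: H1_vec_def\<close>)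
  define n where "n = real CARD('n)"
  have n: "n > 0" by (simp add: n_def)
  \<comment> \<open>Each of the n components gets a squared H1 error of at most 2 e1, so the total
    is at most e^2 / 2.\<close>
  define e1 where "e1 = e\<^sup>2 / (4 * n)"
  have e1: "e1 > 0" using e n by (simp add: e1_def)
  define W where "W = (\<Sum>i\<in>UNIV. (LINT x|lebesgue_on \<Omega>. (w x $ i)\<^sup>2) + (LINT x|lebesgue_on \<Omega>. (norm (G i x))\<^sup>2))"
  have W: "(LINT x|lebesgue_on \<Omega>. (w x $ i)\<^sup>2) \<le> W" "(LINT x|lebesgue_on \<Omega>. (norm (G i x))\<^sup>2) \<le> W" for i
  proof -
    have "(LINT x|lebesgue_on \<Omega>. (w x $ i)\<^sup>2) + (LINT x|lebesgue_on \<Omega>. (norm (G i x))\<^sup>2) \<le> W"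
      unfolding W_def by (rule member_le_sum) auto
    moreover have "0 \<le> (LINT x|lebesgue_on \<Omega>. (w x $ i)\<^sup>2)" "0 \<le> (LINT x|lebesgue_on \<Omega>. (norm (G i x))\<^sup>2)" by auto
    ultimately show "(LINT x|lebesgue_on \<Omega>. (w x $ i)\<^sup>2) \<le> W" "(LINT x|lebesgue_on \<Omega>. (norm (G
        i x))\<^sup>2) \<le> W" by linarith+
  qed
  have W0: "0 \<le> W" by (simp add: W_def sum_nonneg)
  define \<mu> where "\<mu> = measure (lebesgue_on \<Omega>) \<Omega>"
  have \<mu>0: "0 \<le> \<mu>" by (simp add: \<mu>_def)
  obtain C where C: "C > 0" "\<And>x. N x \<le> C * norm x" using seminorm_bound[OF N] by blast
  \<comment> \<open>Small enough that scaling changes the squared norms, all bounded by W, by a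
    fraction of e1. In \<open>perturbed_L2_error\<close> the shares of d, e2 and \<theta> are e1/4,
    e1/4 and e1/8.\<close>
  define \<theta> where "\<theta> = min (1/2) (e1 / (16 * (W + 1)))"
  have \<theta>: "0 < \<theta>" using e1 W0 by (simp add: \<theta>_def)
  have \<theta>1: "\<theta> \<le> 1/2" unfolding \<theta>_def by (rule min.cobounded1)
  have \<theta>W: "\<theta> * W \<le> e1 / 16"
  proof -
    have "\<theta> * W \<le> (e1 / (16 * (W + 1))) * (W + 1)" using W0 e1 by (intro mult_mono) (auto simp: \<theta>_def)
    also have "\<dots> = e1 / 16" using W0 nonzero_mult_divide_mult_cancel_right[of "W + 1" e1 16] by (simp add: times_divide_eq_left)
    finally show ?thesis .
  qed
  define e2 where "e2 = min (e1 / 16) (\<theta> * a / 2)"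
  have e2: "0 < e2" "e2 \<le> e1 / 16" "e2 \<le> \<theta> * a / 2" using e1 \<theta> a(1) by (auto simp: e2_def)
  \<comment> \<open>The last entry makes an error of d in each of the n components cost at most
    \<theta> a / 2 in \<open>N\<close>, whose bound by the Euclidean norm has constant C.\<close>
  define d where "d = min 1 (min (e1 / (16 * (\<mu> + 1))) (\<theta> * a / (2 * C * n)))"
  have d: "0 < d" "d \<le> 1" using e1 \<mu>0 \<theta> a(1) C n by (auto simp: d_def)
  have d\<mu>: "d * \<mu> \<le> e1 / 16"
  proof -
    have "d * \<mu> \<le> (e1 / (16 * (\<mu> + 1))) * (\<mu> + 1)" using \<mu>0 e1 by (intro mult_mono) (auto simp: d_def)
    also have "\<dots> = e1 / 16" using \<mu>0 nonzero_mult_divide_mult_cancel_right[of "\<mu> + 1" e1 16] by (simp add: times_divide_eq_left)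
    finally show ?thesis .
  qed
  have dC: "C * (n * d) \<le> \<theta> * a / 2"
  proof -
    have "C * n * d \<le> C * n * (\<theta> * a / (2 * C * n))" using C n by (intro mult_left_mono) (auto simp: d_def)
    then show ?thesis using C n by (simp add: mult.assoc)
  qed
  obtain g \<Gamma> where gg: "(\<forall>i. (\<forall>x\<in>closure \<Omega>. (g i has_derivative (\<lambda>v. \<Gamma>
      i x \<bullet> v)) (at x)) \<and> continuous_on (closure \<Omega>) (\<Gamma> i) \<and>
      (LINT x|lebesgue_on \<Omega>. (g i x - w x $ i)\<^sup>2) \<le> e2 \<and> (LINT x|lebesgue_on \<Omega>. (norm
          (\<Gamma> i x - G i x))\<^sup>2) \<le> e2) \<and>
     (\<forall>x\<in>closure \<Omega>. N (\<chi> i. g i x) \<le> \<alpha> x + e2)"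
    using H1_constrained_density[OF \<Omega> N G \<alpha> w(2) e2(1)] by (elim exE) (rule that)
  have g: "\<And>i x. x \<in> closure \<Omega> \<Longrightarrow> (g i has_derivative (\<lambda>v. \<Gamma> i x \<bullet> v)) (at x)"
      "\<And>i. continuous_on (closure \<Omega>) (\<Gamma> i)"
      "\<And>i. (LINT x|lebesgue_on \<Omega>. (g i x - w x $ i)\<^sup>2) \<le> e2"
      "\<And>i. (LINT x|lebesgue_on \<Omega>. (norm (\<Gamma> i x - G i x))\<^sup>2) \<le> e2"
      "\<And>x. x \<in> closure \<Omega> \<Longrightarrow> N (\<chi> i. g i x) \<le> \<alpha> x + e2"
    using gg by simp_all
  define s where "s = 1 - \<theta>"
  have s: "0 \<le> s" "s \<le> 1" using \<theta> \<theta>1 by (auto simp: s_def)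
  have sd: "((\<lambda>x. s * g i x) has_derivative (\<lambda>v. (s *\<^sub>R \<Gamma> i x) \<bullet> v)) (at x)" if "x
      \<in> closure \<Omega>" for i x
    using has_derivative_mult_right[OF g(1)[OF that]] by simp
  have sc: "continuous_on (closure \<Omega>) (\<lambda>x. s *\<^sub>R \<Gamma> i x)" for i by (intro continuous_intros g)
  define R where "R i h I F \<longleftrightarrow> I \<in> P1_elements \<Omega> (\<T> h) \<and> (\<forall>x\<in>closure
      \<Omega>. \<bar>I x - s * g i x\<bar> \<le> d) \<and>
      has_wgrad \<Omega> I F \<and> (AE x in lebesgue_on \<Omega>. norm (F x - s *\<^sub>R \<Gamma> i x) \<le> d)" for i h I F
  have "\<exists>h0>0. \<forall>h\<in>H. h < h0 \<longrightarrow> (\<exists>I F. R i h I F)" for i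
  proof -
    have "\<exists>h0>0. \<forall>h\<in>H. h < h0 \<longrightarrow> (\<exists>I\<in>P1_elements \<Omega> (\<T> h).
        (\<forall>T\<in>\<T> h. \<forall>v\<in>vertices T. I v = s * g i v) \<and>
     (\<forall>x\<in>closure \<Omega>. \<bar>I x - s * g i x\<bar> \<le> d) \<and>
     (\<exists>F. has_wgrad \<Omega> I F \<and> (AE x in lebesgue_on \<Omega>. norm (F x - s *\<^sub>R \<Gamma> i x) \<le> d)))"
      by (rule interpolation_converges[OF \<Omega>(1,2) mesh sr sd sc d(1)])
    then show ?thesis unfolding R_def by blast
  qed
  then obtain h0 where h0: "\<And>i. h0 i > 0" "\<And>i h. h \<in> H \<Longrightarrow> h < h0 i \<Longrightarrow> \<exists>I F. R i h I F" by metis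
  obtain hm where hm: "hm > 0" "\<And>i. hm \<le> h0 i"
    using finite_positive_lower_bound[of "UNIV::'n set" h0] h0(1) by auto
  have "\<exists>v. (\<forall>i. (\<lambda>x. v x $ i) \<in> P1_elements \<Omega> (\<T> h)) \<and>
    (\<forall>x\<in>closure \<Omega>. N (v x) \<le> \<alpha> x) \<and> H1_vec_norm \<Omega> (v - w) < e" if h: "h \<in> H" "h < hm" for h
  proof -
    have "h < h0 i" for i using h(2) hm(2)[of i] by linarith
    then have "\<forall>i. \<exists>I F. R i h I F" using h0(2)[OF h(1)] by blast
    then obtain I F where IF: "\<And>i. R i h (I i) (F i)" by metis
    have I: "\<And>i. I i \<in> P1_elements \<Omega> (\<T> h)" "\<And>i x. x \<in> closure \<Omega> \<Longrightarrow>
        \<bar>I i x - s * g i x\<bar> \<le> d"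
       "\<And>i. has_wgrad \<Omega> (I i) (F i)" "\<And>i. AE x in lebesgue_on \<Omega>. norm (F i x - s *\<^sub>R \<Gamma> i x) \<le> d"
      using IF unfolding R_def by blast+
    define v where "v x = (\<chi> i. I i x)" for x
    have vi: "v x $ i = I i x" for x i by (simp add: v_def)
    have Nv: "N (v x) \<le> \<alpha> x" if x: "x \<in> closure \<Omega>" for x
    proof -
      define \<gamma> where "\<gamma> = (\<chi> i. g i x)"
      have "norm (v x - s *\<^sub>R \<gamma>) \<le> (\<Sum>i\<in>UNIV. \<bar>(v x - s *\<^sub>R \<gamma>) $ i\<bar>)" by (rule norm_le_l1_cart)
      also have "\<dots> \<le> (\<Sum>i\<in>(UNIV::'n set). d)" using I(2)[OF x] by (intro sum_mono) (simp add: vi \<gamma>_def)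
      finally have "norm (v x - s *\<^sub>R \<gamma>) \<le> n * d" by (simp add: n_def)
      then have "N (v x - s *\<^sub>R \<gamma>) \<le> C * (n * d)" using C(2)[of "v x - s *\<^sub>R \<gamma>"] C(1) by
          (meson less_imp_le mult_left_mono order_trans)
      moreover have "N (s *\<^sub>R \<gamma>) = s * N \<gamma>" using N s unfolding seminorm_on_vec_def by simp
      moreover have "s * N \<gamma> \<le> s * (\<alpha> x + e2)" using g(5)[OF x] s by (intro mult_left_mono) (auto simp: \<gamma>_def)
      moreover have "s * (\<alpha> x + e2) \<le> \<alpha> x - \<theta> * a + \<theta> * a / 2"
      proof -
        have "s * e2 \<le> 1 * e2" using s e2 by (intro mult_right_mono) auto
        moreover have "\<theta> * a \<le> \<theta> * \<alpha> x" using a(2)[OF x] \<theta> by simp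
        ultimately show ?thesis using e2(3) by (simp add: s_def algebra_simps)
      qed
      ultimately show ?thesis using seminorm_diff_le[OF N, of "v x" "s *\<^sub>R \<gamma>"] dC by linarith
    qed
    have err: "(H1_norm \<Omega> (\<lambda>x. (v - w) x $ i))\<^sup>2 \<le> 2 * e1" for i
    proof -
      have gw: "has_wgrad \<Omega> (g i) (\<Gamma> i)" by (rule C1_has_wgrad[OF \<Omega>(1,2) mesh(1)[OF h(1)] g(1,2)])
      have L: "I i \<in> L2 \<Omega>" "F i \<in> L2 \<Omega>" "g i \<in> L2 \<Omega>" "\<Gamma> i \<in> L2 \<Omega>"
          "(\<lambda>x. w x $ i) \<in> L2 \<Omega>" "G i \<in> L2 \<Omega>"
        using I(3)[of i] gw G[of i] by (auto simp: has_wgrad_def)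
      have th: "0 \<le> \<theta>" "\<theta> \<le> 1" "0 \<le> d" using \<theta> \<theta>1 d by auto
      have A1: "AE x in lebesgue_on \<Omega>. norm (I i x - (1 - \<theta>) *\<^sub>R g i x) \<le> d"
        using I(2) closure_subset by (intro AE_I2) (auto simp: space_restrict_space s_def)
      have A2: "AE x in lebesgue_on \<Omega>. norm (F i x - (1 - \<theta>) *\<^sub>R \<Gamma> i x) \<le> d" using I(4) by (simp add: s_def)
      note p1 = perturbed_L2_error[OF \<Omega>(2) \<Omega>s L(1,3,5) th d(2) A1, folded \<mu>_def]
      note p2 = perturbed_L2_error[OF \<Omega>(2) \<Omega>s L(2,4,6) th d(2) A2, folded \<mu>_def]
      have tW: "2 * \<theta> * (LINT x|lebesgue_on \<Omega>. (w x $ i)\<^sup>2) \<le> e1 / 8" "2 * \<theta> * (LINT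
          x|lebesgue_on \<Omega>. (norm (G i x))\<^sup>2) \<le> e1 / 8"
        using mult_left_mono[OF W(1)[of i] th(1)] mult_left_mono[OF W(2)[of i] th(1)] \<theta>W by auto
      have b1: "(LINT x|lebesgue_on \<Omega>. (I i x - w x $ i)\<^sup>2) \<le> e1"
        using p1 g(3)[of i] tW(1) d\<mu> e2(2) e1 by simp
      have b2: "(LINT x|lebesgue_on \<Omega>. (norm (F i x - G i x))\<^sup>2) \<le> e1"
        using p2 g(4)[of i] tW(2) d\<mu> e2(2) e1 by simp
      have "has_wgrad \<Omega> (\<lambda>x. v x $ i) (F i)" using I(3) by (simp add: vi)
      from has_wgrad_vec_diff[OF \<Omega>(2) \<Omega>s this G]
      have "(H1_norm \<Omega> (\<lambda>x. (v - w) x $ i))\<^sup>2 = (LINT x|lebesgue_on \<Omega>. ((v - w) x $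
          i)\<^sup>2) + (LINT x|lebesgue_on \<Omega>. (norm (F i x - G i x))\<^sup>2)"
        by (rule H1_norm_square[OF \<Omega>(1,2)])
      also have "\<dots> \<le> 2 * e1" using b1 b2 by (simp add: vi)
      finally show ?thesis .
    qed
    have "(H1_vec_norm \<Omega> (v - w))\<^sup>2 \<le> (\<Sum>i\<in>(UNIV::'n set). 2 * e1)"
      unfolding H1_vec_norm_square by (intro sum_mono err)
    also have "\<dots> = e\<^sup>2 / 2" using n by (simp add: e1_def n_def)
    also have "\<dots> < e\<^sup>2" using e by simp
    finally have "H1_vec_norm \<Omega> (v - w) < e" using e by (simp add: power_less_imp_less_base)
    moreover have "(\<lambda>x. v x $ i) \<in> P1_elements \<Omega> (\<T> h)" for i using I(1) by (simp add: vi)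
    ultimately show ?thesis using Nv by blast
  qed
  then show ?thesis using hm(1) by blast
qed

text \<open>Partial sums of the thresholds, each increased by 1, are strictly increasing and
  dominate every threshold.\<close>

lemma eventually_diagonal_subseq:
  assumes "\<And>m::nat. eventually (P m) sequentially"
  shows "\<exists>r::nat \<Rightarrow> nat. strict_mono r \<and> (\<forall>m. P m (r m))"
proof -
  obtain M where M: "\<And>m n. M m \<le> n \<Longrightarrow> P m n" using assms unfolding eventually_sequentially by metis
  define r where "r m = (\<Sum>i\<le>m. M i + 1)" for m
  have "strict_mono r" by (rule strict_monoI_Suc) (simp add: r_def)
  moreover have "M m \<le> r m" for m
    unfolding r_def using member_le_sum[of m "{..m}" "\<lambda>i. M i + 1"] by simp
  ultimately show ?thesis using M by blast
qed

section \<open>Mosco convergence for a general set of constraint points\<close>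

text \<open>The two conditions on \<open>X\<close> split between the two halves: lying in the
  closure makes the recovered functions admissible, and meeting every cell provides the point \<xi>
  that \<open>weak_limit_constraint\<close> asks for.\<close>

lemma P1_constrained_mosco:
  fixes \<Omega> :: "(real^'d::finite) set" and X :: "real \<Rightarrow> (real^'d) set"
  assumes \<Omega>: "open \<Omega>" "bounded \<Omega>" "\<Omega> \<noteq> {}" "lipschitz_boundary \<Omega>"
    and mesh: "\<And>h. h \<in> H \<Longrightarrow> conformal_simplicial_mesh \<Omega> (\<T> h)" "\<And>h. h \<in> H
        \<Longrightarrow> mesh_size (\<T> h) = h" "\<And>h. h \<in> H \<Longrightarrow> 0 < h"
    and sr: "shape_regular H \<T>"
    and \<alpha>: "continuous_on (closure \<Omega>) \<alpha>" and a: "0 < a" "\<And>x. x \<in> closure \<Omega> \<Longrightarrow> a \<le> \<alpha> x"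
    and p: "1 \<le> p"
    and X: "\<And>h. h \<in> H \<Longrightarrow> X h \<subseteq> closure \<Omega>" "\<And>h T. h \<in> H
        \<Longrightarrow> T \<in> \<T> h \<Longrightarrow> X h \<inter> T \<noteq> {}"
  shows "mosco_converges_mesh (H1_vec \<Omega>) (H1_vec_norm \<Omega>) H
    (\<lambda>h. ae_classes \<Omega> (P1_constrained \<Omega> (\<T> h) (lp_norm p) \<alpha> (X h))) (K_cont \<Omega> p
        \<alpha> :: (real^'d \<Rightarrow> real^'n::finite) set)"
  unfolding mosco_converges_mesh_def
proof (intro allI impI, elim conjE)
  fix h :: "nat \<Rightarrow> real" assume h: "\<forall>n. h n \<in> H" "h \<longlonglongrightarrow> 0"
  let ?K = "\<lambda>n. ae_classes \<Omega> (P1_constrained \<Omega> (\<T> (h n)) (lp_norm p) \<alpha> (X (h n))) ::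
      (real^'d \<Rightarrow> real^'n) set"
  have hH: "h n \<in> H" for n using h(1) by blast
  note N = lp_norm_seminorm[OF p, where 'n='n]
  have \<alpha>0: "0 \<le> \<alpha> x" if "x \<in> closure \<Omega>" for x using a(1) a(2)[OF that] by linarith
  show "mosco_converges (H1_vec \<Omega>) (H1_vec_norm \<Omega>) ?K (K_cont \<Omega> p \<alpha> :: (real^'d \<Rightarrow> real^'n) set)"
    unfolding mosco_converges_def
  proof (intro conjI allI ballI impI)
    show "nonempty_closed_convex (H1_vec \<Omega>) (H1_vec_norm \<Omega>) (K_cont \<Omega> p \<alpha> :: (real^'d \<Rightarrow> real^'n) set)"
      by (rule K_cont_nonempty_closed_convex[OF \<Omega>(1,2) p]) (use \<alpha>0 closure_subset in auto)
    show "nonempty_closed_convex (H1_vec \<Omega>) (H1_vec_norm \<Omega>) (?K n)" for n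
      by (rule P1_constrained_nonempty_closed_convex[OF \<Omega>(1,2) mesh(1)[OF hH] N X(1)[OF hH] \<alpha>0])
  next
    fix w :: "real^'d \<Rightarrow> real^'n" assume w: "w \<in> K_cont \<Omega> p \<alpha>"
    then have wV: "w \<in> H1_vec \<Omega>" and wc: "AE x in lebesgue_on \<Omega>. lp_norm p (w x) \<le> \<alpha> x" by (auto simp: K_cont_def)
    \<comment> \<open>Each tolerance 1/(m+1) is reached for all large n; a diagonal choice of
      indices lets the tolerance tend to 0 along a subsequence.\<close>
    have "eventually (\<lambda>n. \<exists>v\<in>?K n. H1_vec_norm \<Omega> (v - w) < 1 / real (Suc m)) sequentially" for m
    proof -
      have "\<exists>h0>0. \<forall>h\<in>H. h < h0 \<longrightarrow> (\<exists>v. (\<forall>i. (\<lambda>x. v x $ i)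
          \<in> P1_elements \<Omega> (\<T> h)) \<and>
          (\<forall>x\<in>closure \<Omega>. lp_norm p (v x) \<le> \<alpha> x) \<and> H1_vec_norm \<Omega> (v - w) < 1 / real (Suc m))"
        by (rule P1_constrained_recovery[OF \<Omega>(1,2,4) mesh sr N \<alpha> a wV wc]) auto
      then obtain h0 where h0: "h0 > 0" "\<And>h. h \<in> H \<Longrightarrow> h < h0 \<Longrightarrow> \<exists>v.
          (\<forall>i. (\<lambda>x. v x $ i) \<in> P1_elements \<Omega> (\<T> h)) \<and>
          (\<forall>x\<in>closure \<Omega>. lp_norm p (v x) \<le> \<alpha> x) \<and> H1_vec_norm \<Omega> (v - w) < 1 / real (Suc m)" by blast
      have "eventually (\<lambda>n. h n < h0) sequentially" using h(2) h0(1) by (rule order_tendstoD)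
      then show ?thesis
      proof eventually_elim
        case (elim n)
        then obtain v where v: "\<And>i. (\<lambda>x. v x $ i) \<in> P1_elements \<Omega> (\<T> (h n))" "\<And>x. x
            \<in> closure \<Omega> \<Longrightarrow> lp_norm p (v x) \<le> \<alpha> x"
          "H1_vec_norm \<Omega> (v - w) < 1 / real (Suc m)" using h0(2)[OF hH] by blast
        have "v \<in> P1_constrained \<Omega> (\<T> (h n)) (lp_norm p) \<alpha> (X (h n))"
          using v(1,2) X(1)[OF hH] by (auto simp: P1_constrained_def)
        then have "v \<in> ?K n" by (rule ae_classesI) simp
        with v(3) show ?case by blast
      qed
    qed
    from eventually_diagonal_subseq[where P="\<lambda>m n. \<exists>v\<in>?K n. H1_vec_norm \<Omega> (v - w) < 1 / real (Suc m)", OF this]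
    obtain r where r: "strict_mono r"
      "\<forall>m. \<exists>v\<in>?K (r m). H1_vec_norm \<Omega> (v - w) < 1 / real (Suc m)" by blast
    then obtain u where u: "\<And>m. u m \<in> ?K (r m)" "\<And>m. H1_vec_norm \<Omega> (u m - w) < 1 / real (Suc m)" by metis
    have "(\<lambda>m. H1_vec_norm \<Omega> (u m - w)) \<longlonglongrightarrow> 0"
    proof (rule tendsto_sandwich[OF _ _ tendsto_const])
      show "(\<lambda>m. 1 / real (Suc m)) \<longlonglongrightarrow> 0" using LIMSEQ_inverse_real_of_nat by (simp add: inverse_eq_divide)
      show "\<forall>\<^sub>F m in sequentially. H1_vec_norm \<Omega> (u m - w) \<le> 1 / real (Suc m)"
        using u(2) by (intro always_eventually allI less_imp_le)
      show "\<forall>\<^sub>F m in sequentially. 0 \<le> H1_vec_norm \<Omega> (u m - w)"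
        by (simp add: H1_vec_norm_def sum_nonneg)
    qed
    then have "strongly_converges (H1_vec_norm \<Omega>) u w" by (simp add: strongly_converges_def)
    with r(1) u(1) show "\<exists>r. strict_mono r \<and> (\<exists>u. (\<forall>k. u k \<in> ?K (r k)) \<and>
        strongly_converges (H1_vec_norm \<Omega>) u w)" by blast
  next
    fix r :: "nat \<Rightarrow> nat" and u :: "nat \<Rightarrow> real^'d \<Rightarrow> real^'n" and w
    assume w: "w \<in> H1_vec \<Omega>"
      and A: "strict_mono r \<and> (\<forall>k. u k \<in> ?K (r k)) \<and> weakly_converges (H1_vec \<Omega>) (H1_vec_norm \<Omega>) u w"
    have "\<forall>k. \<exists>v. v \<in> P1_constrained \<Omega> (\<T> (h (r k))) (lp_norm p) \<alpha> (X (h (r k)))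
        \<and> (AE x in lebesgue_on \<Omega>. u k x = v x)"
      using A unfolding ae_classes_def by blast
    then obtain v where v: "\<And>k. v k \<in> P1_constrained \<Omega> (\<T> (h (r k))) (lp_norm p) \<alpha> (X (h (r k)))"
      "\<And>k. AE x in lebesgue_on \<Omega>. u k x = v k x" by metis
    have "AE x in lebesgue_on \<Omega>. lp_norm p (w x) \<le> \<alpha> x"
    proof (rule weak_limit_constraint[OF \<Omega>(1-3) N \<alpha> mesh(1)[OF hH] _ _ _ v(2) _ w])
      have "(\<lambda>k. h (r k)) \<longlonglongrightarrow> 0" using LIMSEQ_subseq_LIMSEQ[OF h(2), of r] A by (simp add: o_def)
      then show "(\<lambda>k. mesh_size (\<T> (h (r k)))) \<longlonglongrightarrow> 0" by (simp add: mesh(2)[OF hH])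
      show "(\<lambda>x. v k x $ i) \<in> P1_elements \<Omega> (\<T> (h (r k)))" for k i using v(1)[of k] by (auto simp: P1_constrained_def)
      show "\<exists>\<xi>\<in>T. lp_norm p (v k \<xi>) \<le> \<alpha> \<xi>" if T: "T \<in> \<T> (h (r k))" for k T
        using X(2)[OF hH T] v(1)[of k] unfolding P1_constrained_def by blast
      show "weakly_converges (H1_vec \<Omega>) (H1_vec_norm \<Omega>) u w" using A by blast
    qed
    with w show "w \<in> K_cont \<Omega> p \<alpha>" by (simp add: K_cont_def)
  qed
qed

lemma midpoint_of_mem:
  assumes "conformal_simplicial_mesh \<Omega> \<T>" "T \<in> \<T>"
  shows "midpoint_of T \<in> T"
proof -
  obtain C where C: "finite C" "C \<noteq> {}" "T = convex hull C" "vertices T = C" using mesh_cell(6)[OF assms] by blast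
  have "(\<Sum>v\<in>C. (1 / real (card C)) *\<^sub>R v) \<in> convex hull C"
  proof (rule convex_sum[OF C(1) convex_convex_hull])
    show "v \<in> convex hull C" if "v \<in> C" for v using that by (rule hull_inc)
  qed (use C in auto)
  then show ?thesis using C(3,4) by (simp add: midpoint_of_def scaleR_sum_right)
qed

theorem theorem1:
  fixes \<Omega> :: "(real^'d::finite) set"
    and H :: "real set"
    and \<T> :: "real \<Rightarrow> (real^'d) set set"
    and \<alpha> :: "real^'d \<Rightarrow> real"
    and p :: ereal
  assumes "open \<Omega>" and "connected \<Omega>" and "\<Omega> \<noteq> {}" and "bounded \<Omega>"
    and "lipschitz_boundary \<Omega>" and "polyhedral \<Omega>"
    and "\<And>h. h \<in> H \<Longrightarrow> 0 < h"
    and "\<And>h. h \<in> H \<Longrightarrow> conformal_simplicial_mesh \<Omega> (\<T> h)"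
    and "\<And>h. h \<in> H \<Longrightarrow> mesh_size (\<T> h) = h"
    and "shape_regular H \<T>"
    and "continuous_on (closure \<Omega>) \<alpha>"
    and "(INF x\<in>\<Omega>. \<alpha> x) > 0"
    and "1 \<le> p"
  shows "mosco_converges_mesh (H1_vec \<Omega>) (H1_vec_norm \<Omega>) H
           (\<lambda>h. ae_classes \<Omega> (K_midpoint \<Omega> (\<T> h) p \<alpha>))
           (K_cont \<Omega> p \<alpha> :: (real^'d \<Rightarrow> real^'n::finite) set)
       \<and> mosco_converges_mesh (H1_vec \<Omega>) (H1_vec_norm \<Omega>) H
           (\<lambda>h. ae_classes \<Omega> (K_nodal \<Omega> (\<T> h) p \<alpha>))
           (K_cont \<Omega> p \<alpha> :: (real^'d \<Rightarrow> real^'n::finite) set)"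
proof -
  define a where "a = (INF x\<in>\<Omega>. \<alpha> x)"
  have "compact (closure \<Omega>)" using assms(4) by (simp add: compact_closure)
  \<comment> \<open>A real infimum is a lower bound only for sets bounded below; here compactness of
    the closure provides this.\<close>
  then have "bounded (\<alpha> ` closure \<Omega>)" using assms(11) compact_continuous_image compact_imp_bounded by blast
  then have "bounded (\<alpha> ` \<Omega>)" by (rule bounded_subset) (use closure_subset in blast)
  then have "bdd_below (\<alpha> ` \<Omega>)" by (rule bounded_imp_bdd_below)
  then have le: "a \<le> \<alpha> x" if "x \<in> \<Omega>" for x unfolding a_def using that by (rule cINF_lower)
  \<comment> \<open>Nodes may lie on the boundary, so the lower bound is extended to the closure by
    continuity.\<close>
  have a: "a \<le> \<alpha> x" if "x \<in> closure \<Omega>" for x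
    using continuous_ge_on_closure[OF assms(11) that] le by blast
  have mid: "K_midpoint \<Omega> (\<T> h) p \<alpha> = P1_constrained \<Omega> (\<T> h) (lp_norm p) \<alpha> (midpoint_of ` \<T> h)" for h
    by (auto simp: K_midpoint_def P1_constrained_def)
  have nod: "K_nodal \<Omega> (\<T> h) p \<alpha> = P1_constrained \<Omega> (\<T> h) (lp_norm p) \<alpha> (mesh_nodes (\<T> h))" for h
    by (auto simp: K_nodal_def P1_constrained_def)
  note base = assms(1,4,3,5) assms(8,9,7) assms(10,11)
  have a0: "0 < a" using assms(12) by (simp add: a_def)
  have vT: "vertices T \<subseteq> T" for T :: "(real^'d) set" by (auto simp: vertices_def extreme_point_of_def)
  show ?thesis unfolding mid nod
  proof
    show "mosco_converges_mesh (H1_vec \<Omega>) (H1_vec_norm \<Omega>) H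
        (\<lambda>h. ae_classes \<Omega> (P1_constrained \<Omega> (\<T> h) (lp_norm p) \<alpha> (midpoint_of ` \<T> h)))
        (K_cont \<Omega> p \<alpha> :: (real^'d \<Rightarrow> real^'n) set)"
    proof (rule P1_constrained_mosco[OF base a0 a assms(13)])
      show "midpoint_of ` \<T> h \<subseteq> closure \<Omega>" if "h \<in> H" for h
        using midpoint_of_mem[OF assms(8)[OF that]] mesh_cell(4)[OF assms(8)[OF that]] by blast
      show "midpoint_of ` \<T> h \<inter> T \<noteq> {}" if "h \<in> H" "T \<in> \<T> h" for h T
        using midpoint_of_mem[OF assms(8)[OF that(1)] that(2)] that(2) by blast
    qed
    show "mosco_converges_mesh (H1_vec \<Omega>) (H1_vec_norm \<Omega>) H
        (\<lambda>h. ae_classes \<Omega> (P1_constrained \<Omega> (\<T> h) (lp_norm p) \<alpha> (mesh_nodes (\<T> h))))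
        (K_cont \<Omega> p \<alpha> :: (real^'d \<Rightarrow> real^'n) set)"
    proof (rule P1_constrained_mosco[OF base a0 a assms(13)])
      show "mesh_nodes (\<T> h) \<subseteq> closure \<Omega>" if "h \<in> H" for h
        using vT mesh_cell(4)[OF assms(8)[OF that]] unfolding mesh_nodes_def by blast
      show "mesh_nodes (\<T> h) \<inter> T \<noteq> {}" if hT: "h \<in> H" "T \<in> \<T> h" for h T
      proof -
        obtain C where "C \<noteq> {}" "vertices T = C" using mesh_cell(6)[OF assms(8)[OF hT(1)] hT(2)] by blast
        then show ?thesis using vT[of T] hT(2) unfolding mesh_nodes_def by blast
      qed
    qed
  qed
qed

end
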